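(* Let $d\ge 2$. For any $\delta>0$, the set of even integers $n$ for which $$\mathsf{W}^{3,\mathsf{E}}_n\big(\Gamma\text{ closes}\big)\le n^{-(1-1/d)+\delta}$$ has limiting density equal to one.
   Context: A nearest neighbour walk of length $n$ in $\mathbb{Z}^d$ is a map $\gamma:\{0,\dots,n\}\to\mathbb{Z}^d$ with $\|\gamma(i+1)-\gamma(i)\|=1$ for each $i$. It is $3$-edge self-avoiding if it traverses each unordered nearest-neighbour edge of $\mathbb{Z}^d$ at most three times in total (counting both directions); vertices may be revisited. $\mathrm{SAW}^{3,\mathsf{E}}_n$ is the set of $3$-edge self-avoiding walks of length $n$ with $\gamma(0)=0$, $\mathsf{W}^{3,\mathsf{E}}_n$ is the uniform probability law on this set, and $\Gamma$ denotes the random walk with this law. A walk $\gamma\in\mathrm{SAW}^{3,\mathsf{E}}_n$ closes if $\|\gamma(n)\|=0$, i.e. $\gamma(n)=0$. The limit supremum density of a set $A$ of even integers is $\limsup_n n^{-1}|A\cap[0,2n]|$; the limit infimum density is the corresponding $\liminf$. When the two are equal, the common value is called the limiting density. *)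

theory Defs
  imports "HOL-Probability.Probability"
begin

(* The lattice Z^d is the type int ^ 'd with d = CARD('d).  Since int ^ 'd carries no
   norm in the library, the Euclidean norm is taken after embedding into real ^ 'd. *)

definition znorm :: "int ^ 'd::finite \<Rightarrow> real" where
  "znorm x = norm ((\<chi> i. real_of_int (x $ i)) :: real ^ 'd)"

(* A map on {0..n} is an extensional function: its value is undefined outside {0..n},
   so that a set of walks of length n is a set of maps {0..n} -> Z^d. *)

definition nn_walk :: "nat \<Rightarrow> (nat \<Rightarrow> int ^ 'd::finite) \<Rightarrow> bool" where
  "nn_walk n \<gamma> \<longleftrightarrow>
     \<gamma> \<in> {0..n} \<rightarrow>\<^sub>E UNIV \<and> (\<forall>i<n. znorm (\<gamma> (i + 1) - \<gamma> i) = 1)"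

definition nn_edges :: "(int ^ 'd::finite) set set" where
  "nn_edges = {{x, y} | x y. znorm (x - y) = 1}"

definition edge_self_avoiding :: "nat \<Rightarrow> nat \<Rightarrow> (nat \<Rightarrow> int ^ 'd::finite) \<Rightarrow> bool" where
  "edge_self_avoiding k n \<gamma> \<longleftrightarrow>
     (\<forall>e\<in>nn_edges. card {i \<in> {0..<n}. {\<gamma> i, \<gamma> (i + 1)} = e} \<le> k)"

definition SAW3E :: "nat \<Rightarrow> (nat \<Rightarrow> int ^ 'd::finite) set" where
  "SAW3E n = {\<gamma>. nn_walk n \<gamma> \<and> edge_self_avoiding 3 n \<gamma> \<and> \<gamma> 0 = 0}"

(* pmf_of_set is the uniform law only on finite nonempty sets; see finite_SAW3E and
   SAW3E_nonempty below. *)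

definition W3E :: "nat \<Rightarrow> (nat \<Rightarrow> int ^ 'd::finite) pmf" where
  "W3E n = pmf_of_set (SAW3E n)"

definition closes :: "nat \<Rightarrow> (nat \<Rightarrow> int ^ 'd::finite) \<Rightarrow> bool" where
  "closes n \<gamma> \<longleftrightarrow> znorm (\<gamma> n) = 0"

(* Densities of a set of even natural numbers: [0,2n] contains n + 1 even numbers,
   whence the normalisation by n. *)

definition limsup_density :: "nat set \<Rightarrow> ereal" where
  "limsup_density A = limsup (\<lambda>n. ereal (real (card (A \<inter> {0..2 * n})) / real n))"

definition liminf_density :: "nat set \<Rightarrow> ereal" where
  "liminf_density A = liminf (\<lambda>n. ereal (real (card (A \<inter> {0..2 * n})) / real n))"

definition has_limiting_density :: "nat set \<Rightarrow> real \<Rightarrow> bool" where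
  "has_limiting_density A \<rho> \<longleftrightarrow>
     limsup_density A = ereal \<rho> \<and> liminf_density A = ereal \<rho>"

lemma abs_nth_le_znorm:
  fixes x :: "int ^ 'd::finite"
  shows "real_of_int \<bar>x $ i\<bar> \<le> znorm x"
  using component_le_norm_cart[of "(\<chi> i. real_of_int (x $ i)) :: real ^ 'd" i]
  by (simp add: znorm_def)

lemma znorm_eq_0_iff: "znorm x = 0 \<longleftrightarrow> x = 0"
  by (simp add: znorm_def vec_eq_iff)

lemma nn_walk_coord_bound:
  assumes "nn_walk n \<gamma>" "\<gamma> 0 = 0" "j \<le> n"
  shows "\<bar>\<gamma> j $ i\<bar> \<le> int j"
  using assms(3)
proof (induction j)
  case (Suc j)
  have "real_of_int \<bar>(\<gamma> (Suc j) - \<gamma> j) $ i\<bar> \<le> 1"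
    using abs_nth_le_znorm[of "\<gamma> (Suc j) - \<gamma> j" i] assms(1) Suc.prems
    by (simp add: nn_walk_def)
  hence "\<bar>\<gamma> (Suc j) $ i - \<gamma> j $ i\<bar> \<le> 1" by simp
  moreover have "\<bar>\<gamma> j $ i\<bar> \<le> int j" using Suc by simp
  ultimately show ?case by linarith
qed (simp add: assms(2))

lemma finite_SAW3E: "finite (SAW3E n :: (nat \<Rightarrow> int ^ 'd::finite) set)"
proof -
  let ?B = "{x :: int ^ 'd. \<forall>i. x $ i \<in> {- int n..int n}}"
  have "vec_nth ` ?B \<subseteq> (UNIV \<rightarrow>\<^sub>E {- int n..int n})" by (auto simp: PiE_iff)
  hence "finite (vec_nth ` ?B)" by (rule finite_subset) (intro finite_PiE, auto)
  hence "finite ?B" by (rule finite_imageD) (auto simp: inj_on_def vec_eq_iff)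
  hence "finite ({0..n} \<rightarrow>\<^sub>E ?B)" by (intro finite_PiE) auto
  moreover have "SAW3E n \<subseteq> ({0..n} \<rightarrow>\<^sub>E ?B)"
  proof
    fix \<gamma> :: "nat \<Rightarrow> int ^ 'd" assume g: "\<gamma> \<in> SAW3E n"
    have "\<gamma> j $ i \<in> {- int n..int n}" if "j \<le> n" for i j
      using nn_walk_coord_bound[of n \<gamma> j i] g that by (auto simp: SAW3E_def)
    hence "\<gamma> j \<in> ?B" if "j \<le> n" for j using that by blast
    moreover have "\<gamma> \<in> extensional {0..n}"
      using g by (simp add: SAW3E_def nn_walk_def PiE_iff)
    ultimately show "\<gamma> \<in> {0..n} \<rightarrow>\<^sub>E ?B" unfolding PiE_iff by simp
  qed
  ultimately show ?thesis by (rule finite_subset[rotated])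
qed

lemma SAW3E_nonempty: "(SAW3E n :: (nat \<Rightarrow> int ^ 'd::finite) set) \<noteq> {}"
proof -
  fix k :: 'd
  define \<gamma> :: "nat \<Rightarrow> int ^ 'd" where
    "\<gamma> = restrict (\<lambda>j. axis k (int j)) {0..n}"
  have inj: "i = j" if "{\<gamma> i, \<gamma> (i + 1)} = {\<gamma> j, \<gamma> (j + 1)}" "i < n" "j < n" for i j
    using that by (auto simp: \<gamma>_def doubleton_eq_iff axis_eq_axis)
  have "card {i \<in> {0..<n}. {\<gamma> i, \<gamma> (i + 1)} = e} \<le> 3" for e
  proof -
    have "card {i \<in> {0..<n}. {\<gamma> i, \<gamma> (i + 1)} = e} \<le> Suc 0"
      by (rule card_le_Suc0_iff_eq[THEN iffD2]) (use inj in auto)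
    thus ?thesis by simp
  qed
  moreover have "znorm (\<gamma> (i + 1) - \<gamma> i) = 1" if "i < n" for i
  proof -
    have "(\<chi> l. real_of_int ((\<gamma> (i + 1) - \<gamma> i) $ l)) = (axis k 1 :: real ^ 'd)"
      using that by (auto simp: \<gamma>_def vec_eq_iff axis_def)
    thus ?thesis by (simp add: znorm_def)
  qed
  moreover have "\<gamma> 0 = 0" by (simp add: \<gamma>_def axis_def vec_eq_iff)
  moreover have "\<gamma> \<in> {0..n} \<rightarrow>\<^sub>E UNIV" by (simp add: \<gamma>_def)
  ultimately have "\<gamma> \<in> SAW3E n"
    by (simp add: SAW3E_def nn_walk_def edge_self_avoiding_def)
  thus ?thesis by blast
qed

end

theory Submission
  imports Defs "HOL-Real_Asymp.Real_Asymp"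
begin

text \<open>Let \<open>c n\<close> count the closed walks and let \<open>\<mu>\<close> be the connective constant, so that at least
  \<open>\<mu> ^ n\<close> walks of length \<open>n\<close> exist and it suffices to bound \<open>a n = c n / (n * \<mu> ^ n)\<close>, the
  number of unrooted polygons in units of \<open>\<mu> ^ n\<close>, by \<open>n powr (- (2 - 1 / d) + \<delta>)\<close>.
  Two polygons of lengths of order \<open>X\<close> can be joined by a doubly traversed edge in about
  \<open>X powr (1 - 1 / d)\<close> relative positions, since some coordinate projection is that large
  (Loomis--Whitney).  The joining edge separates the lowest from the highest vertex, being
  traversed once on the way up and once on the way down.  Polygons with many such edges are
  rare: traversing any subset of them three times on the way up, and reflecting the way down,
  gives a bridge, and the subset can be recovered because its edges have total multiplicity
  four.  As there are at most \<open>\<mu> ^ n\<close> bridges, a typical polygon has only logarithmically many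
  such edges, so joining is almost injective and
  \<open>a (m + n + 6)\<close> is at least of order \<open>X powr (2 - 1 / d) * a m * a n\<close> when summed over a
  positive density of pairs.  If \<open>a n \<ge> n powr (- (2 - 1 / d) + \<delta>)\<close> at a positive density of
  lengths in one window, the excess \<open>\<delta>\<close> therefore nearly doubles in the next one, and after boundedly many
  steps this contradicts the polynomial upper bound on \<open>a\<close>.\<close>

section \<open>Walks as lists of vertices\<close>


text \<open>The multiplicity bound three drives the marking. A joining edge is used twice, so
  vertex-disjoint polygons with adjacent vertices can always be joined. Tripling its upward
  traversal gives 3 + 1 traversals, more than any polygon allows, so marks are recognisable; the
  unfolded walk is still legal because the reflection puts the other traversal on a different edge.
  A mark lengthens the walk by two steps, whence the base \<open>1 + 1 / \<mu>\<^sup>2\<close> of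
  the exponential moment.

  The number \<open>\<mu>\<close> bounds walks from below and bridges from above; no rate of
  convergence of the walk count is available. This is why every upper bound, even the crude one on
  polygons, has to pass through bridges.

  The critical exponent is the fixed point of joining. With q = 1 - 1/d, a sum N is reached by about
  X pairs of lengths, each with about X powr q positions. So \<open>a\<close> of order X powr (-(1 +
  q) + x) at one scale forces X powr (-(1 + q) + 2 x) at the next, up to logarithms: an excess x > 0
  grows, whereas x = 0 is stable.\<close>

fun edges :: "'a list \<Rightarrow> 'a set multiset" where
  "edges [] = {#}"
| "edges [x] = {#}"
| "edges (x # y # zs) = add_mset {x, y} (edges (y # zs))"

lemma edges_append: "edges (xs @ a # ys) = edges (xs @ [a]) + edges (a # ys)"
proof (induction xs)
  case (Cons x xs)
  thus ?case by (cases xs) auto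
qed simp

text \<open>Both lists run round the same closed loop from different starting points; cutting each
  at the two junction vertices yields the same two arcs.\<close>

lemma edges_rotate: "edges (ys @ xs @ [hd (ys @ xs)]) = edges (xs @ ys @ [hd (xs @ ys)])"
proof (cases "xs = [] \<or> ys = []")
  case False
  then obtain x xs' y ys' where [simp]: "xs = x # xs'" "ys = y # ys'"
    by (meson neq_Nil_conv)
  show ?thesis
    using edges_append[of "x # xs'" y "ys' @ [x]"] edges_append[of "y # ys'" x "xs' @ [y]"]
    by simp
qed auto

lemma edges_map: "edges (map g xs) = image_mset ((`) g) (edges xs)"
  by (induction xs rule: edges.induct) auto

lemma size_edges: "size (edges xs) = length xs - 1"
  by (induction xs rule: edges.induct) auto

lemma edges_subset: "e \<in># edges xs \<Longrightarrow> e \<subseteq> set xs \<and> e \<noteq> {}"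
  by (induction xs rule: edges.induct) auto

lemma edges_nth: "edges w = image_mset (\<lambda>i. {w ! i, w ! (i + 1)}) (mset_set {0..<length w - 1})"
proof (induction w rule: edges.induct)
  case (3 x y zs)
  have "{0..<length (x # y # zs) - 1} = insert 0 (Suc ` {0..<length (y # zs) - 1})"
    by (simp add: image_Suc_atLeastLessThan atLeastLessThanSuc_atLeastAtMost) auto
  moreover have "mset_set (Suc ` {0..<length (y # zs) - 1})
      = image_mset Suc (mset_set {0..<length (y # zs) - 1})"
    by (simp add: image_mset_mset_set)
  ultimately have "mset_set {0..<length (x # y # zs) - 1}
      = add_mset 0 (image_mset Suc (mset_set {0..<length (y # zs) - 1}))"
    by simp
  thus ?case using 3 by (simp add: multiset.map_comp comp_def del: One_nat_def)
qed auto

definition admissible :: "(int ^ 'd::finite) set multiset \<Rightarrow> bool" where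
  "admissible M \<longleftrightarrow> set_mset M \<subseteq> nn_edges \<and> (\<forall>e. count M e \<le> 3)"

lemma znorm_minus_commute: "znorm (x - y) = znorm (y - x)"
proof -
  have "(\<chi> i. real_of_int ((x - y) $ i)) = - (\<chi> i. real_of_int ((y - x) $ i))"
    by (simp add: vec_eq_iff)
  thus ?thesis unfolding znorm_def by (metis norm_minus_cancel)
qed

lemma nn_edge_iff: "{x, y} \<in> nn_edges \<longleftrightarrow> znorm (x - y) = 1"
  unfolding nn_edges_def
  by (auto simp: doubleton_eq_iff znorm_minus_commute)

lemma nn_edge_image:
  assumes "\<And>x y. znorm (g x - g y) = znorm (x - y)"
  shows "e \<in> nn_edges \<Longrightarrow> g ` e \<in> nn_edges"
  using assms unfolding nn_edges_def by fastforce

lemma isometry_inj: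
  assumes "\<And>x y. znorm (g x - g y) = znorm (x - y)"
  shows "inj g"
proof (rule injI)
  fix x y assume "g x = g y"
  hence "znorm (x - y) = 0" using assms[of x y] znorm_eq_0_iff[of "0 :: int ^ 'b"] by simp
  thus "x = y" using znorm_eq_0_iff[of "x - y"] by simp
qed

text \<open>An isometry is injective on vertices, hence on edges, so multiplicities are carried over
  unchanged.\<close>

lemma admissible_image:
  assumes "\<And>x y. znorm (g x - g y) = znorm (x - y)" and "admissible M"
  shows "admissible (image_mset ((`) g) M)"
proof -
  have inj: "inj ((`) g)"
    using isometry_inj[of g] assms(1) by (simp add: inj_image_eq_iff inj_def)
  have "count (image_mset ((`) g) M) e \<le> 3" for e
  proof (cases "e \<in> range ((`) g)")
    case True
    then obtain e' where "e = g ` e'" by auto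
    moreover have "(`) g -` {g ` e'} = {e'}" using inj by (auto simp: inj_def)
    ultimately have "count (image_mset ((`) g) M) e = (\<Sum>x \<in> {e'} \<inter> set_mset M. count M x)"
      by (simp add: count_image_mset)
    also have "\<dots> \<le> count M e'" by (cases "e' \<in># M") auto
    finally show ?thesis using assms(2) by (meson admissible_def le_trans)
  next
    case False
    hence "count (image_mset ((`) g) M) e = 0" by (auto simp: count_eq_zero_iff)
    thus ?thesis by simp
  qed
  thus ?thesis using assms nn_edge_image[of g] by (auto simp: admissible_def)
qed

lemma admissible_mono: "M \<subseteq># N \<Longrightarrow> admissible N \<Longrightarrow> admissible M"
  unfolding admissible_def by (meson le_trans mset_subset_eq_count set_mset_mono subset_trans)

definition translate :: "int ^ 'd::finite \<Rightarrow> (int ^ 'd) list \<Rightarrow> (int ^ 'd) list" where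
  "translate v = map (\<lambda>x. x + v)"

lemma translate_simps [simp]:
  "length (translate v w) = length w"
  "set (translate v w) = (\<lambda>x. x + v) ` set w"
  "translate v (xs @ ys) = translate v xs @ translate v ys"
  "translate v (x # xs) = (x + v) # translate v xs"
  "translate v [] = []"
  "translate u (translate v w) = translate (v + u) w"
  "translate 0 w = w"
  "translate v w = [] \<longleftrightarrow> w = []"
  by (auto simp: translate_def add.assoc)

lemma hd_translate [simp]: "w \<noteq> [] \<Longrightarrow> hd (translate v w) = hd w + v"
  by (cases w) auto

lemma admissible_translate: "admissible (edges w) \<Longrightarrow> admissible (edges (translate v w))"
  unfolding translate_def edges_map by (rule admissible_image) auto

section \<open>Walks and closed walks as counted objects\<close>

definition walks :: "nat \<Rightarrow> (int ^ 'd::finite) list set" where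
  "walks n = {w. length w = Suc n \<and> hd w = 0 \<and> admissible (edges w)}"

text \<open>A closed walk of length \<open>n\<close> is stored as the cyclic list of its \<open>n\<close> vertices, without
  repeating the starting point at the end.\<close>

definition polygons :: "nat \<Rightarrow> (int ^ 'd::finite) list set" where
  "polygons n = {w. length w = n \<and> hd w = 0 \<and> admissible (edges (w @ [hd w]))}"

definition list_of_walk :: "nat \<Rightarrow> (nat \<Rightarrow> 'a) \<Rightarrow> 'a list" where
  "list_of_walk n \<gamma> = map \<gamma> [0..<Suc n]"

lemma length_list_of_walk [simp]: "length (list_of_walk n \<gamma>) = Suc n"
  by (simp add: list_of_walk_def)

lemma nth_list_of_walk [simp]: "i \<le> n \<Longrightarrow> list_of_walk n \<gamma> ! i = \<gamma> i"
  by (simp add: list_of_walk_def del: upt_Suc)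

lemma admissible_edges_list_of_walk:
  fixes \<gamma> :: "nat \<Rightarrow> int ^ 'd::finite"
  shows "admissible (edges (list_of_walk n \<gamma>)) \<longleftrightarrow>
    (\<forall>i<n. znorm (\<gamma> (i + 1) - \<gamma> i) = 1) \<and> edge_self_avoiding 3 n \<gamma>"
proof -
  have E: "edges (list_of_walk n \<gamma>) = image_mset (\<lambda>i. {\<gamma> i, \<gamma> (i + 1)}) (mset_set {0..<n})"
    unfolding edges_nth length_list_of_walk diff_Suc_1
    by (rule image_mset_cong) (auto simp: nth_list_of_walk)
  have c: "count (edges (list_of_walk n \<gamma>)) e = card {i \<in> {0..<n}. {\<gamma> i, \<gamma> (i + 1)} = e}" for e
    unfolding E count_image_mset
    by (auto simp: count_mset_set vimage_def Int_def intro!: arg_cong[where f = card])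
  have s: "set_mset (edges (list_of_walk n \<gamma>)) \<subseteq> nn_edges \<longleftrightarrow>
      (\<forall>i<n. znorm (\<gamma> (i + 1) - \<gamma> i) = 1)"
    unfolding E by (auto simp: nn_edge_iff image_subset_iff znorm_minus_commute)
  \<comment> \<open>Sets outside \<open>nn_edges\<close> have count 0; this reconciles the bound
    over all sets in \<open>admissible\<close> with the one over lattice edges in
    \<open>edge_self_avoiding\<close>.\<close>
  have "card {i \<in> {0..<n}. {\<gamma> i, \<gamma> (i + 1)} = e} \<le> 3"
    if "set_mset (edges (list_of_walk n \<gamma>)) \<subseteq> nn_edges" "e \<notin> nn_edges" for e
  proof -
    have "count (edges (list_of_walk n \<gamma>)) e = 0"
      using that by (metis count_inI subsetD)
    thus ?thesis using c[of e] by linarith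
  qed
  thus ?thesis unfolding admissible_def c edge_self_avoiding_def s[symmetric] by blast
qed

lemma bij_list_of_walk:
  "bij_betw (list_of_walk n) (SAW3E n) (walks n :: (int ^ 'd::finite) list set)"
proof (rule bij_betwI')
  fix x y :: "nat \<Rightarrow> int ^ 'd"
  assume x: "x \<in> SAW3E n" and y: "y \<in> SAW3E n"
  have xy: "x \<in> {0..n} \<rightarrow>\<^sub>E UNIV" "y \<in> {0..n} \<rightarrow>\<^sub>E UNIV"
    using x y by (auto simp: SAW3E_def nn_walk_def)
  show "(list_of_walk n x = list_of_walk n y) = (x = y)"
  proof
    assume "list_of_walk n x = list_of_walk n y"
    hence "x i = y i" if "i \<in> {0..n}" for i using that nth_list_of_walk[of i n] by (metis atLeastAtMost_iff)
    thus "x = y" using xy by (intro PiE_ext[of x "{0..n}" "\<lambda>_. UNIV" y]) auto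
  qed simp
next
  fix x :: "nat \<Rightarrow> int ^ 'd"
  assume x: "x \<in> SAW3E n"
  have "hd (list_of_walk n x) = x 0"
    using nth_list_of_walk[of 0 n x] hd_conv_nth[of "list_of_walk n x"]
    by (metis length_list_of_walk length_0_conv nat.distinct(1) zero_le)
  thus "list_of_walk n x \<in> walks n"
    using x admissible_edges_list_of_walk[of n x] by (simp add: SAW3E_def walks_def nn_walk_def)
next
  fix w :: "(int ^ 'd) list"
  assume w: "w \<in> walks n"
  define x where "x = restrict (\<lambda>i. w ! i) {0..n}"
  have lw: "list_of_walk n x = w"
    using w by (intro nth_equalityI) (auto simp: walks_def x_def)
  have "x 0 = 0" using w by (cases w) (auto simp: walks_def x_def)
  moreover have "x \<in> {0..n} \<rightarrow>\<^sub>E UNIV" by (simp add: x_def)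
  ultimately have "x \<in> SAW3E n"
    using w admissible_edges_list_of_walk[of n x] lw
    by (simp add: SAW3E_def walks_def nn_walk_def)
  thus "\<exists>x\<in>SAW3E n. w = list_of_walk n x" using lw by blast
qed

lemma finite_walks: "finite (walks n)"
  using bij_betw_finite[OF bij_list_of_walk] finite_SAW3E by blast

lemma walks_card_pos: "card (walks n :: (int ^ 'd::finite) list set) \<ge> 1"
  using bij_betw_same_card[OF bij_list_of_walk, of n] finite_SAW3E[of n] SAW3E_nonempty[of n]
  by (metis card_0_eq less_one linorder_not_le)

lemma polygons_snoc_walks: "w \<in> polygons n \<Longrightarrow> n \<ge> 1 \<Longrightarrow> w @ [hd w] \<in> walks n"
  by (cases w) (auto simp: polygons_def walks_def)

lemma finite_polygons: "n \<ge> 1 \<Longrightarrow> finite (polygons n)"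
proof -
  assume n: "n \<ge> 1"
  have "(\<lambda>w. w @ [hd w]) ` polygons n \<subseteq> walks n" using polygons_snoc_walks n by blast
  moreover have "inj_on (\<lambda>w. w @ [hd w]) (polygons n)" by (auto simp: inj_on_def)
  ultimately show ?thesis using finite_walks inj_on_finite by blast
qed

text \<open>A closing walk repeats its first vertex at the end, so dropping the last vertex loses
  nothing.\<close>

lemma prob_closes:
  assumes n: "n \<ge> 1"
  shows "measure_pmf.prob (W3E n) {\<Gamma> :: nat \<Rightarrow> int ^ 'd::finite. closes n \<Gamma>}
    = card (polygons n :: (int ^ 'd) list set) / card (walks n :: (int ^ 'd) list set)"
proof -
  let ?Z = "SAW3E n \<inter> {\<Gamma> :: nat \<Rightarrow> int ^ 'd. closes n \<Gamma>}"
  have 1: "bij_betw (list_of_walk n) ?Z (list_of_walk n ` ?Z)"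
    using bij_list_of_walk[of n] by (meson bij_betw_subset inf_le1)
  have 2: "list_of_walk n ` ?Z = (\<lambda>w. w @ [hd w]) ` polygons n"
  proof (intro equalityI subsetI)
    fix w :: "(int ^ 'd) list" assume "w \<in> list_of_walk n ` ?Z"
    then obtain g where g: "g \<in> SAW3E n" "g n = 0" "w = list_of_walk n g"
      by (auto simp: closes_def znorm_eq_0_iff)
    have sw: "w \<in> walks n" using g bij_list_of_walk[of n] by (auto simp: bij_betw_def)
    have ne: "w \<noteq> []" using sw by (auto simp: walks_def)
    hence "w = butlast w @ [last w]" by simp
    moreover have "last w = 0" using last_conv_nth[OF ne] g by simp
    moreover have "hd (butlast w) = 0"
      using sw n by (cases w) (auto simp: walks_def)
    moreover have "length (butlast w) = n" using sw by (auto simp: walks_def)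
    ultimately show "w \<in> (\<lambda>w. w @ [hd w]) ` polygons n"
      using sw by (intro image_eqI[of _ _ "butlast w"]) (auto simp: polygons_def walks_def)
  next
    fix w :: "(int ^ 'd) list" assume "w \<in> (\<lambda>w. w @ [hd w]) ` polygons n"
    then obtain u where u: "u \<in> polygons n" "w = u @ [hd u]" by blast
    hence "w \<in> walks n" using polygons_snoc_walks n by blast
    then obtain g where g: "g \<in> SAW3E n" "w = list_of_walk n g"
      using bij_list_of_walk[of n] by (auto simp: bij_betw_def)
    have "g n = w ! n" using g by simp
    also have "\<dots> = 0" using u by (auto simp: polygons_def nth_append)
    finally show "w \<in> list_of_walk n ` ?Z" using g by (auto simp: closes_def znorm_eq_0_iff)
  qed
  have 3: "bij_betw (\<lambda>w. w @ [hd w]) (polygons n) ((\<lambda>w. w @ [hd w]) ` (polygons n :: (int ^ 'd) list set))"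
    by (auto simp: bij_betw_def inj_on_def)
  have "card ?Z = card (polygons n :: (int ^ 'd) list set)"
    using bij_betw_same_card[OF 1] bij_betw_same_card[OF 3] 2 by simp
  moreover have "card (SAW3E n :: (nat \<Rightarrow> int ^ 'd) set) = card (walks n :: (int ^ 'd) list set)"
    using bij_betw_same_card bij_list_of_walk by blast
  ultimately show ?thesis
    unfolding W3E_def by (simp add: measure_pmf_of_set[OF SAW3E_nonempty finite_SAW3E])
qed


section \<open>Bridges and the connective constant\<close>

lemma admissible_add:
  assumes "admissible M" "admissible N" "set_mset M \<inter> set_mset N = {}"
  shows "admissible (M + N)"
proof -
  have "count M e + count N e \<le> 3" for e
  proof (cases "e \<in># M")
    case True
    hence "count N e = 0" using assms(3) by (auto simp: count_eq_zero_iff)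
    thus ?thesis using assms(1) by (simp add: admissible_def)
  next
    case False
    thus ?thesis using assms(2) by (simp add: admissible_def not_in_iff)
  qed
  thus ?thesis using assms by (auto simp: admissible_def)
qed

lemma edges_snoc_meets: "e \<in># edges (u @ [x]) \<Longrightarrow> \<exists>y\<in>set u. y \<in> e"
proof (induction u)
  case (Cons a u)
  thus ?case by (cases u) auto
qed simp

text \<open>The end lies strictly above all earlier vertices, while the starting level may be
  revisited: one strict end is enough to make consecutive bridges edge-disjoint.\<close>

definition bridges :: "'d::finite \<Rightarrow> nat \<Rightarrow> (int ^ 'd) list set" where
  "bridges k n = {w \<in> walks n. \<forall>v\<in>set (butlast w). 0 \<le> v $ k \<and> v $ k < last w $ k}"

lemma bridges_last_nonneg: "w \<in> bridges k n \<Longrightarrow> 0 \<le> last w $ k"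
  by (cases w; cases "tl w") (auto simp: bridges_def walks_def)

lemma bridges_nonneg: "w \<in> bridges k n \<Longrightarrow> v \<in> set w \<Longrightarrow> 0 \<le> v $ k"
proof -
  assume w: "w \<in> bridges k n" and v: "v \<in> set w"
  have "w \<noteq> []" using w by (auto simp: bridges_def walks_def)
  hence "w = butlast w @ [last w]" by simp
  hence "v \<in> set (butlast w) \<or> v = last w" using v
    by (metis in_set_conv_decomp_first rotate1.simps(2) set_ConsD set_append set_rotate1 UnE empty_iff empty_set)
  thus "0 \<le> v $ k" using w bridges_last_nonneg[OF w] by (auto simp: bridges_def)
qed

lemma walks_snoc_cases:
  assumes "w \<in> walks n"
  obtains u x where "w = u @ [x]" "length u = n"
proof -
  have "w \<noteq> []" using assms by (auto simp: walks_def)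
  hence "w = butlast w @ [last w]" "length (butlast w) = n" using assms by (auto simp: walks_def)
  thus thesis using that by blast
qed

text \<open>Each edge of the first bridge has an endpoint strictly below the junction, and the
  second bridge stays at or above it. So no edge is shared and no multiplicities add up.\<close>

lemma bridges_concat:
  assumes w: "w1 \<in> bridges k a" "w2 \<in> bridges k b"
  shows "butlast w1 @ translate (last w1) w2 \<in> bridges k (a + b)"
proof -
  obtain u l where u: "w1 = u @ [l]" "length u = a"
    using w(1) walks_snoc_cases[of w1 a thesis] unfolding bridges_def by simp
  obtain t where t: "w2 = 0 # t" using w(2) by (cases w2) (auto simp: bridges_def walks_def)
  have l: "0 \<le> l $ k" using bridges_last_nonneg[OF w(1)] u by simp
  have eq: "edges (u @ translate l w2) = edges w1 + edges (translate l w2)"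
    using u t edges_append[of u l "translate l t"] by simp
  have "admissible (edges (u @ translate l w2))" unfolding eq
  proof (rule admissible_add)
    show "admissible (edges w1)" using w by (simp add: bridges_def walks_def)
    show "admissible (edges (translate l w2))"
      using w by (simp add: bridges_def walks_def admissible_translate)
    show "set_mset (edges w1) \<inter> set_mset (edges (translate l w2)) = {}"
    proof (rule ccontr)
      assume "set_mset (edges w1) \<inter> set_mset (edges (translate l w2)) \<noteq> {}"
      then obtain e where e: "e \<in># edges w1" "e \<in># edges (translate l w2)" by blast
      obtain y where y: "y \<in> set u" "y \<in> e" using edges_snoc_meets[of e u l] e(1) u by auto
      hence "y $ k < l $ k" using w(1) u by (auto simp: bridges_def)
      moreover have "y \<in> set (translate l w2)" using edges_subset[OF e(2)] y by blast
      then obtain z where "z \<in> set w2" "y = z + l" by auto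
      hence "y $ k \<ge> l $ k" using bridges_nonneg[OF w(2)] by simp
      ultimately show False by simp
    qed
  qed
  moreover have "hd (u @ translate l w2) = 0"
    using w u t by (cases u) (auto simp: bridges_def walks_def)
  moreover have "length (u @ translate l w2) = Suc (a + b)"
    using w u by (simp add: bridges_def walks_def)
  ultimately have sw: "u @ translate l w2 \<in> walks (a + b)" by (simp add: walks_def)
  have ne: "w2 \<noteq> []" using t by simp
  have last: "last (u @ translate l w2) = last w2 + l"
    using ne by (simp add: translate_def last_map)
  have "v $ k \<ge> 0 \<and> v $ k < last w2 $ k + l $ k" if "v \<in> set (butlast (u @ translate l w2))" for v
  proof -
    have "butlast (u @ translate l w2) = u @ translate l (butlast w2)"
      using ne by (simp add: butlast_append translate_def map_butlast)
    hence "v \<in> set (u @ translate l (butlast w2))" using that by simp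
    then consider "v \<in> set u" | z where "z \<in> set (butlast w2)" "v = z + l" by auto
    thus ?thesis
    proof cases
      case 1
      hence "0 \<le> v $ k \<and> v $ k < l $ k" using w(1) u by (auto simp: bridges_def)
      thus ?thesis using bridges_last_nonneg[OF w(2)] by simp
    next
      case 2
      thus ?thesis using w(2) l by (auto simp: bridges_def)
    qed
  qed
  thus ?thesis using sw last u by (simp add: bridges_def)
qed

section \<open>Super- and submultiplicativity\<close>

lemma finite_bridges: "finite (bridges k n)"
  unfolding bridges_def by (simp add: finite_walks)

lemma card_bridges_supermult:
  fixes k :: "'d::finite"
  shows "card (bridges k a) * card (bridges k b) \<le> card (bridges k (a + b))"
proof -
  let ?f = "\<lambda>(w1, w2). butlast w1 @ translate (last w1) w2 :: (int ^ 'd) list"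
  have "card (bridges k a \<times> bridges k b) \<le> card (bridges k (a + b))"
  proof (rule card_inj_on_le[of ?f])
    show "?f ` (bridges k a \<times> bridges k b) \<subseteq> bridges k (a + b)" using bridges_concat by auto
    show "inj_on ?f (bridges k a \<times> bridges k b)"
    proof (rule inj_onI, clarify)
      fix w1 w2 v1 v2 :: "(int ^ 'd) list"
      assume A: "w1 \<in> bridges k a" "w2 \<in> bridges k b" "v1 \<in> bridges k a" "v2 \<in> bridges k b"
        and eq: "butlast w1 @ translate (last w1) w2 = butlast v1 @ translate (last v1) v2"
      have len: "length (butlast w1) = length (butlast v1)" using A by (auto simp: bridges_def walks_def)
      have b: "butlast w1 = butlast v1" and t: "translate (last w1) w2 = translate (last v1) v2"
        using eq len by (simp_all add: append_eq_append_conv)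
      have ne: "w2 \<noteq> []" "v2 \<noteq> []" "w1 \<noteq> []" "v1 \<noteq> []" "hd w2 = 0" "hd v2 = 0"
        using A by (auto simp: bridges_def walks_def)
      have "hd (translate (last w1) w2) = last w1" "hd (translate (last v1) v2) = last v1"
        using ne by simp_all
      hence l: "last w1 = last v1" using t by simp
      have "w1 = v1" using b l ne by (metis append_butlast_last_id)
      moreover have "w2 = v2"
        using arg_cong[OF t, of "translate (- last w1)"] l by simp
      ultimately show "w1 = v1 \<and> w2 = v2" by simp
    qed
  qed (rule finite_bridges)
  thus ?thesis by (simp add: card_cartesian_product)
qed

lemma card_walks_submult:
  "card (walks (a + b) :: (int ^ 'd::finite) list set)
    \<le> card (walks a :: (int ^ 'd) list set) * card (walks b :: (int ^ 'd) list set)"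
proof -
  let ?f = "\<lambda>w :: (int ^ 'd) list. (take (Suc a) w, translate (- (w ! a)) (drop a w))"
  have "card (walks (a + b) :: (int ^ 'd) list set)
      \<le> card ((walks a :: (int ^ 'd) list set) \<times> (walks b :: (int ^ 'd) list set))"
  proof (rule card_inj_on_le[of ?f])
    show "finite ((walks a :: (int ^ 'd) list set) \<times> (walks b :: (int ^ 'd) list set))"
      by (simp add: finite_walks)
    show "?f ` walks (a + b) \<subseteq> walks a \<times> walks b"
    proof clarify
      fix w :: "(int ^ 'd) list" assume w: "w \<in> walks (a + b)"
      have len: "length w = Suc (a + b)" using w by (simp add: walks_def)
      have d: "drop a w = w ! a # drop (Suc a) w" using len by (simp add: Cons_nth_drop_Suc)
      have tk: "take (Suc a) w = take a w @ [w ! a]" using len by (simp add: take_Suc_conv_app_nth)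
      have "edges w = edges (take (Suc a) w) + edges (drop a w)"
        using edges_append[of "take a w" "w ! a" "drop (Suc a) w"] d tk
        by (metis append_take_drop_id)
      hence "admissible (edges (take (Suc a) w))" "admissible (edges (drop a w))"
        using w admissible_mono[of _ "edges w"] by (simp_all add: walks_def)
      moreover have "hd (take (Suc a) w) = 0" using w by (cases w) (auto simp: walks_def)
      moreover have "hd (translate (- (w ! a)) (drop a w)) = 0" using d by simp
      ultimately show "take (Suc a) w \<in> walks a \<and> translate (- (w ! a)) (drop a w) \<in> walks b"
        using len by (simp add: walks_def admissible_translate)
    qed
    show "inj_on ?f (walks (a + b))"
    proof (rule inj_onI)
      fix w v :: "(int ^ 'd) list"
      assume A: "w \<in> walks (a + b)" "v \<in> walks (a + b)" and "?f w = ?f v"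
      hence t: "take (Suc a) w = take (Suc a) v"
        and d: "translate (- (w ! a)) (drop a w) = translate (- (v ! a)) (drop a v)" by auto
      have "take (Suc a) w ! a = take (Suc a) v ! a" using t by simp
      hence "w ! a = v ! a" by simp
      hence "drop a w = drop a v" using arg_cong[OF d, of "translate (w ! a)"] by simp
      moreover have "take a w = take a v"
        using arg_cong[OF t, of "take a"] by simp
      ultimately show "w = v" by (metis append_take_drop_id)
    qed
  qed
  thus ?thesis by (simp add: card_cartesian_product)
qed

lemma card_bridges_power: "n \<ge> 1 \<Longrightarrow> card (bridges k m) ^ n \<le> card (bridges k (n * m))"
proof (induction n rule: nat_induct_at_least)
  case (Suc n)
  have "card (bridges k m) ^ Suc n \<le> card (bridges k m) * card (bridges k (n * m))"
    using Suc by simp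
  also have "\<dots> \<le> card (bridges k (Suc n * m))" using card_bridges_supermult[of k m "n * m"] by simp
  finally show ?case .
qed simp

lemma card_walks_power: 
  "n \<ge> 1 \<Longrightarrow> card (walks (n * m) :: (int ^ 'd::finite) list set) \<le> card (walks m :: (int ^ 'd) list set) ^ n"
proof (induction n rule: nat_induct_at_least)
  case (Suc n)
  have "card (walks (Suc n * m) :: (int ^ 'd) list set)
      \<le> card (walks m :: (int ^ 'd) list set) * card (walks (n * m) :: (int ^ 'd) list set)"
    using card_walks_submult[of m "n * m"] by simp
  also have "\<dots> \<le> card (walks m :: (int ^ 'd) list set) ^ Suc n"
    using Suc by simp
  finally show ?case .
qed simp

text \<open>With b and s counting bridges and walks, b(m)^n <= b(m n) <= s(m n) <= s(n)^m. Hence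
  every m-th root of b(m) lies below every n-th root of s(n), and the infimum of the latter
  separates the two families without any statement on convergence.\<close>

lemma connective_constant:
  obtains \<mu> :: real where "\<mu> \<ge> 1"
    "\<And>n. n \<ge> 1 \<Longrightarrow> \<mu> ^ n \<le> card (walks n :: (int ^ 'd::finite) list set)"
    "\<And>(k :: 'd) n. n \<ge> 1 \<Longrightarrow> card (bridges k n) \<le> \<mu> ^ n"
proof -
  define s where "s = (\<lambda>n. real (card (walks n :: (int ^ 'd) list set)))"
  define \<mu> where "\<mu> = (INF n\<in>{1..}. root n (s n))"
  have s1: "s n \<ge> 1" for n using walks_card_pos[where 'd='d, of n] by (simp add: s_def)
  have r1: "root n (s n) \<ge> 1" if "n \<ge> 1" for n using s1 that by simp
  have bdd: "bdd_below ((\<lambda>n. root n (s n)) ` {1..})"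
    using r1 by (intro bdd_belowI[of _ 1]) auto
  have mu1: "\<mu> \<ge> 1" unfolding \<mu>_def using r1 by (intro cINF_greatest) auto
  have 1: "\<mu> ^ n \<le> s n" if "n \<ge> 1" for n
  proof -
    have "\<mu> \<le> root n (s n)" unfolding \<mu>_def using bdd that by (intro cINF_lower) auto
    hence "\<mu> ^ n \<le> root n (s n) ^ n" using mu1 by (intro power_mono) auto
    also have "\<dots> = s n" using s1[of n] that by (intro real_root_pow_pos2) auto
    finally show ?thesis .
  qed
  have 2: "card (bridges k m) \<le> \<mu> ^ m" if m: "m \<ge> 1" for k :: 'd and m
  proof -
    have "root m (card (bridges k m)) \<le> root n (s n)" if n: "n \<ge> 1" for n
    proof -
      have "card (bridges k m) ^ n \<le> card (bridges k (n * m))" using card_bridges_power n by blast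
      also have "\<dots> \<le> card (walks (m * n) :: (int ^ 'd) list set)"
        unfolding mult.commute[of n m] by (rule card_mono[OF finite_walks]) (auto simp: bridges_def)
      also have "\<dots> \<le> card (walks n :: (int ^ 'd) list set) ^ m" using card_walks_power m by blast
      finally have "real (card (bridges k m)) ^ n \<le> s n ^ m"
        unfolding s_def by (metis of_nat_le_iff of_nat_power)
      moreover have "(root m (card (bridges k m)) ^ m) ^ n = real (card (bridges k m)) ^ n"
        using m by (simp add: real_root_pow_pos2)
      moreover have "(root n (s n) ^ n) ^ m = s n ^ m"
        using n s1[of n] by (simp add: real_root_pow_pos2)
      ultimately have "root m (card (bridges k m)) ^ (m * n) \<le> root n (s n) ^ (m * n)"
        by (simp add: power_mult[symmetric] mult.commute)
      thus ?thesis using m n r1[OF n] power_le_imp_le_base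
        by (smt (verit) nat_0_less_mult_iff power_strict_mono less_le_trans zero_less_one not_less of_nat_0_le_iff)
    qed
    hence "root m (card (bridges k m)) \<le> \<mu>" unfolding \<mu>_def by (intro cINF_greatest) auto
    hence "root m (card (bridges k m)) ^ m \<le> \<mu> ^ m"
      by (intro power_mono) (simp_all add: real_root_ge_zero)
    thus ?thesis using m by (simp add: real_root_pow_pos2)
  qed
  show thesis using that[OF mu1] 1 2 by (simp add: s_def)
qed


section \<open>Unfolding polygons into bridges\<close>

lemma znorm_eq_sqrt: "znorm x = sqrt (\<Sum>i\<in>UNIV. (real_of_int (x $ i))\<^sup>2)"
  by (simp add: znorm_def norm_vec_def L2_set_def)

lemma znorm_axis [simp]: "znorm (axis k 1) = 1" "znorm (- axis k 1) = 1"
  "znorm (axis k (-1)) = 1"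
proof -
  have *: "(\<Sum>i\<in>UNIV. (real_of_int ((if i = k then c else 0)))\<^sup>2) = (real_of_int c)\<^sup>2" for c
    by (subst sum.cong[OF refl, of _ _ "\<lambda>i. if k = i then (real_of_int c)\<^sup>2 else 0"]) auto
  show "znorm (axis k 1) = 1" "znorm (axis k (-1)) = 1"
    unfolding znorm_eq_sqrt axis_def by (simp_all add: *)
  thus "znorm (- axis k 1) = 1" using znorm_minus_commute[of "axis k 1" 0] by simp
qed

text \<open>Each step from x to y along an edge of \<open>S\<close> becomes x, y, x, y, so the walk
  keeps its ends and its set of vertices.\<close>

fun triple :: "'a set set \<Rightarrow> 'a list \<Rightarrow> 'a list" where
  "triple S [] = []"
| "triple S [x] = [x]"
| "triple S (x # y # zs) = (if {x, y} \<in> S then [x, y] else []) @ x # triple S (y # zs)"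

lemma triple_eq_Nil [simp]: "triple S w = [] \<longleftrightarrow> w = []"
  by (induction S w rule: triple.induct) auto

lemma hd_triple [simp]: "hd (triple S w) = hd w"
  by (induction S w rule: triple.induct) auto

lemma last_triple [simp]: "last (triple S w) = last w"
  by (induction S w rule: triple.induct) auto

lemma set_triple [simp]: "set (triple S w) = set w"
  by (induction S w rule: triple.induct) auto

lemma triple_Cons: "\<exists>t. triple S (y # zs) = y # t"
  by (metis hd_triple list.collapse list.sel(1) triple_eq_Nil list.distinct(1))

lemma count_edges_triple:
  "count (edges (triple S w)) e = (if e \<in> S then 3 else 1) * count (edges w) e"
proof (induction S w rule: triple.induct)
  case (3 S x y zs)
  obtain t where "triple S (y # zs) = y # t" using triple_Cons[of S y zs] by blast
  thus ?case using 3 by (auto simp: insert_commute)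
qed auto

lemma set_mset_edges_triple: "set_mset (edges (triple S w)) = set_mset (edges w)"
proof -
  have "e \<in># edges (triple S w) \<longleftrightarrow> e \<in># edges w" for e
    unfolding count_greater_zero_iff[symmetric] count_edges_triple by simp
  thus ?thesis by blast
qed

lemma length_triple: "length (triple S w) = length w + 2 * size (filter_mset (\<lambda>e. e \<in> S) (edges w))"
  by (induction S w rule: triple.induct) auto

text \<open>The second vertex of the output is the second vertex of the input, and \<open>S\<close>
  then tells whether this step was tripled, that is, how much to strip.\<close>

lemma triple_inject: "triple S w = triple S w' \<Longrightarrow> w = w'"
proof (induction w arbitrary: w')
  case Nil
  thus ?case using triple_eq_Nil[of S w'] by simp
next
  case (Cons x v)
  then obtain v' where w': "w' = x # v'"
    by (metis hd_triple list.collapse list.sel(1) triple_eq_Nil list.distinct(1))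
  show ?case
  proof (cases v)
    case Nil
    show ?thesis
    proof (cases v')
      case v': (Cons y' z')
      have "length (triple S (x # v)) = length (triple S w')" using Cons.prems by simp
      thus ?thesis using w' Nil v' unfolding length_triple by simp
    qed (use Nil w' in simp)
  next
    case v: (Cons y z)
    have ne: "triple S (y # z) \<noteq> []" by simp
    obtain t where t: "triple S (y # z) = y # t" using triple_Cons[of S y z] by blast
    show ?thesis
    proof (cases v')
      case Nil
      thus ?thesis using Cons.prems w' v by (auto split: if_splits)
    next
      case v': (Cons y' z')
      obtain t' where t': "triple S (y' # z') = y' # t'" using triple_Cons[of S y' z'] by blast
      have "y = y'" using Cons.prems w' v v' t t' by (auto split: if_splits)
      hence "triple S v = triple S v'" using Cons.prems w' v v' t t' by (auto split: if_splits)
      thus ?thesis using Cons.IH w' by simp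
    qed
  qed
qed

text \<open>The root is the only visit to the lowest level. This strictness singles out one starting
  point of the cyclic list, and it makes the image of the root the strictly highest vertex after
  unfolding.\<close>

definition rooted_polygons :: "'d::finite \<Rightarrow> nat \<Rightarrow> (int ^ 'd) list set" where
  "rooted_polygons k n = {w \<in> polygons n. w \<noteq> [] \<and> (\<forall>v\<in>set (tl w). 0 < v $ k)}"

definition top_level :: "'d::finite \<Rightarrow> (int ^ 'd) list \<Rightarrow> int" where
  "top_level k w = Max ((\<lambda>v. v $ k) ` set w)"

text \<open>The first vertex on the top level ends the ascent and also begins the descent, so that
  the two edge multisets add up to that of the closed walk.\<close>

definition ascent :: "'d::finite \<Rightarrow> (int ^ 'd) list \<Rightarrow> (int ^ 'd) list" where
  "ascent k w = takeWhile (\<lambda>v. v $ k < top_level k w) w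
     @ [hd (dropWhile (\<lambda>v. v $ k < top_level k w) w)]"

definition descent :: "'d::finite \<Rightarrow> (int ^ 'd) list \<Rightarrow> (int ^ 'd) list" where
  "descent k w = dropWhile (\<lambda>v. v $ k < top_level k w) w @ [hd w]"

text \<open>The exact counts 1 and 1 let the first traversal be tripled within the bound of three,
  and make the total afterwards exactly four.\<close>

definition links :: "'d::finite \<Rightarrow> (int ^ 'd) list \<Rightarrow> (int ^ 'd) set set" where
  "links k w = {e. count (edges (ascent k w)) e = 1 \<and> count (edges (descent k w)) e = 1}"

lemma top_level_ge: "v \<in> set w \<Longrightarrow> v $ k \<le> top_level k w"
  unfolding top_level_def by (intro Max_ge) auto

lemma top_level_attained: "w \<noteq> [] \<Longrightarrow> \<exists>v\<in>set w. v $ k = top_level k w"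
  unfolding top_level_def using Max_in[of "(\<lambda>v. v $ k) ` set w"]
  by (metis (no_types, lifting) List.finite_set finite_imageI imageE image_is_empty set_empty)

lemma top_split:
  fixes k :: "'d::finite"
  assumes "w \<noteq> []"
  obtains us q vs where "w = us @ q # vs" "ascent k w = us @ [q]" "descent k w = q # vs @ [hd w]"
    "q $ k = top_level k w" "\<forall>v\<in>set us. v $ k < top_level k w"
proof -
  let ?P = "\<lambda>v :: int ^ 'd. v $ k < top_level k w"
  obtain v where v: "v \<in> set w" "\<not> ?P v" using top_level_attained[OF assms, of k] by auto
  hence "dropWhile ?P w \<noteq> []" by auto
  then obtain q vs where q: "dropWhile ?P w = q # vs" by (meson neq_Nil_conv)
  have "\<not> ?P q" using q hd_dropWhile[of ?P w] by auto
  moreover have "q \<in> set w" using q by (metis set_dropWhileD list.set_intros(1))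
  ultimately have "q $ k = top_level k w" using top_level_ge[of q w k] by simp
  moreover have "w = takeWhile ?P w @ q # vs" using q takeWhile_dropWhile_id[of ?P w] by simp
  moreover have "\<forall>v\<in>set (takeWhile ?P w). ?P v" using set_takeWhileD by fast
  ultimately show thesis using that[of "takeWhile ?P w" q vs] q
    by (simp add: ascent_def descent_def)
qed

lemma edges_ascent_descent:
  "w \<noteq> [] \<Longrightarrow> edges (w @ [hd w]) = edges (ascent k w) + edges (descent k w)"
  by (rule top_split[of w k]) (auto intro: edges_append[of _ _ "_ @ [_]", simplified])

lemma finite_links: "finite (links k w)"
proof (rule finite_subset)
  show "links k w \<subseteq> set_mset (edges (ascent k w))"
    unfolding links_def by (auto simp: count_greater_zero_iff[symmetric] simp del: count_greater_zero_iff)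
qed simp

lemma size_filter_links:
  assumes "S \<subseteq> links k w"
  shows "size (filter_mset (\<lambda>e. e \<in> S) (edges (ascent k w))) = card S"
proof -
  have "filter_mset (\<lambda>e. e \<in> S) (edges (ascent k w)) = mset_set S"
  proof (rule multiset_eqI)
    fix e
    show "count (filter_mset (\<lambda>e. e \<in> S) (edges (ascent k w))) e = count (mset_set S) e"
      using assms finite_subset[OF assms finite_links]
      by (auto simp: links_def count_mset_set')
  qed
  thus ?thesis by simp
qed

lemma card_subset_links:
  assumes "w \<in> polygons n" "w \<noteq> []" "S \<subseteq> links k w"
  shows "card S \<le> n"
proof -
  have "card S \<le> size (edges (ascent k w))"
    using size_filter_links[OF assms(3)] size_filter_mset_lesseq by metis
  also have "\<dots> \<le> size (edges (w @ [hd w]))"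
    unfolding edges_ascent_descent[OF assms(2), of k] by simp
  also have "\<dots> = n" using assms by (simp add: size_edges polygons_def)
  finally show ?thesis .
qed

definition reflect :: "'d::finite \<Rightarrow> int \<Rightarrow> int ^ 'd \<Rightarrow> int ^ 'd" where
  "reflect k c v = (\<chi> i. if i = k then c - v $ i else v $ i)"

lemma reflect_nth [simp]: "reflect k c v $ k = c - v $ k"
  by (simp add: reflect_def)

lemma reflect_isometry: "znorm (reflect k c x - reflect k c y) = znorm (x - y)"
proof -
  have "(real_of_int ((reflect k c x - reflect k c y) $ i))\<^sup>2 = (real_of_int ((x - y) $ i))\<^sup>2" for i
    by (auto simp: reflect_def power2_commute)
  thus ?thesis unfolding znorm_eq_sqrt by simp
qed

lemma reflect_reflect [simp]: "reflect k c (reflect k c v) = v"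
  by (simp add: reflect_def vec_eq_iff)

text \<open>The mirror lies half a step above the top level. This puts the halves on disjoint levels
  and inserts one vertical edge between them.\<close>

definition unfold_walk :: "'d::finite \<Rightarrow> (int ^ 'd) set set \<Rightarrow> (int ^ 'd) list \<Rightarrow> (int ^ 'd) list" where
  "unfold_walk k S w = triple S (ascent k w)
     @ map (reflect k (2 * top_level k w + 1)) (descent k w)"

text \<open>With h the top level, the tripled ascent stays on levels at most h and the reflected
  descent on levels at least h + 1, so multiplicities never combine. The reflected root is the only
  vertex on level 2 h + 1. Each marked edge adds two steps, the connecting edge one.\<close>

lemma unfold_walk_in_bridges:
  assumes w: "w \<in> rooted_polygons k n" and S: "S \<subseteq> links k w"
  shows "unfold_walk k S w \<in> bridges k (n + 2 * card S + 1)"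
proof -
  define h where "h = top_level k w"
  let ?r = "reflect k (2 * h + 1)"
  have ne: "w \<noteq> []" and cw: "w \<in> polygons n" using w by (auto simp: rooted_polygons_def)
  have hd0: "hd w = 0" and gd: "admissible (edges (w @ [hd w]))" and len: "length w = n"
    using cw by (auto simp: polygons_def)
  obtain us q vs where sp: "w = us @ q # vs" "ascent k w = us @ [q]"
    "descent k w = q # vs @ [hd w]" "q $ k = h" "\<forall>v\<in>set us. v $ k < h"
    using top_split[OF ne, of k] unfolding h_def by metis
  \<comment> \<open>A lone vertex would need a loop at the origin, which is no lattice edge; hence
    the top level is positive.\<close>
  have tl_ne: "tl w \<noteq> []"
  proof
    assume "tl w = []"
    hence "w = [0]" using hd0 ne by (cases w) auto
    hence "{0 :: int ^ 'a} \<in> nn_edges" using gd by (simp add: admissible_def)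
    thus False using nn_edge_iff[of "0 :: int ^ 'a" 0] znorm_eq_0_iff[of "0 :: int ^ 'a"] by simp
  qed
  then obtain v where v: "v \<in> set (tl w)" by (meson list.set_sel(1))
  hence h0: "0 < h" using w top_level_ge[of v w k] list.set_sel(2)[OF ne v]
    unfolding h_def rooted_polygons_def by fastforce
  have nonneg: "0 \<le> v $ k" if "v \<in> set w" for v
    using that w hd0 ne by (cases w) (auto simp: rooted_polygons_def intro: less_imp_le)
  have le_h: "v $ k \<le> h" if "v \<in> set w" for v using top_level_ge that unfolding h_def by blast
  \<comment> \<open>The root is below the top level and so belongs to the ascent. Hence all of
    \<open>q # vs\<close> is strictly above level 0, and its reflection strictly below
    \<open>2 * h + 1\<close>.\<close>
  have usne: "us \<noteq> []" using sp h0 hd0 by (cases us) auto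
  have qvs: "0 < v $ k" if "v \<in> set (q # vs)" for v
  proof -
    have "set (q # vs) \<subseteq> set (tl w)" using sp usne by (cases us) auto
    thus ?thesis using that w by (auto simp: rooted_polygons_def)
  qed
  let ?T = "triple S (us @ [q])"
  let ?D = "map ?r (q # vs @ [0])"
  have W: "unfold_walk k S w = ?T @ ?D"
    unfolding unfold_walk_def sp(2,3) hd0 h_def by simp
  have Tb: "?T = butlast ?T @ [q]"
    by (metis append_butlast_last_id last_snoc last_triple snoc_eq_iff_butlast triple_eq_Nil)
  have eq: "edges (?T @ ?D) = edges ?T + ({#{q, ?r q}#} + edges ?D)"
  proof -
    have "edges (?T @ ?D) = edges ((butlast ?T @ q # ?D))" using Tb by (metis append.assoc append_Cons append_Nil)
    also have "\<dots> = edges (butlast ?T @ [q]) + edges (q # ?D)" by (rule edges_append)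
    finally show ?thesis using Tb by simp
  qed
  have gT: "admissible (edges ?T)"
  proof -
    have "edges (us @ [q]) \<subseteq># edges (w @ [hd w])"
      using edges_ascent_descent[OF ne, of k] sp by simp
    hence g: "admissible (edges (us @ [q]))" using gd admissible_mono by blast
    have "count (edges ?T) e \<le> 3" for e
      using S g sp(2) unfolding count_edges_triple by (auto simp: links_def admissible_def)
    thus ?thesis using g unfolding admissible_def set_mset_edges_triple by blast
  qed
  have gD: "admissible (edges ?D)"
  proof -
    have "edges (q # vs @ [0]) \<subseteq># edges (w @ [hd w])"
      using edges_ascent_descent[OF ne, of k] sp hd0 by simp
    hence "admissible (edges (q # vs @ [0]))" using gd admissible_mono by blast
    thus ?thesis unfolding edges_map by (rule admissible_image[OF reflect_isometry])
  qed
  have "q - ?r q = axis k (-1)"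
    using sp(4) by (auto simp: vec_eq_iff reflect_def axis_def)
  hence gq: "admissible {#{q, ?r q}#}" by (simp add: admissible_def nn_edge_iff)
  have lowT: "v $ k \<le> h" if "v \<in> set ?T" for v using that le_h sp(1) by auto
  have highD: "h + 1 \<le> v $ k" if "v \<in> set ?D" for v
    using that le_h nonneg sp(1) h0 by fastforce
  have "admissible (edges (?T @ ?D))" unfolding eq
  proof (rule admissible_add[OF gT admissible_add[OF gq gD]])
    have "\<not> {q, ?r q} \<subseteq> set ?D" using highD[of q] sp(4) by fastforce
    thus "set_mset {#{q, ?r q}#} \<inter> set_mset (edges ?D) = {}" using edges_subset[of _ ?D] by fastforce
    have "\<not> {q, ?r q} \<subseteq> set ?T" using lowT[of "?r q"] sp(4) by fastforce
    hence 1: "{q, ?r q} \<notin># edges ?T" using edges_subset[of _ ?T] by fastforce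
    have "e \<notin># edges ?D" if T: "e \<in># edges ?T" for e
    proof
      assume D: "e \<in># edges ?D"
      have "e \<noteq> {}" using edges_subset[OF T] by blast
      then obtain y where "y \<in> e" by blast
      hence "y \<in> set ?T" "y \<in> set ?D" using edges_subset[OF D] edges_subset[OF T] by blast+
      thus False using lowT[of y] highD[of y] by linarith
    qed
    thus "set_mset (edges ?T) \<inter> set_mset ({#{q, ?r q}#} + edges ?D) = {}" using 1 by auto
  qed
  moreover have "length (?T @ ?D) = Suc (n + 2 * card S + 1)"
    using size_filter_links[OF S] sp len by (simp add: length_triple)
  moreover have "hd (?T @ ?D) = 0" using usne sp hd0 by simp
  ultimately have sw: "?T @ ?D \<in> walks (n + 2 * card S + 1)" by (simp add: walks_def)
  have last: "last (?T @ ?D) $ k = 2 * h + 1" by simp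
  have "0 \<le> v $ k \<and> v $ k < 2 * h + 1" if "v \<in> set (butlast (?T @ ?D))" for v
  proof -
    have "butlast (?T @ ?D) = ?T @ map ?r (q # vs)" by (simp add: butlast_append)
    hence "v \<in> set (us @ [q]) \<or> (\<exists>y\<in>set (q # vs). v = ?r y)" using that by auto
    thus ?thesis
    proof
      assume "v \<in> set (us @ [q])"
      thus ?thesis using le_h[of v] nonneg[of v] sp(1) h0 by auto
    next
      assume "\<exists>y\<in>set (q # vs). v = ?r y"
      then obtain y where y: "y \<in> set (q # vs)" "v = ?r y" by blast
      thus ?thesis using qvs[OF y(1)] le_h[of y] sp(1) h0 by auto
    qed
  qed
  thus ?thesis using sw last unfolding W bridges_def by simp
qed

text \<open>The length tells where the ascent ends; the level of its last vertex fixes the mirror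
  and thereby the descent. The marked set is then visible in the multiplicities, and knowing it
  undoes the tripling.\<close>

lemma unfold_walk_inject:
  assumes w: "w \<in> rooted_polygons k n" "S \<subseteq> links k w" and w': "w' \<in> rooted_polygons k n" "S' \<subseteq> links k w'"
    and eq: "unfold_walk k S w = unfold_walk k S' w'"
    and len: "length (triple S (ascent k w)) = length (triple S' (ascent k w'))"
  shows "w = w' \<and> S = S'"
proof -
  have ne: "w \<noteq> []" "w' \<noteq> []" using w w' by (auto simp: rooted_polygons_def)
  obtain us q vs where sp: "w = us @ q # vs" "ascent k w = us @ [q]"
    "descent k w = q # vs @ [hd w]" "q $ k = top_level k w"
    using top_split[OF ne(1), of k] by metis
  obtain us' q' vs' where sp': "w' = us' @ q' # vs'" "ascent k w' = us' @ [q']"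
    "descent k w' = q' # vs' @ [hd w']" "q' $ k = top_level k w'"
    using top_split[OF ne(2), of k] by metis
  let ?r = "reflect k (2 * top_level k w + 1)" and ?r' = "reflect k (2 * top_level k w' + 1)"
  have T: "triple S (ascent k w) = triple S' (ascent k w')"
    and D: "map ?r (descent k w) = map ?r' (descent k w')"
    using eq len unfolding unfold_walk_def by (simp_all add: append_eq_append_conv)
  have "last (triple S (ascent k w)) = q" "last (triple S' (ascent k w')) = q'"
    using sp(2) sp'(2) by simp_all
  hence "q = q'" using T by simp
  hence h: "top_level k w = top_level k w'" using sp(4) sp'(4) by simp
  have "map ?r (map ?r (descent k w)) = map ?r (map ?r (descent k w'))" using D h by simp
  hence D': "descent k w = descent k w'" by (simp add: comp_def)
  \<comment> \<open>An unmarked edge keeps its multiplicity of at most 3, a marked one has 3 +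
    1.\<close>
  have mult: "S = {e. count (edges (triple S (ascent k w))) e + count (edges (descent k w)) e \<ge> 4}"
    if w: "w \<in> rooted_polygons k n" "S \<subseteq> links k w" for w S
  proof -
    have "count (edges (ascent k w)) e + count (edges (descent k w)) e \<le> 3" for e
    proof -
      have "admissible (edges (w @ [hd w]))" "w \<noteq> []" using w by (auto simp: rooted_polygons_def polygons_def)
      thus ?thesis using edges_ascent_descent[of w k] by (simp add: admissible_def)
    qed
    hence *: "count (edges (ascent k w)) e + count (edges (descent k w)) e < 4" for e
      by (simp add: le_less_trans[where y = 3])
    have "count (edges (triple S (ascent k w))) e + count (edges (descent k w)) e \<ge> 4 \<longleftrightarrow> e \<in> S" for e
      using w(2) *[of e] by (cases "e \<in> S") (auto simp: count_edges_triple links_def)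
    thus ?thesis by blast
  qed
  have S: "S = S'" using mult[OF w] mult[OF w'] T D' by simp
  have "ascent k w = ascent k w'" using T S triple_inject by blast
  hence "us = us'" using sp sp' by simp
  moreover have "vs = vs'" using D' sp sp' by simp
  ultimately show ?thesis using S sp(1) sp'(1) \<open>q = q'\<close> by simp
qed

lemma sum_Pow_power:
  fixes x :: real
  assumes "finite A"
  shows "(\<Sum>S\<in>Pow A. x ^ card S) = (1 + x) ^ card A"
  using prod_add[OF assms, of "\<lambda>_. x" "\<lambda>_. 1"] by (simp add: add.commute)

lemma finite_rooted_polygons: "finite (rooted_polygons k n)"
proof (cases "n = 0")
  case True
  hence "rooted_polygons k n = {}" by (auto simp: rooted_polygons_def polygons_def)
  thus ?thesis by simp
next
  case False
  thus ?thesis by (intro finite_subset[OF _ finite_polygons[of n]]) (auto simp: rooted_polygons_def)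
qed

text \<open>Expand the power over subsets of the links, with weight \<open>1 / \<mu>\<^sup>2\<close>
  per edge. A subset of size j leads to a bridge longer by 2 j, and the weight cancels exactly this
  growth. One factor \<open>3 * real n + 2\<close> bounds the positions where the ascent may end,
  the other the sizes of the subset.\<close>

lemma sum_links_le:
  fixes k :: "'d::finite" and \<mu> :: real
  assumes mu: "\<mu> \<ge> 1" and bridges: "\<And>n. n \<ge> 1 \<Longrightarrow> card (bridges k n) \<le> \<mu> ^ n"
  shows "(\<Sum>w\<in>rooted_polygons k n. (1 + 1 / \<mu>\<^sup>2) ^ card (links k w)) \<le> (3 * real n + 2)\<^sup>2 * \<mu> ^ (n + 1)"
proof -
  define P where "P = Sigma (rooted_polygons k n) (\<lambda>w. Pow (links k w))"
  define x where "x = 1 / \<mu>\<^sup>2"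
  have finP: "finite P" unfolding P_def using finite_rooted_polygons finite_links by blast
  have cardS: "card (snd p) \<in> {..n}" if "p \<in> P" for p
    using that card_subset_links[of "fst p" n "snd p" k] by (auto simp: P_def rooted_polygons_def)
  have Pj: "real (card {p \<in> P. card (snd p) = j}) \<le> (3 * real n + 2) * \<mu> ^ (n + 2 * j + 1)"
    if j: "j \<le> n" for j
  proof -
    let ?f = "\<lambda>(w, S). (length (triple S (ascent k w)), unfold_walk k S w)"
    have "card {p \<in> P. card (snd p) = j} \<le> card ({..n + 2 * j + 1} \<times> bridges k (n + 2 * j + 1))"
    proof (rule card_inj_on_le[of ?f])
      show "inj_on ?f {p \<in> P. card (snd p) = j}"
      proof (rule inj_onI)
        fix p p' assume A: "p \<in> {p \<in> P. card (snd p) = j}" "p' \<in> {p \<in> P. card (snd p) = j}"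
          "?f p = ?f p'"
        thus "p = p'"
          using unfold_walk_inject[of "fst p" k n "snd p" "fst p'" "snd p'"]
          by (auto simp: P_def split: prod.splits)
      qed
      show "?f ` {p \<in> P. card (snd p) = j} \<subseteq> {..n + 2 * j + 1} \<times> bridges k (n + 2 * j + 1)"
      proof
        fix y assume "y \<in> ?f ` {p \<in> P. card (snd p) = j}"
        then obtain w S where y: "y = ?f (w, S)" "w \<in> rooted_polygons k n" "S \<subseteq> links k w" "card S = j"
          by (auto simp: P_def)
        have B: "unfold_walk k S w \<in> bridges k (n + 2 * j + 1)" using unfold_walk_in_bridges[OF y(2,3)] y(4) by simp
        moreover have "length (triple S (ascent k w)) < length (unfold_walk k S w)"
          by (simp add: unfold_walk_def descent_def)
        ultimately show "y \<in> {..n + 2 * j + 1} \<times> bridges k (n + 2 * j + 1)"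
          using y(1) by (simp add: bridges_def walks_def)
      qed
    qed (simp add: finite_bridges)
    hence "real (card {p \<in> P. card (snd p) = j}) \<le> real (n + 2 * j + 2) * real (card (bridges k (n + 2 * j + 1)))"
      unfolding card_cartesian_product by (metis (mono_tags) Suc_eq_plus1 add.assoc card_atMost nat_1_add_1 of_nat_le_iff of_nat_mult)
    also have "\<dots> \<le> (3 * real n + 2) * \<mu> ^ (n + 2 * j + 1)"
      using bridges[of "n + 2 * j + 1"] j by (intro mult_mono) auto
    finally show ?thesis .
  qed
  have "(\<Sum>w\<in>rooted_polygons k n. (1 + x) ^ card (links k w)) = (\<Sum>w\<in>rooted_polygons k n. \<Sum>S\<in>Pow (links k w). x ^ card S)"
    by (simp add: sum_Pow_power[OF finite_links])
  also have "\<dots> = (\<Sum>p\<in>P. x ^ card (snd p))"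
    unfolding P_def by (subst sum.Sigma) (auto simp: finite_rooted_polygons finite_links split_def)
  also have "\<dots> = (\<Sum>j\<le>n. \<Sum>p\<in>{p \<in> P. card (snd p) = j}. x ^ card (snd p))"
    using finP cardS by (intro sum.group[symmetric]) auto
  also have "\<dots> = (\<Sum>j\<le>n. real (card {p \<in> P. card (snd p) = j}) * x ^ j)"
    by (intro sum.cong) auto
  also have "\<dots> \<le> (\<Sum>j\<le>n. (3 * real n + 2) * \<mu> ^ (n + 1))"
  proof (rule sum_mono)
    fix j assume "j \<in> {..n}"
    hence "real (card {p \<in> P. card (snd p) = j}) * x ^ j
        \<le> ((3 * real n + 2) * \<mu> ^ (n + 2 * j + 1)) * x ^ j"
      using Pj[of j] mu by (intro mult_right_mono) (auto simp: x_def)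
    also have "\<dots> = (3 * real n + 2) * \<mu> ^ (n + 1)"
      using mu by (simp add: x_def power_add power_divide power_mult[symmetric])
    finally show "real (card {p \<in> P. card (snd p) = j}) * x ^ j \<le> (3 * real n + 2) * \<mu> ^ (n + 1)" .
  qed
  also have "\<dots> = (real n + 1) * ((3 * real n + 2) * \<mu> ^ (n + 1))" by simp
  also have "\<dots> \<le> (3 * real n + 2) * ((3 * real n + 2) * \<mu> ^ (n + 1))"
    using mu by (intro mult_right_mono) auto
  finally show ?thesis by (simp add: x_def power2_eq_square mult.assoc)
qed


section \<open>Rooting polygons at their lowest vertex\<close>

lemma edges_cyclic_rotate: "edges (rotate i w @ [hd (rotate i w)]) = edges (w @ [hd w])"
proof -
  have "edges ((drop m w @ take m w) @ [hd (drop m w @ take m w)]) = edges (w @ [hd w])" for m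
    using edges_rotate[of "drop m w" "take m w"] by (metis append.assoc append_take_drop_id)
  thus ?thesis unfolding rotate_drop_take by blast
qed

definition rooted :: "'d::finite \<Rightarrow> (int ^ 'd) list \<Rightarrow> bool" where
  "rooted k w \<longleftrightarrow> w \<noteq> [] \<and> (\<forall>v\<in>set (tl w). hd w $ k < v $ k)"

lemma rooted_polygons_rooted: "w \<in> rooted_polygons k n \<Longrightarrow> rooted k w"
  by (simp add: rooted_polygons_def polygons_def rooted_def)

lemma rooted_translate: "rooted k (translate v w) \<longleftrightarrow> rooted k w"
  by (cases w) (auto simp: rooted_def)

text \<open>The head of a proper rotation would be a non-root vertex, hence strictly above the old
  root, and by its own rootedness also strictly below it.\<close>

lemma rooted_rotate_fixed:
  assumes w: "rooted k w" and w': "rooted k (rotate m w)" and m: "m < length w"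
  shows "m = 0"
proof (rule ccontr)
  assume m0: "m \<noteq> 0"
  have r: "rotate m w = drop m w @ take m w" using m by (simp add: rotate_drop_take)
  obtain y ys where y: "drop m w = y # ys" using m by (cases "drop m w") auto
  obtain p t where p: "w = p # t" using w by (cases w) (auto simp: rooted_def)
  have tk: "take m w = p # take (m - 1) t" using m0 p by (cases m) auto
  have "y \<in> set t" using y m0 p by (cases m) (auto dest!: arg_cong[where f = set] intro: in_set_dropD)
  hence "p $ k < y $ k" using w p by (auto simp: rooted_def)
  moreover have "y $ k < p $ k" using w' r y tk by (auto simp: rooted_def)
  ultimately show False by simp
qed

lemma rooted_rotate_unique:
  assumes w: "rooted k w" and w': "rooted k w'" and len: "length w = length w'"
    and i: "i < length w" and j: "j < length w" and eq: "rotate i w = rotate j w'"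
  shows "i = j \<and> w = w'"
proof -
  let ?n = "length w"
  have "rotate (?n - j) (rotate j w') = w'" using j len by (simp add: rotate_rotate rotate_id)
  hence w'eq: "w' = rotate (?n - j + i) w" using eq by (metis rotate_rotate)
  hence w'm: "w' = rotate ((?n - j + i) mod ?n) w" by (metis rotate_conv_mod)
  have "(?n - j + i) mod ?n < ?n" using i by (intro mod_less_divisor) linarith
  hence 0: "(?n - j + i) mod ?n = 0" using rooted_rotate_fixed[OF w] w' w'm by metis
  hence "w' = w" using w'm by simp
  moreover have "i = j"
  proof -
    obtain c where "?n - j + i = ?n * c" using 0 by auto
    moreover have "0 < ?n - j + i" "?n - j + i < ?n * 2" using i j by auto
    ultimately have "0 < ?n * c" "?n * c < ?n * 2" by simp_all
    hence "c = 1" using i by (cases c) auto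
    thus ?thesis using \<open>?n - j + i = ?n * c\<close> j by simp
  qed
  ultimately show ?thesis by simp
qed

lemma polygons_rotate:
  assumes "w \<in> polygons n" "w \<noteq> []"
  shows "translate (- hd (rotate i w)) (rotate i w) \<in> polygons n"
proof -
  let ?x = "rotate i w"
  have ne: "?x \<noteq> []" using assms by simp
  have "translate (- hd ?x) ?x @ [0] = translate (- hd ?x) (?x @ [hd ?x])" by simp
  moreover have "admissible (edges (?x @ [hd ?x]))"
    using assms(1) unfolding edges_cyclic_rotate polygons_def by blast
  ultimately have "admissible (edges (translate (- hd ?x) ?x @ [0]))" by (metis admissible_translate)
  thus ?thesis using assms ne by (simp add: polygons_def)
qed

lemma translate_rotate: "translate v (rotate i w) = rotate i (translate v w)"
  by (simp add: translate_def rotate_map)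

lemma translate_eq_iff: "translate u w = translate v w' \<longleftrightarrow> w = translate (v - u) w'"
proof
  assume "translate u w = translate v w'"
  hence "translate (- u) (translate u w) = translate (- u) (translate v w')" by simp
  thus "w = translate (v - u) w'" by simp
qed simp

lemma translate_fixes_root:
  assumes "w = translate v w'" "w' \<noteq> []" "hd w = hd w'"
  shows "w = w'"
proof -
  have "hd w = hd w' + v" using assms(1,2) by simp
  hence "v = 0" using assms(3) by simp
  thus ?thesis using assms(1) by simp
qed

text \<open>The n choices of a starting vertex give distinct polygons, because the position of the
  strictly lowest vertex reveals the choice.\<close>

lemma card_rooted_polygons_le:
  fixes k :: "'d::finite"
  shows "n * card (rooted_polygons k n) \<le> card (polygons n :: (int ^ 'd) list set)"
proof (cases "n = 0")
  case False
  let ?f = "\<lambda>(i, w). translate (- hd (rotate i w)) (rotate i w) :: (int ^ 'd) list"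
  have "card ({..<n} \<times> rooted_polygons k n) \<le> card (polygons n :: (int ^ 'd) list set)"
  proof (rule card_inj_on_le[of ?f])
    show "?f ` ({..<n} \<times> rooted_polygons k n) \<subseteq> polygons n" using polygons_rotate by (auto simp: rooted_polygons_def)
    show "inj_on ?f ({..<n} \<times> rooted_polygons k n)"
    proof (rule inj_onI, clarify)
      fix i j :: nat and w w' :: "(int ^ 'd) list"
      assume A: "i < n" "j < n" "w \<in> rooted_polygons k n" "w' \<in> rooted_polygons k n"
        and eq: "translate (- hd (rotate i w)) (rotate i w) = translate (- hd (rotate j w')) (rotate j w')"
      have v: "rotate i w = rotate j (translate (hd (rotate i w) - hd (rotate j w')) w')"
        (is "_ = rotate j (translate ?v w')")
        using eq unfolding translate_eq_iff by (simp add: translate_rotate)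
      have len: "length w = n" "length w' = n" using A by (auto simp: rooted_polygons_def polygons_def)
      have "i = j \<and> w = translate ?v w'"
        using rooted_rotate_unique[of k w "translate ?v w'" i j] v A len rooted_polygons_rooted
        by (auto simp: rooted_translate)
      moreover have "hd w = 0" "hd w' = 0" "w' \<noteq> []" using A by (auto simp: rooted_polygons_def polygons_def)
      ultimately show "i = j \<and> w = w'" using translate_fixes_root[of w ?v w'] by metis
    qed
    show "finite (polygons n :: (int ^ 'd) list set)" using False by (intro finite_polygons) simp
  qed
  thus ?thesis by (simp add: card_cartesian_product)
qed simp

text \<open>The spike makes a lowest vertex the unique lowest one, so that no tie has to be broken.\<close>

definition spike :: "'d::finite \<Rightarrow> (int ^ 'd) list \<Rightarrow> (int ^ 'd) list" where
  "spike k x = 0 # translate (axis k 1 - hd x) x @ [axis k 1]"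

lemma set_tl_spike: "x \<noteq> [] \<Longrightarrow> set (tl (spike k x)) = (\<lambda>v. v + (axis k 1 - hd x)) ` set x"
  using hd_in_set[of x] by (force simp: spike_def image_iff)

text \<open>The edge of the spike is traversed twice, and no other edge touches the new root because
  the old vertices all lie on positive levels.\<close>

lemma spike_in_rooted_polygons:
  assumes x: "x \<noteq> []" "length x = n" "admissible (edges (x @ [hd x]))"
    and min: "\<And>v. v \<in> set x \<Longrightarrow> hd x $ k \<le> v $ k"
  shows "spike k x \<in> rooted_polygons k (n + 2)"
proof -
  let ?e = "axis k 1 :: int ^ 'a" and ?y = "translate (axis k 1 - hd x) x"
  have y: "?y \<noteq> []" "hd ?y = ?e" using x by simp_all
  have pos: "0 < v $ k" if v: "v \<in> set (tl (spike k x))" for v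
  proof -
    obtain u where u: "u \<in> set x" "v = u + (axis k 1 - hd x)"
      using v unfolding set_tl_spike[OF x(1)] by blast
    have "v $ k = u $ k + 1 - hd x $ k" by (simp add: u(2) axis_def)
    thus ?thesis using min[OF u(1)] by linarith
  qed
  obtain ys where ys: "?y = ?e # ys" using y by (cases ?y) auto
  have "edges (spike k x @ [0]) = {#{0, ?e}, {0, ?e}#} + edges (?y @ [?e])"
    using edges_append[of "0 # ?y" ?e "[0]"] ys by (simp add: spike_def insert_commute)
  moreover have "admissible ({#{0, ?e}, {0, ?e}#} + edges (?y @ [?e]))"
  proof (rule admissible_add)
    show "admissible {#{0, ?e}, {0, ?e}#}"
      using nn_edge_iff[of 0 ?e] by (simp add: admissible_def)
    have "?y @ [?e] = translate (axis k 1 - hd x) (x @ [hd x])" by simp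
    thus "admissible (edges (?y @ [?e]))" using x(3) by (metis admissible_translate)
    have "set (?y @ [?e]) = set (tl (spike k x))" by (simp add: spike_def)
    hence "0 \<notin> set (?y @ [?e])" using pos[of 0] by auto
    thus "set_mset {#{0, ?e}, {0, ?e}#} \<inter> set_mset (edges (?y @ [?e])) = {}"
      using edges_subset[of "{0, ?e}" "?y @ [?e]"] by auto
  qed
  ultimately have "admissible (edges (spike k x @ [0]))" by simp
  moreover have "hd (spike k x) = 0" "length (spike k x) = n + 2" "spike k x \<noteq> []"
    using x by (simp_all add: spike_def)
  ultimately show ?thesis using pos by (simp add: rooted_polygons_def polygons_def)
qed

section \<open>Widths of projections along a coordinate\<close>

definition flatten :: "'d::finite \<Rightarrow> int ^ 'd \<Rightarrow> int ^ 'd" where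
  "flatten j v = (\<chi> i. if i = j then 0 else v $ i)"

lemma flatten_add: "flatten j (u + v) = flatten j u + flatten j v"
  by (simp add: flatten_def vec_eq_iff)

lemma card_flatten_translate:
  "card (flatten j ` (\<lambda>v. v + u) ` S) = card (flatten j ` S)"
proof -
  have "flatten j ` (\<lambda>v. v + u) ` S = (\<lambda>v. v + flatten j u) ` flatten j ` S"
    by (simp add: image_image flatten_add)
  thus ?thesis by (simp add: card_image)
qed

text \<open>Restart at a lowest vertex and attach a spike. The original is recovered from the index
  of that vertex, which costs the factor \<open>n\<close>; translations do not change the
  width.\<close>

lemma card_polygons_wide_le:
  fixes k j :: "'d::finite" and K :: real
  assumes n: "n \<ge> 1"
  shows "card {w \<in> polygons n. K \<le> card (flatten j ` set w)}
    \<le> n * card {w \<in> rooted_polygons k (n + 2). K \<le> card (flatten j ` set (tl w))}"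
proof -
  define idx where "idx = (\<lambda>w :: (int ^ 'd) list. SOME i. i < n \<and> (\<forall>v\<in>set w. w ! i $ k \<le> v $ k))"
  have idx: "idx w < n \<and> (\<forall>v\<in>set w. w ! idx w $ k \<le> v $ k)" if "w \<in> polygons n" for w
  proof -
    have len: "length w = n" using that by (simp add: polygons_def)
    hence "set w \<noteq> {}" using n by auto
    hence "\<exists>u\<in>set w. \<forall>v\<in>set w. u $ k \<le> v $ k"
      using arg_min_if_finite(1)[of "set w" "\<lambda>v. v $ k"] arg_min_least[of "set w" _ "\<lambda>v. v $ k"]
      by (metis List.finite_set)
    then obtain u where u: "u \<in> set w" "\<forall>v\<in>set w. u $ k \<le> v $ k" by blast
    then obtain i where "i < n" "w ! i = u" using len by (metis in_set_conv_nth)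
    hence "\<exists>i. i < n \<and> (\<forall>v\<in>set w. w ! i $ k \<le> v $ k)" using u(2) by blast
    thus ?thesis unfolding idx_def by (rule someI_ex)
  qed
  let ?f = "\<lambda>w. (idx w, spike k (rotate (idx w) w))"
  have "card {w \<in> polygons n. K \<le> card (flatten j ` set w)}
    \<le> card ({..<n} \<times> {w \<in> rooted_polygons k (n + 2). K \<le> card (flatten j ` set (tl w))})"
  proof (rule card_inj_on_le[of ?f])
    show "finite ({..<n} \<times> {w \<in> rooted_polygons k (n + 2). K \<le> card (flatten j ` set (tl w))})"
      by (intro finite_cartesian_product finite_subset[OF _ finite_rooted_polygons[of k "n + 2"]]) auto
    show "?f ` {w \<in> polygons n. K \<le> card (flatten j ` set w)}
      \<subseteq> {..<n} \<times> {w \<in> rooted_polygons k (n + 2). K \<le> card (flatten j ` set (tl w))}"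
    proof (rule image_subsetI)
      fix w :: "(int ^ 'd) list" assume "w \<in> {w \<in> polygons n. K \<le> card (flatten j ` set w)}"
      hence w: "w \<in> polygons n" "K \<le> card (flatten j ` set w)" by auto
      let ?x = "rotate (idx w) w"
      have len: "length w = n" "w \<noteq> []" using w n by (auto simp: polygons_def)
      have "hd ?x = w ! idx w" using len idx[OF w(1)] by (simp add: hd_rotate_conv_nth)
      moreover have "admissible (edges (?x @ [hd ?x]))"
        using w(1) unfolding edges_cyclic_rotate polygons_def by blast
      ultimately have "spike k ?x \<in> rooted_polygons k (n + 2)"
        using len idx[OF w(1)] by (intro spike_in_rooted_polygons) auto
      moreover have "card (flatten j ` set (tl (spike k ?x))) = card (flatten j ` set w)"
        using set_tl_spike[of ?x k] card_flatten_translate len by simp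
      ultimately show "?f w \<in> {..<n} \<times> {w \<in> rooted_polygons k (n + 2). K \<le> card (flatten j ` set (tl w))}"
        using w idx[OF w(1)] by simp
    qed
    show "inj_on ?f {w \<in> polygons n. K \<le> card (flatten j ` set w)}"
    proof (rule inj_onI, clarify)
      fix w w' :: "(int ^ 'd) list" assume w: "w \<in> polygons n" "w' \<in> polygons n" and i: "idx w = idx w'"
        and s: "spike k (rotate (idx w) w) = spike k (rotate (idx w') w')"
      let ?v = "hd (rotate (idx w) w) - hd (rotate (idx w) w')"
      have "translate (axis k 1 - hd (rotate (idx w) w)) (rotate (idx w) w)
          = translate (axis k 1 - hd (rotate (idx w) w')) (rotate (idx w) w')"
        using s i by (simp add: spike_def)
      hence v: "rotate (idx w) w = rotate (idx w) (translate ?v w')"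
        unfolding translate_eq_iff by (simp add: translate_rotate)
      have "length w = n" "length w' = n" using w by (simp_all add: polygons_def)
      hence "rotate (n - idx w) (rotate (idx w) w) = w"
        "rotate (n - idx w) (rotate (idx w) (translate ?v w')) = translate ?v w'"
        using idx[OF w(1)] by (simp_all add: rotate_rotate rotate_id)
      hence "w = translate ?v w'" using v by metis
      moreover have "hd w = 0" "hd w' = 0" "w' \<noteq> []" using w n by (auto simp: polygons_def)
      ultimately show "w = w'" using translate_fixes_root[of w ?v w'] by metis
    qed
  qed
  thus ?thesis by (simp add: card_cartesian_product)
qed

definition swap_coords :: "'d::finite \<Rightarrow> 'd \<Rightarrow> int ^ 'd \<Rightarrow> int ^ 'd" where
  "swap_coords i j v = (\<chi> l. v $ Transposition.transpose i j l)"

lemma swap_coords_isometry: "znorm (swap_coords i j x - swap_coords i j y) = znorm (x - y)"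
proof -
  have "(\<Sum>l\<in>UNIV. (real_of_int ((x - y) $ Transposition.transpose i j l))\<^sup>2)
      = (\<Sum>l\<in>UNIV. (real_of_int ((x - y) $ l))\<^sup>2)"
    by (rule sum.reindex_bij_witness[of _ "Transposition.transpose i j" "Transposition.transpose i j"]) auto
  thus ?thesis unfolding znorm_eq_sqrt swap_coords_def by simp
qed

text \<open>Exchanging two coordinates is a lattice symmetry. It allows the width to be measured in
  one fixed direction, which can then be taken different from the height direction.\<close>

lemma card_polygons_wide_swap:
  fixes i j :: "'d::finite" and K :: real
  assumes n: "n \<ge> 1"
  shows "card {w \<in> polygons n. K \<le> card (flatten j ` set w)}
    \<le> card {w \<in> polygons n. K \<le> card (flatten i ` set w)}"
proof (rule card_inj_on_le[of "map (swap_coords i j)"])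
  let ?s = "swap_coords i j"
  have inj: "inj ?s" using isometry_inj swap_coords_isometry by blast
  show "inj_on (map ?s) {w \<in> polygons n. K \<le> card (flatten j ` set w)}"
    using inj by (meson inj_mapI inj_on_subset subset_UNIV)
  show "finite {w \<in> polygons n. K \<le> card (flatten i ` set w)}"
    by (rule finite_subset[OF _ finite_polygons[OF n]]) auto
  show "map ?s ` {w \<in> polygons n. K \<le> card (flatten j ` set w)}
    \<subseteq> {w \<in> polygons n. K \<le> card (flatten i ` set w)}"
  proof clarify
    fix w :: "(int ^ 'd) list" assume w: "w \<in> polygons n" "K \<le> card (flatten j ` set w)"
    have ne: "w \<noteq> []" using w n by (auto simp: polygons_def)
    have 0: "?s 0 = 0" by (simp add: swap_coords_def vec_eq_iff)
    have "map ?s w @ [hd (map ?s w)] = map ?s (w @ [hd w])" using ne by (simp add: hd_map)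
    moreover have "admissible (edges (map ?s (w @ [hd w])))"
      unfolding edges_map using w(1) unfolding polygons_def by (intro admissible_image[OF swap_coords_isometry]) blast
    ultimately have "map ?s w \<in> polygons n" using w ne 0 by (simp add: polygons_def hd_map)
    moreover have "flatten i (?s v) = ?s (flatten j v)" for v
      by (auto simp: flatten_def swap_coords_def vec_eq_iff Transposition.transpose_def)
    hence "flatten i ` set (map ?s w) = ?s ` flatten j ` set w" by (simp add: image_image)
    hence "card (flatten i ` set (map ?s w)) = card (flatten j ` set w)"
      using inj by (simp add: card_image inj_on_subset)
    ultimately show "map ?s w \<in> polygons n \<and> K \<le> card (flatten i ` set (map ?s w))" using w by simp
  qed
qed


section \<open>A wide coordinate projection\<close>

text \<open>Bounding every projection of a slice by their sum loses a factor depending only on the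
  dimension, but avoids the generalised Hoelder inequality of the sharp Loomis--Whitney bound.\<close>

lemma loomis_whitney_max:
  fixes I :: "'i set"
  assumes "finite I" "I \<noteq> {}"
  shows "\<exists>C>0. \<forall>(S :: ('i \<Rightarrow> int) set) (K :: nat). finite S \<longrightarrow> S \<noteq> {} \<longrightarrow>
    (\<forall>x\<in>S. \<forall>y\<in>S. \<forall>i. i \<notin> I \<longrightarrow> x i = y i) \<longrightarrow>
    (\<forall>i\<in>I. card ((\<lambda>x. x(i := 0)) ` S) \<le> K) \<longrightarrow>
    real (card S) ^ (card I - 1) \<le> C * real K ^ card I"
  using assms
proof (induction I rule: finite_ne_induct)
  case (singleton i)
  have *: "real (card S) ^ 0 \<le> 1 * real K ^ 1"
    if "finite S" "S \<noteq> {}" "card ((\<lambda>x. x(i := 0)) ` S) \<le> K" for S :: "('i \<Rightarrow> int) set" and K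
  proof -
    have "card ((\<lambda>x. x(i := 0)) ` S) > 0" using that by (simp add: card_gt_0_iff)
    thus ?thesis using that(3) by simp
  qed
  show ?case
  proof (intro exI[of _ "1 :: real"] conjI allI impI)
    fix S :: "('i \<Rightarrow> int) set" and K :: nat
    assume "finite S" "S \<noteq> {}" "\<forall>i\<in>{i}. card ((\<lambda>x. x(i := 0)) ` S) \<le> K"
    thus "real (card S) ^ (card {i} - 1) \<le> 1 * real K ^ card {i}" using *[of S K] by simp
  qed simp
next
  case (insert j I)
  then obtain C where C: "C > 0" "\<And>(S :: ('i \<Rightarrow> int) set) (K :: nat). finite S \<Longrightarrow> S \<noteq> {} \<Longrightarrow>
    (\<forall>x\<in>S. \<forall>y\<in>S. \<forall>i. i \<notin> I \<longrightarrow> x i = y i) \<Longrightarrow>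
    (\<forall>i\<in>I. card ((\<lambda>x. x(i := 0)) ` S) \<le> K) \<Longrightarrow>
    real (card S) ^ (card I - 1) \<le> C * real K ^ card I" by metis
  define n where "n = card I"
  have n: "n > 0" using insert by (simp add: n_def card_gt_0_iff)
  have "real (card S) ^ n \<le> (C * real n ^ n) * real K ^ (n + 1)"
    if S: "finite S" "S \<noteq> {}" "\<forall>x\<in>S. \<forall>y\<in>S. \<forall>i. i \<notin> insert j I \<longrightarrow> x i = y i"
      and K: "\<forall>i\<in>insert j I. card ((\<lambda>x. x(i := 0)) ` S) \<le> K" for S :: "('i \<Rightarrow> int) set" and K
  proof -
    define slice where "slice = (\<lambda>t. {x \<in> S. x j = t})"
    define T where "T = (\<lambda>x. x j) ` S"
    define P where "P = (\<lambda>(i :: 'i) A. card ((\<lambda>x :: 'i \<Rightarrow> int. x(i := 0)) ` A))"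
    have finT: "finite T" using S by (simp add: T_def)
    have fin_slice: "finite (slice t)" for t using S by (simp add: slice_def)
    have S_slice: "S = (\<Union>t\<in>T. slice t)" by (auto simp: slice_def T_def)
    have slice_le: "real (card (slice t)) \<le> root n (C * real K) * (\<Sum>i\<in>I. P i (slice t))" if "t \<in> T" for t
    proof -
      define Kt where "Kt = (\<Sum>i\<in>I. P i (slice t))"
      have ne: "slice t \<noteq> {}" using that by (auto simp: slice_def T_def)
      have "\<forall>x\<in>slice t. \<forall>y\<in>slice t. \<forall>i. i \<notin> I \<longrightarrow> x i = y i"
        using S(3) unfolding slice_def by (metis (mono_tags, lifting) insert_iff mem_Collect_eq)
      moreover have "P i (slice t) \<le> Kt" if "i \<in> I" for i
        unfolding Kt_def using insert.hyps that by (intro member_le_sum) auto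
      ultimately have ih: "real (card (slice t)) ^ (n - 1) \<le> C * real Kt ^ n"
        unfolding n_def using C(2)[of "slice t" Kt] ne fin_slice by (simp add: P_def)
      \<comment> \<open>A slice has constant coordinate \<open>j\<close>, so projecting along
        \<open>j\<close> is injective on it and it has at most \<open>K\<close> points. This
        supplies the factor that raises the power from n - 1 to n.\<close>
      have "inj_on (\<lambda>x. x(j := 0)) (slice t)"
      proof (rule inj_onI)
        fix x y assume xy: "x \<in> slice t" "y \<in> slice t" "x(j := 0) = y(j := 0)"
        have "x j = y j" using xy by (simp add: slice_def)
        thus "x = y" using xy(3) by (metis fun_upd_triv fun_upd_upd)
      qed
      hence "card (slice t) = P j (slice t)" by (simp add: P_def card_image)
      also have "\<dots> \<le> P j S"
        unfolding P_def using S by (intro card_mono) (auto simp: slice_def)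
      also have "\<dots> \<le> K" using K by (simp add: P_def)
      finally have "real (card (slice t)) * real (card (slice t)) ^ (n - 1) \<le> real K * (C * real Kt ^ n)"
        using ih by (intro mult_mono) auto
      hence "real (card (slice t)) ^ n \<le> (C * real K) * real Kt ^ n"
        using n by (simp add: power_eq_if mult.assoc mult.left_commute)
      also have "\<dots> = (root n (C * real K) * real Kt) ^ n"
        using C(1) n by (simp add: power_mult_distrib)
      finally have "real (card (slice t)) \<le> root n (C * real K) * real Kt"
        using C(1) n power_mono_iff[of "real (card (slice t))" "root n (C * real K) * real Kt" n]
        by (simp add: real_root_ge_zero)
      thus ?thesis by (simp add: Kt_def)
    qed
    \<comment> \<open>Projecting along \<open>i \<noteq> j\<close> keeps the coordinate
      \<open>j\<close>, so different slices have disjoint projections.\<close>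
    have P_sum: "(\<Sum>t\<in>T. P i (slice t)) = P i S" if i: "i \<in> I" for i
    proof -
      have ij: "i \<noteq> j" using i insert by auto
      have "(\<lambda>x. x(i := 0)) ` S = (\<Union>t\<in>T. (\<lambda>x. x(i := 0)) ` slice t)"
        using S_slice by blast
      moreover have "card (\<Union>t\<in>T. (\<lambda>x. x(i := 0)) ` slice t)
          = (\<Sum>t\<in>T. card ((\<lambda>x. x(i := 0)) ` slice t))"
      proof (rule card_UN_disjoint[OF finT])
        show "\<forall>s\<in>T. \<forall>t\<in>T. s \<noteq> t \<longrightarrow>
          (\<lambda>x. x(i := 0)) ` slice s \<inter> (\<lambda>x. x(i := 0)) ` slice t = {}"
        proof (intro ballI impI, rule ccontr)
          fix s t assume st: "s \<noteq> t" "(\<lambda>x. x(i := 0)) ` slice s \<inter> (\<lambda>x. x(i := 0)) ` slice t \<noteq> {}"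
          then obtain x y where xy: "x \<in> slice s" "y \<in> slice t" "x(i := 0) = y(i := 0)" by auto
          have "x j = y j" using xy(3) ij by (metis fun_upd_other)
          thus False using xy(1,2) st(1) by (simp add: slice_def)
        qed
      qed (use fin_slice in auto)
      ultimately show ?thesis by (simp add: P_def)
    qed
    have "card S = (\<Sum>t\<in>T. card (slice t))"
      unfolding S_slice by (rule card_UN_disjoint[OF finT]) (auto simp: fin_slice slice_def S(1))
    hence "real (card S) = (\<Sum>t\<in>T. real (card (slice t)))" by simp
    also have "\<dots> \<le> (\<Sum>t\<in>T. root n (C * real K) * (\<Sum>i\<in>I. P i (slice t)))"
      by (rule sum_mono) (rule slice_le)
    also have "\<dots> = root n (C * real K) * real (\<Sum>t\<in>T. \<Sum>i\<in>I. P i (slice t))"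
      by (simp add: sum_distrib_left)
    also have "(\<Sum>t\<in>T. \<Sum>i\<in>I. P i (slice t)) = (\<Sum>i\<in>I. P i S)"
      using P_sum by (subst sum.swap) simp
    also have "root n (C * real K) * real (\<Sum>i\<in>I. P i S) \<le> root n (C * real K) * (real n * real K)"
    proof (rule mult_left_mono)
      have "(\<Sum>i\<in>I. P i S) \<le> (\<Sum>i\<in>I. K)" using K by (intro sum_mono) (simp add: P_def)
      hence "(\<Sum>i\<in>I. P i S) \<le> n * K" by (simp add: n_def)
      thus "real (\<Sum>i\<in>I. P i S) \<le> real n * real K" by (metis of_nat_le_iff of_nat_mult)
    qed (use C(1) n in \<open>simp add: real_root_ge_zero\<close>)
    finally have "real (card S) ^ n \<le> (root n (C * real K) * (real n * real K)) ^ n"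
      by (intro power_mono) auto
    also have "\<dots> = (C * real n ^ n) * real K ^ (n + 1)"
      using C(1) n by (simp add: power_mult_distrib)
    finally show ?thesis .
  qed
  note bound = this
  have n1: "card (insert j I) = n + 1" using insert by (simp add: n_def)
  show ?case
  proof (intro exI[of _ "C * real n ^ n"] conjI allI impI)
    show "C * real n ^ n > 0" using C(1) n by simp
    fix S :: "('i \<Rightarrow> int) set" and K :: nat
    assume "finite S" "S \<noteq> {}" "\<forall>x\<in>S. \<forall>y\<in>S. \<forall>i. i \<notin> insert j I \<longrightarrow> x i = y i"
      "\<forall>i\<in>insert j I. card ((\<lambda>x. x(i := 0)) ` S) \<le> K"
    from bound[OF this]
    show "real (card S) ^ (card (insert j I) - 1) \<le> C * real n ^ n * real K ^ card (insert j I)"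
      by (simp add: n1)
  qed
qed

lemma finite_unit_vectors: "finite {u :: int ^ 'd::finite. znorm u = 1}"
proof -
  let ?B = "{u :: int ^ 'd. \<forall>i. u $ i \<in> {-1..1}}"
  have "vec_nth ` ?B \<subseteq> (UNIV \<rightarrow>\<^sub>E {-1..1})" by (auto simp: PiE_iff)
  hence "finite (vec_nth ` ?B)" by (rule finite_subset) (intro finite_PiE, auto)
  hence "finite ?B" by (rule finite_imageD) (auto simp: inj_on_def vec_eq_iff)
  moreover have "u $ i \<in> {-1..1}" if "znorm u = 1" for u :: "int ^ 'd" and i
    using abs_nth_le_znorm[of u i] that by auto
  hence "{u :: int ^ 'd. znorm u = 1} \<subseteq> ?B" by blast
  ultimately show ?thesis by (rule finite_subset[rotated])
qed

text \<open>Degrees are bounded and each edge is used at most three times, so a closed walk meets a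
  number of vertices at least proportional to its length.\<close>

lemma length_le_vertices:
  obtains D :: real where "D > 0"
    "\<And>n (w :: (int ^ 'd::finite) list). n \<ge> 1 \<Longrightarrow> w \<in> polygons n \<Longrightarrow> n \<le> D * card (set w)"
proof -
  let ?U = "{u :: int ^ 'd. znorm u = 1}"
  have "real n \<le> (3 * real (card ?U) + 1) * card (set w)"
    if n: "n \<ge> 1" and w: "w \<in> polygons n" for n and w :: "(int ^ 'd) list"
  proof -
    let ?E = "edges (w @ [hd w])"
    have ne: "w \<noteq> []" using n w by (auto simp: polygons_def)
    have sub: "set_mset ?E \<subseteq> (\<lambda>(x, u). {x, x + u}) ` (set w \<times> ?U)"
    proof
      fix e assume e: "e \<in># ?E"
      have "e \<in> nn_edges" using e w by (auto simp: polygons_def admissible_def)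
      then obtain x y where xy: "e = {x, y}" "znorm (y - x) = 1"
        by (auto simp: nn_edges_def znorm_minus_commute)
      moreover have "x \<in> set w" using edges_subset[OF e] xy ne by auto
      ultimately show "e \<in> (\<lambda>(x, u). {x, x + u}) ` (set w \<times> ?U)"
        by (intro image_eqI[of _ _ "(x, y - x)"]) auto
    qed
    have "n = size ?E" using w by (simp add: size_edges polygons_def)
    also have "\<dots> = (\<Sum>e\<in>set_mset ?E. count ?E e)" by (simp add: size_multiset_overloaded_eq)
    also have "\<dots> \<le> (\<Sum>e\<in>set_mset ?E. 3)"
      using w unfolding polygons_def admissible_def by (intro sum_mono) blast
    also have "\<dots> = 3 * card (set_mset ?E)" by simp
    also have "card (set_mset ?E) \<le> card ((\<lambda>(x, u). {x, x + u}) ` (set w \<times> ?U))"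
      using sub finite_unit_vectors by (intro card_mono) auto
    also have "\<dots> \<le> card (set w \<times> ?U)" by (intro card_image_le) (simp add: finite_unit_vectors)
    also have "\<dots> = card (set w) * card ?U" by (simp add: card_cartesian_product)
    finally have "n \<le> 3 * (card (set w) * card ?U)" by simp
    hence "real n \<le> real (3 * (card (set w) * card ?U))" by (rule of_nat_mono)
    thus ?thesis by (simp add: algebra_simps)
  qed
  thus thesis using that[of "3 * real (card ?U) + 1"] by simp
qed

lemma wide_direction:
  obtains \<kappa> :: real where "\<kappa> > 0"
    "\<And>n (w :: (int ^ 'd::finite) list). n \<ge> 1 \<Longrightarrow> w \<in> polygons n \<Longrightarrow>
       \<exists>j. \<kappa> * real n powr (1 - 1 / real CARD('d)) \<le> card (flatten j ` set w)"
proof -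
  define d where "d = CARD('d)"
  have d: "d \<ge> 1" by (simp add: d_def Suc_leI)
  obtain D :: real where D: "D > 0"
    "\<And>n (w :: (int ^ 'd) list). n \<ge> 1 \<Longrightarrow> w \<in> polygons n \<Longrightarrow> n \<le> D * card (set w)"
    using length_le_vertices by blast
  obtain C :: real where C: "C > 0" and LW: "\<forall>(S :: ('d \<Rightarrow> int) set) (K :: nat). finite S \<longrightarrow> S \<noteq> {} \<longrightarrow>
    (\<forall>x\<in>S. \<forall>y\<in>S. \<forall>i. i \<notin> UNIV \<longrightarrow> x i = y i) \<longrightarrow>
    (\<forall>i\<in>UNIV. card ((\<lambda>x. x(i := 0)) ` S) \<le> K) \<longrightarrow>
    real (card S) ^ (card (UNIV :: 'd set) - 1) \<le> C * real K ^ card (UNIV :: 'd set)"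
    using loomis_whitney_max[of "UNIV :: 'd set"] by auto
  \<comment> \<open>What remains of \<open>((n / D) ^ (d - 1) / C) powr (1 / d)\<close> once the
    power of n is split off.\<close>
  define \<kappa> where "\<kappa> = ((1 / D) ^ (d - 1) / C) powr (1 / d)"
  have "\<kappa> > 0" using C D by (simp add: \<kappa>_def)
  moreover have "\<exists>j. \<kappa> * real n powr (1 - 1 / real d) \<le> card (flatten j ` set w)"
    if n: "n \<ge> 1" and w: "w \<in> polygons n" for n and w :: "(int ^ 'd) list"
  proof -
    let ?c = "\<lambda>j. card (flatten j ` set w)"
    have ne: "set w \<noteq> {}" using n w by (auto simp: polygons_def)
    define K where "K = Max (range ?c)"
    have "K \<in> range ?c" unfolding K_def by (intro Max_in) auto
    then obtain j where j: "?c j = K" by auto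
    have le: "?c i \<le> K" for i unfolding K_def by (intro Max_ge) auto
    have inj: "inj_on vec_nth A" for A :: "(int ^ 'd) set" by (auto simp: inj_on_def vec_eq_iff)
    have "card ((\<lambda>x. x(i := 0)) ` vec_nth ` set w) = ?c i" for i
    proof -
      have "(vec_nth v)(i := 0) = vec_nth (flatten i v)" for v :: "int ^ 'd"
        by (auto simp: flatten_def fun_eq_iff)
      hence "(\<lambda>x. x(i := 0)) ` vec_nth ` set w = vec_nth ` flatten i ` set w"
        by (simp add: image_image)
      thus ?thesis using card_image[OF inj] by metis
    qed
    hence "real (card (vec_nth ` set w)) ^ (d - 1) \<le> C * real K ^ d"
      using LW ne le unfolding d_def by simp
    hence 1: "real (card (set w)) ^ (d - 1) \<le> C * real K ^ d" using card_image[OF inj] by metis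
    have "real n / D \<le> card (set w)" using D n w by (simp add: field_simps)
    hence "(real n / D) ^ (d - 1) \<le> real (card (set w)) ^ (d - 1)"
      using D by (intro power_mono) auto
    hence "(real n / D) ^ (d - 1) \<le> C * real K ^ d" using 1 by (rule order_trans)
    hence "(real n / D) ^ (d - 1) / C \<le> real K ^ d" using C by (simp add: pos_divide_le_eq mult.commute)
    hence "((real n / D) ^ (d - 1) / C) powr (1 / d) \<le> (real K ^ d) powr (1 / d)"
      using C D by (intro powr_mono2) auto
    also have "(real K ^ d) powr (1 / d) = real K"
      using d by (cases "K = 0") (simp_all add: powr_powr flip: powr_realpow)
    also have "((real n / D) ^ (d - 1) / C) powr (1 / d) = \<kappa> * (real n ^ (d - 1)) powr (1 / d)"
      unfolding \<kappa>_def using C D n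
      by (subst powr_mult[symmetric]) (auto simp: power_divide field_simps)
    also have "(real n ^ (d - 1)) powr (1 / d) = real n powr (1 - 1 / real d)"
      using n d by (simp add: powr_powr of_nat_diff diff_divide_distrib flip: powr_realpow)
    finally show ?thesis using j by auto
  qed
  ultimately show thesis using that unfolding d_def by blast
qed

text \<open>The wide direction depends on the polygon. A union bound over the directions and the
  coordinate symmetry move it to \<open>j\<close> at the price of a factor d.\<close>

lemma card_polygons_le_wide_rooted_polygons:
  fixes k j :: "'d::finite"
  obtains \<kappa> :: real where "\<kappa> > 0"
    "\<And>n. n \<ge> 1 \<Longrightarrow> card (polygons n :: (int ^ 'd) list set) \<le> CARD('d) * n *
       card {w \<in> rooted_polygons k (n + 2). \<kappa> * real n powr (1 - 1 / real CARD('d)) \<le> card (flatten j ` set (tl w))}"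
proof -
  obtain \<kappa> :: real where \<kappa>: "\<kappa> > 0"
    "\<And>n (w :: (int ^ 'd) list). n \<ge> 1 \<Longrightarrow> w \<in> polygons n \<Longrightarrow>
       \<exists>j. \<kappa> * real n powr (1 - 1 / real CARD('d)) \<le> card (flatten j ` set w)"
    using wide_direction by blast
  have "card (polygons n :: (int ^ 'd) list set) \<le> CARD('d) * n *
       card {w \<in> rooted_polygons k (n + 2). \<kappa> * real n powr (1 - 1 / real CARD('d)) \<le> card (flatten j ` set (tl w))}"
    if n: "n \<ge> 1" for n
  proof -
    let ?K = "\<kappa> * real n powr (1 - 1 / real CARD('d))"
    let ?A = "\<lambda>i. {w \<in> polygons n. ?K \<le> card (flatten i ` set (w :: (int ^ 'd) list))}"
    let ?g = "card {w \<in> rooted_polygons k (n + 2). ?K \<le> card (flatten j ` set (tl w))}"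
    have "card (polygons n :: (int ^ 'd) list set) \<le> card (\<Union>i\<in>UNIV. ?A i)"
      using \<kappa>(2)[OF n] by (intro card_mono finite_subset[OF _ finite_polygons[OF n]]) auto
    also have "\<dots> \<le> (\<Sum>i\<in>UNIV. card (?A i))" by (rule card_UN_le) simp
    also have "\<dots> \<le> (\<Sum>i\<in>(UNIV :: 'd set). n * ?g)"
    proof (rule sum_mono)
      fix i :: 'd
      have "card (?A i) \<le> card (?A j)" by (rule card_polygons_wide_swap[OF n])
      also have "\<dots> \<le> n * ?g" by (rule card_polygons_wide_le[OF n])
      finally show "card (?A i) \<le> n * ?g" .
    qed
    finally show ?thesis by simp
  qed
  thus thesis using that \<kappa>(1) by blast
qed


section \<open>Joining polygons\<close>

lemma append_Cons_first_unique:
  assumes "xs @ a # ys = xs' @ a # ys'" "a \<notin> set xs" "a \<notin> set xs'"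
  shows "xs = xs' \<and> ys = ys'"
proof -
  have t: "takeWhile (\<lambda>x. x \<noteq> a) (us @ a # vs) = us" if "a \<notin> set us" for us vs
    using that by (induction us) auto
  have "xs = xs'" using t[of xs ys] t[of xs' ys'] assms by simp
  thus ?thesis using assms(1) by simp
qed

text \<open>The loop round \<open>C\<close> is inserted at the first visit of \<open>A\<close> to
  \<open>a\<close>. Since \<open>C\<close> avoids \<open>A\<close>, the first two occurrences of
  \<open>a\<close> in \<open>w\<close> delimit the loop.\<close>

definition joined :: "'d::finite \<Rightarrow> (int ^ 'd) list \<Rightarrow> (int ^ 'd) list \<Rightarrow> (int ^ 'd) list \<Rightarrow> int ^ 'd \<Rightarrow> bool" where
  "joined j A C w a \<longleftrightarrow> set A \<inter> set C = {} \<and>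
     (\<exists>X Z P Q. A = X @ a # Z \<and> a \<notin> set X \<and> C = P @ (a + axis j 1) # Q \<and>
        w = X @ a # ((a + axis j 1) # Q @ P @ [a + axis j 1]) @ a # Z)"

text \<open>Cutting out the loop returns \<open>A\<close>, but \<open>C\<close> only up to rotation;
  its strictly lowest vertex fixes the rotation.\<close>

lemma joined_inject:
  assumes J: "joined j A C w a" "joined j A' C' w a" and r: "rooted k C" "rooted k C'"
  shows "A = A' \<and> C = C'"
proof -
  let ?b = "a + axis j 1"
  obtain X Z P Q where 1: "A = X @ a # Z" "a \<notin> set X" "C = P @ ?b # Q"
    "w = X @ a # (?b # Q @ P @ [?b]) @ a # Z" "set A \<inter> set C = {}"
    using J(1) unfolding joined_def by blast
  obtain X' Z' P' Q' where 2: "A' = X' @ a # Z'" "a \<notin> set X'" "C' = P' @ ?b # Q'"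
    "w = X' @ a # (?b # Q' @ P' @ [?b]) @ a # Z'" "set A' \<inter> set C' = {}"
    using J(2) unfolding joined_def by blast
  have X: "X = X'" and R: "(?b # Q @ P @ [?b]) @ a # Z = (?b # Q' @ P' @ [?b]) @ a # Z'"
    using append_Cons_first_unique[of X a "(?b # Q @ P @ [?b]) @ a # Z" X' "(?b # Q' @ P' @ [?b]) @ a # Z'"] 1 2
    by simp_all
  have "a \<notin> set C" "a \<notin> set C'" using 1(1,5) 2(1,5) by auto
  hence "a \<notin> set (?b # Q @ P @ [?b])" "a \<notin> set (?b # Q' @ P' @ [?b])" using 1(3) 2(3) by auto
  from append_Cons_first_unique[OF R this]
  have Y: "Q @ P = Q' @ P'" and Z: "Z = Z'" by simp_all
  have "rotate (length P) C = rotate (length P') C'"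
    unfolding 1(3) 2(3) rotate_append using Y by simp
  moreover have "length C = length C'"
    using arg_cong[OF Y, of length] 1(3) 2(3) by simp
  ultimately have "C = C'"
    using rooted_rotate_unique[OF r, of "length P" "length P'"] 1(3) 2(3) by simp
  thus ?thesis using X Z 1(1) 2(1) by simp
qed

text \<open>\<open>C\<close> contains all the highest vertices, so the top is first reached inside
  the inserted loop: one crossing of the joining edge comes before, the other after. As
  \<open>C\<close> stays above level 0, the root of \<open>A\<close> remains the only lowest
  vertex.\<close>

lemma joined_in_rooted_polygons:
  assumes J: "joined j A C w a" and A: "A \<in> rooted_polygons k m" and C: "length C = n" "admissible (edges (C @ [hd C]))"
    and pos: "\<And>v. v \<in> set C \<Longrightarrow> 0 < v $ k" and jk: "j \<noteq> k"
    and top: "top_level k A < top_level k C"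
  shows "w \<in> rooted_polygons k (m + n + 2)" "{a, a + axis j 1} \<in> links k w"
proof -
  let ?b = "a + axis j 1" and ?h = "top_level k C"
  obtain X Z P Q where J': "A = X @ a # Z" "a \<notin> set X" "C = P @ ?b # Q"
    "w = X @ a # (?b # Q @ P @ [?b]) @ a # Z" and disj: "set A \<inter> set C = {}"
    using J unfolding joined_def by blast
  have gA: "admissible (edges (A @ [0]))" and hdA: "hd A = 0" "A \<noteq> []" "length A = m"
    and posA: "\<And>v. v \<in> set (tl A) \<Longrightarrow> 0 < v $ k"
    using A unfolding rooted_polygons_def polygons_def by auto
  \<comment> \<open>By \<open>j \<noteq> k\<close>, \<open>a\<close> is on the level of its partner
    in \<open>C\<close>, which is positive; so the loop is not inserted at the root.\<close>
  have "?b $ k = a $ k" using jk by (simp add: axis_def)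
  moreover have "0 < ?b $ k" using pos[of ?b] J'(3) by simp
  ultimately have "a \<noteq> 0" by auto
  then obtain X' where X: "X = 0 # X'" using J'(1) hdA(1) by (cases X) auto
  let ?U = "?b # Q @ P @ [?b]"
  have setU: "set ?U = set C" using J'(3) by auto
  have a: "a \<in> set A" "a \<notin> set C" using J'(1) disj by auto
  have b: "?b \<in> set C" "?b \<notin> set A" using J'(3) disj by auto
  have ab: "{a, ?b} \<notin># edges ys" if "set ys \<subseteq> set A \<or> set ys \<subseteq> set C" for ys
    using edges_subset[of "{a, ?b}" ys] that a b by auto
  have eU: "edges ?U = edges (C @ [hd C])"
    using edges_rotate[of "?b # Q" P] J'(3) by simp
  have eA: "edges (A @ [0]) = edges (X @ [a]) + edges (a # Z @ [0])"
    using edges_append[of X a "Z @ [0]"] J'(1) by simp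
  have eU2: "edges ((?b # Q @ P) @ ?b # (a # Z @ [0])) = edges ?U + edges (?b # a # Z @ [0])"
    using edges_append[of "?b # Q @ P" ?b "a # Z @ [0]"] by simp
  have "edges (w @ [0]) = edges (X @ [a]) + edges (a # (?b # Q @ P) @ ?b # a # Z @ [0])"
    using edges_append[of X a "(?b # Q @ P) @ ?b # a # Z @ [0]"] J'(4) by simp
  also have "edges (a # (?b # Q @ P) @ ?b # a # Z @ [0])
      = {#{a, ?b}#} + (edges ?U + ({#{a, ?b}#} + edges (a # Z @ [0])))"
    using eU2 by (simp add: insert_commute)
  finally have ew: "edges (w @ [0]) = {#{a, ?b}, {a, ?b}#} + (edges (A @ [0]) + edges (C @ [hd C]))"
    unfolding eA eU by simp
  have "admissible (edges (w @ [0]))" unfolding ew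
  proof (rule admissible_add[OF _ admissible_add[OF gA C(2)]])
    have "znorm (a - ?b) = 1" by simp
    thus "admissible {#{a, ?b}, {a, ?b}#}" using nn_edge_iff[of a ?b] by (simp add: admissible_def)
    have sA: "set (A @ [0]) \<subseteq> set A" using hdA by (metis Un_insert_right hd_in_set insert_absorb set_append empty_set list.simps(15) subsetI sup_bot.right_neutral)
    have sC: "set (C @ [hd C]) \<subseteq> set C" using J'(3) by (cases P) auto
    show "set_mset {#{a, ?b}, {a, ?b}#} \<inter> set_mset (edges (A @ [0]) + edges (C @ [hd C])) = {}"
      using ab[of "A @ [0]"] ab[of "C @ [hd C]"] sA sC by auto
    show "set_mset (edges (A @ [0])) \<inter> set_mset (edges (C @ [hd C])) = {}"
    proof (rule ccontr)
      assume "set_mset (edges (A @ [0])) \<inter> set_mset (edges (C @ [hd C])) \<noteq> {}"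
      then obtain e where e: "e \<in># edges (A @ [0])" "e \<in># edges (C @ [hd C])" by blast
      have "e \<subseteq> set A" "e \<subseteq> set C" "e \<noteq> {}"
        using edges_subset[OF e(1)] edges_subset[OF e(2)] sA sC by auto
      thus False using disj by blast
    qed
  qed
  moreover have "hd w = 0" "w \<noteq> []" "length w = m + n + 2"
    using J'(4) X hdA(3) C(1) J'(1,3) by auto
  moreover have "0 < v $ k" if "v \<in> set (tl w)" for v
  proof -
    have "v \<in> set (tl A) \<union> set C" using that J'(4) X J'(1) setU by auto
    thus ?thesis using posA pos by blast
  qed
  ultimately show "w \<in> rooted_polygons k (m + n + 2)" by (simp add: rooted_polygons_def polygons_def)
  have Cne: "C \<noteq> []" using J'(3) by simp
  have lowA: "v $ k < ?h" if "v \<in> set A" for v using top_level_ge[OF that, of k] top by simp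
  have "set w = set A \<union> set C" using J'(4) J'(1) setU by auto
  hence "top_level k w = ?h"
  proof -
    assume s: "set w = set A \<union> set C"
    obtain q where q: "q \<in> set C" "q $ k = ?h" using top_level_attained[OF Cne, of k] by blast
    have "?h \<le> top_level k w" using top_level_ge[of q w k] s q by auto
    moreover obtain v where v: "v \<in> set w" "v $ k = top_level k w"
      using top_level_attained[of w k] \<open>w \<noteq> []\<close> by blast
    have "v $ k \<le> ?h" using v(1) s lowA[of v] top_level_ge[of v C k] by auto
    ultimately show ?thesis using v by simp
  qed
  note h = this
  have "\<exists>q\<in>set C. \<not> q $ k < ?h" using top_level_attained[OF Cne, of k] by (metis less_irrefl)
  hence "\<exists>q\<in>set ?U. \<not> q $ k < ?h" unfolding setU .
  then obtain U1 q U2 where U: "?U = U1 @ q # U2" "\<not> q $ k < ?h" "\<forall>v\<in>set U1. v $ k < ?h"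
    using split_list_first_prop[of ?U "\<lambda>q. \<not> q $ k < ?h"] by auto
  have w: "w = (X @ a # U1) @ q # U2 @ a # Z" using J'(4) U(1) by simp
  have low: "\<forall>v\<in>set (X @ a # U1). v $ k < ?h" using lowA J'(1) U(3) by auto
  have tW: "takeWhile (\<lambda>v. v $ k < ?h) w = X @ a # U1"
    unfolding w using low U(2) by (subst takeWhile_append2) auto
  have dW: "dropWhile (\<lambda>v. v $ k < ?h) w = q # U2 @ a # Z"
    unfolding w using low U(2) by (subst dropWhile_append2) auto
  have asc: "ascent k w = X @ a # U1 @ [q]" unfolding ascent_def h tW dW by simp
  have desc: "descent k w = (q # U2) @ a # Z @ [0]"
    unfolding descent_def h dW using \<open>hd w = 0\<close> by simp
  have sub: "set (X @ [a]) \<subseteq> set A" "set (a # Z @ [0]) \<subseteq> set A" using J'(1) X by auto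
  have subU: "set (U1 @ [q]) \<subseteq> set C" "set (q # U2) \<subseteq> set C" using U(1) setU by auto
  obtain y where y: "U1 @ [q] = ?b # y" using U(1) by (cases U1) auto
  have "edges (ascent k w) = edges (X @ [a]) + ({#{a, ?b}#} + edges (U1 @ [q]))"
    unfolding asc using edges_append[of X a "U1 @ [q]"] y by simp
  hence "count (edges (ascent k w)) {a, ?b} = 1"
    using ab[of "X @ [a]"] ab[of "U1 @ [q]"] sub subU by (simp add: not_in_iff)
  moreover have "last (q # U2) = ?b" using arg_cong[OF U(1), of last] by simp
  then obtain W where W: "q # U2 = W @ [?b]" by (metis append_butlast_last_id list.distinct(1))
  have "edges (descent k w) = edges (q # U2) + ({#{a, ?b}#} + edges (a # Z @ [0]))"
    unfolding desc W using edges_append[of W ?b "a # Z @ [0]"] by (simp add: insert_commute)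
  hence "count (edges (descent k w)) {a, ?b} = 1"
    using ab[of "q # U2"] ab[of "a # Z @ [0]"] sub subU by (simp add: not_in_iff)
  ultimately show "{a, ?b} \<in> links k w" by (simp add: links_def)
qed

text \<open>Slide \<open>B\<close> in from far away in direction \<open>j\<close>, and stop just before the two sets meet.\<close>

lemma first_contact:
  assumes A: "u \<in> set A" and B: "0 \<in> set B"
  obtains s where "set A \<inter> set (translate (flatten j u + axis j s) B) = {}"
    "\<exists>a\<in>set A. a + axis j 1 \<in> set (translate (flatten j u + axis j s) B)"
proof -
  define T where "T = {t. \<exists>b\<in>set B. b + (flatten j u + axis j t) \<in> set A}"
  have "T \<subseteq> (\<lambda>(a, b). a $ j - b $ j) ` (set A \<times> set B)"
  proof
    fix t assume "t \<in> T"
    then obtain b where b: "b \<in> set B" "b + (flatten j u + axis j t) \<in> set A" by (auto simp: T_def)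
    have "t = (b + (flatten j u + axis j t)) $ j - b $ j" by (simp add: flatten_def axis_def)
    thus "t \<in> (\<lambda>(a, b). a $ j - b $ j) ` (set A \<times> set B)" using b by force
  qed
  hence fin: "finite T" by (rule finite_subset) simp
  have "0 + (flatten j u + axis j (u $ j)) = u" by (auto simp: flatten_def axis_def vec_eq_iff)
  hence "u $ j \<in> T" unfolding T_def using A B by (metis (mono_tags, lifting) mem_Collect_eq)
  hence M: "Max T \<in> T" using Max_in[OF fin] by blast
  have "Max T + 1 \<notin> T" using Max_ge[OF fin, of "Max T + 1"] by linarith
  hence "set A \<inter> set (translate (flatten j u + axis j (Max T + 1)) B) = {}" by (auto simp: T_def)
  moreover obtain b where b: "b \<in> set B" "b + (flatten j u + axis j (Max T)) \<in> set A"
    using M by (auto simp: T_def)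
  have "b + (flatten j u + axis j (Max T)) + axis j 1 = b + (flatten j u + axis j (Max T + 1))"
    by (auto simp: axis_def vec_eq_iff)
  hence "\<exists>a\<in>set A. a + axis j 1 \<in> set (translate (flatten j u + axis j (Max T + 1)) B)"
    using b by (intro bexI[OF _ b(2)]) auto
  ultimately show thesis using that by blast
qed

lemma top_level_translate: "w \<noteq> [] \<Longrightarrow> top_level k (translate v w) = top_level k w + v $ k"
proof -
  assume ne: "w \<noteq> []"
  have "(\<lambda>x. x $ k) ` set (translate v w) = (\<lambda>x. x + v $ k) ` (\<lambda>x. x $ k) ` set w"
    by (simp add: image_image)
  thus ?thesis unfolding top_level_def using ne Max_add_commute[of "set w" "\<lambda>x. x $ k" "v $ k"]
    by (simp add: image_image)
qed

text \<open>The point \<open>z\<close> names the line on which the root of \<open>B\<close> slides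
  in. Taking it from a non-root vertex of \<open>A\<close> lifts \<open>B\<close> by a positive
  amount, which turns the weak inequality between top levels into a strict one.\<close>

lemma join_exists:
  assumes A: "A \<in> rooted_polygons k m" and B: "B \<in> rooted_polygons k n" and top: "top_level k A \<le> top_level k B"
    and jk: "j \<noteq> k" and z: "z \<in> flatten j ` set (tl A)"
  shows "\<exists>V w a. flatten j V = z \<and> joined j A (translate V B) w a \<and> w \<in> rooted_polygons k (m + n + 2)
    \<and> {a, a + axis j 1} \<in> links k w"
proof -
  obtain u where u: "u \<in> set (tl A)" "z = flatten j u" using z by blast
  have uA: "u \<in> set A" using u(1) A by (auto simp: rooted_polygons_def intro: list.set_sel(2))
  have B0: "B \<noteq> []" "hd B = 0" "length B = n" "admissible (edges (B @ [hd B]))" 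
    and Bpos: "\<And>v. v \<in> set (tl B) \<Longrightarrow> 0 < v $ k"
    using B unfolding rooted_polygons_def polygons_def by auto
  obtain t where Bt: "B = 0 # t" using B0 by (cases B) auto
  have "0 \<in> set B" by (simp add: Bt)
  from first_contact[OF uA this, of j] obtain s where
    s: "set A \<inter> set (translate (flatten j u + axis j s) B) = {}"
    "\<exists>a\<in>set A. a + axis j 1 \<in> set (translate (flatten j u + axis j s) B)" by metis
  define V where "V = flatten j u + axis j s"
  define C where "C = translate V B"
  obtain a where a: "a \<in> set A" "a + axis j 1 \<in> set C" using s(2) unfolding C_def V_def by blast
  obtain X Z where XZ: "A = X @ a # Z" "a \<notin> set X" using split_list_first[OF a(1)] by blast
  obtain P Q where PQ: "C = P @ (a + axis j 1) # Q" using split_list[OF a(2)] by blast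
  define w where "w = X @ a # ((a + axis j 1) # Q @ P @ [a + axis j 1]) @ a # Z"
  have J: "joined j A C w a" unfolding joined_def w_def
    using s(1) XZ PQ unfolding C_def V_def by blast
  have Vk: "V $ k = u $ k" using jk by (simp add: V_def flatten_def axis_def)
  hence V0: "0 < V $ k" using u A by (simp add: rooted_polygons_def)
  have "0 < v $ k" if "v \<in> set C" for v
    using that V0 Bpos Bt by (auto simp: C_def add_pos_pos)
  moreover have "top_level k A < top_level k C"
    using top top_level_translate[OF B0(1), of k V] V0 unfolding C_def by linarith
  moreover have "admissible (edges (C @ [hd C]))"
  proof -
    have "C @ [hd C] = translate V (B @ [hd B])" using B0(1) by (simp add: C_def)
    thus ?thesis using B0(4) by (metis admissible_translate)
  qed
  moreover have "length C = n" using B0 by (simp add: C_def)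
  ultimately have "w \<in> rooted_polygons k (m + n + 2)" "{a, a + axis j 1} \<in> links k w"
    using joined_in_rooted_polygons[OF J A _ _ _ jk] by blast+
  moreover have "flatten j V = z" using u by (auto simp: V_def flatten_def axis_def vec_eq_iff)
  ultimately show ?thesis using J unfolding C_def by blast
qed

text \<open>A pair with a point of the projection is mapped injectively to the joined polygon with
  its joining edge. Of the two endpoints, \<open>a\<close> is the one with smaller coordinate
  \<open>j\<close>; cutting there gives \<open>A\<close> and the translated \<open>B\<close>, whose
  root reveals the translation and hence the point.\<close>

lemma join_count:
  fixes k j :: "'d::finite"
  assumes jk: "j \<noteq> k" and fin: "finite Ps"
    and Ps: "\<And>A B. (A, B) \<in> Ps \<Longrightarrow>
      \<exists>m n. A \<in> rooted_polygons k m \<and> B \<in> rooted_polygons k n \<and> m + n = N \<and> top_level k A \<le> top_level k B"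
  shows "(\<Sum>(A, B)\<in>Ps. card (flatten j ` set (tl A))) \<le> (\<Sum>w\<in>rooted_polygons k (N + 2). card (links k w))"
proof -
  define T where "T = Sigma Ps (\<lambda>(A, B). flatten j ` set (tl A))"
  have "\<forall>p\<in>T. \<exists>V w a. flatten j V = snd p \<and> joined j (fst (fst p)) (translate V (snd (fst p))) w a
      \<and> w \<in> rooted_polygons k (N + 2) \<and> {a, a + axis j 1} \<in> links k w"
  proof
    fix p assume p: "p \<in> T"
    obtain A B z where [simp]: "p = ((A, B), z)" by (metis prod.exhaust)
    have "(A, B) \<in> Ps" and z: "z \<in> flatten j ` set (tl A)" using p by (auto simp: T_def)
    then obtain m n where mn: "A \<in> rooted_polygons k m" "B \<in> rooted_polygons k n" "m + n = N" "top_level k A \<le> top_level k B"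
      using Ps by blast
    from join_exists[OF mn(1,2,4) jk z]
    show "\<exists>V w a. flatten j V = snd p \<and> joined j (fst (fst p)) (translate V (snd (fst p))) w a
      \<and> w \<in> rooted_polygons k (N + 2) \<and> {a, a + axis j 1} \<in> links k w"
      using mn(3) by simp
  qed
  then obtain V W a where F: "\<And>p. p \<in> T \<Longrightarrow> flatten j (V p) = snd p
      \<and> joined j (fst (fst p)) (translate (V p) (snd (fst p))) (W p) (a p)
      \<and> W p \<in> rooted_polygons k (N + 2) \<and> {a p, a p + axis j 1} \<in> links k (W p)" by metis
  let ?R = "Sigma (rooted_polygons k (N + 2)) (links k)"
  let ?f = "\<lambda>p. (W p, {a p, a p + axis j 1})"
  have "card T \<le> card ?R"
  proof (rule card_inj_on_le[of ?f])
    show "?f ` T \<subseteq> ?R" using F by auto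
    show "finite ?R" using finite_rooted_polygons finite_links by blast
    show "inj_on ?f T"
    proof (rule inj_onI)
      fix p p' assume p: "p \<in> T" "p' \<in> T" and eq: "?f p = ?f p'"
      obtain A B z A' B' z' where [simp]: "p = ((A, B), z)" "p' = ((A', B'), z')"
        by (metis prod.exhaust)
      have "a p = a p'"
      proof (rule ccontr)
        assume "a p \<noteq> a p'"
        hence "a p = a p' + axis j 1" "a p + axis j 1 = a p'" using eq by (auto simp: doubleton_eq_iff)
        hence "(a p + axis j 1 + axis j 1) $ j = a p $ j" by simp
        thus False by (simp add: axis_def)
      qed
      moreover have "W p = W p'" using eq by simp
      ultimately have J: "joined j A (translate (V p) B) (W p) (a p)"
        "joined j A' (translate (V p') B') (W p) (a p)" using F[OF p(1)] F[OF p(2)] by simp_all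
      have "(A, B) \<in> Ps" "(A', B') \<in> Ps" using p by (auto simp: T_def)
      then obtain n n' where BB: "B \<in> rooted_polygons k n" "B' \<in> rooted_polygons k n'" using Ps by blast
      hence r: "rooted k (translate (V p) B)" "rooted k (translate (V p') B')"
        using rooted_polygons_rooted by (auto simp: rooted_translate)
      have AA: "A = A'" and C: "translate (V p) B = translate (V p') B'"
        using joined_inject[OF J r] by blast+
      have B0: "B \<noteq> []" "B' \<noteq> []" "hd B = 0" "hd B' = 0"
        using BB by (auto simp: rooted_polygons_def polygons_def)
      have V: "V p = V p'" using arg_cong[OF C, of hd] B0 by simp
      hence "B = B'" using C by (simp add: translate_eq_iff)
      moreover have "z = z'" using F[OF p(1)] F[OF p(2)] V by simp
      ultimately show "p = p'" using AA by simp
    qed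
  qed
  moreover have "card T = (\<Sum>(A, B)\<in>Ps. card (flatten j ` set (tl A)))"
    unfolding T_def using fin by (subst card_SigmaI) (auto simp: split_def)
  moreover have "card ?R = (\<Sum>w\<in>rooted_polygons k (N + 2). card (links k w))"
    using finite_rooted_polygons finite_links by (intro card_SigmaI) auto
  ultimately show ?thesis by simp
qed


text \<open>The free parameter \<open>L\<close> is a cut-off: polygons with more than \<open>L\<close> links are bounded by the
  exponential moment.\<close>

lemma sum_card_links_le:
  fixes k :: "'d::finite" and \<mu> L :: real
  assumes mu: "\<mu> \<ge> 1" and bridges: "\<And>n. n \<ge> 1 \<Longrightarrow> card (bridges k n) \<le> \<mu> ^ n"
  shows "(\<Sum>w\<in>rooted_polygons k n. real (card (links k w))) \<le> L * card (rooted_polygons k n)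
    + (1 + 1 / \<mu>\<^sup>2) powr (- L) / ln (1 + 1 / \<mu>\<^sup>2) * ((3 * real n + 2)\<^sup>2 * \<mu> ^ (n + 1))"
proof -
  define l where "l = 1 + 1 / \<mu>\<^sup>2"
  have l: "l > 1" using mu by (simp add: l_def)
  have "real x \<le> L + l powr (- L) / ln l * l ^ x" for x
  proof -
    have "(real x - L) * ln l \<le> exp ((real x - L) * ln l)"
      using exp_ge_add_one_self[of "(real x - L) * ln l"] by linarith
    also have "\<dots> = l powr (real x - L)" using l by (simp add: powr_def)
    also have "\<dots> = l powr (- L) * l powr real x"
      by (simp only: powr_add[symmetric]) (simp add: algebra_simps)
    also have "l powr real x = l ^ x" using l by (intro powr_realpow) linarith
    finally show ?thesis using l by (simp add: field_simps)
  qed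
  hence "(\<Sum>w\<in>rooted_polygons k n. real (card (links k w)))
      \<le> (\<Sum>w\<in>rooted_polygons k n. L + l powr (- L) / ln l * l ^ card (links k w))"
    by (intro sum_mono) blast
  also have "\<dots> = L * card (rooted_polygons k n) + l powr (- L) / ln l * (\<Sum>w\<in>rooted_polygons k n. l ^ card (links k w))"
    by (simp add: sum.distrib sum_distrib_left mult.commute)
  also have "\<dots> \<le> L * card (rooted_polygons k n) + l powr (- L) / ln l * ((3 * real n + 2)\<^sup>2 * \<mu> ^ (n + 1))"
    using sum_links_le[OF mu bridges, of n] l unfolding l_def[symmetric] by (intro add_left_mono mult_left_mono) auto
  finally show ?thesis unfolding l_def .
qed

section \<open>Upper bound and recurrence for polygon counts\<close>

lemma card_rooted_polygons_upper:
  fixes k :: "'d::finite" and \<mu> :: real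
  assumes mu: "\<mu> \<ge> 1" and bridges: "\<And>n. n \<ge> 1 \<Longrightarrow> card (bridges k n) \<le> \<mu> ^ n"
  shows "card (rooted_polygons k n) \<le> (3 * real n + 2)\<^sup>2 * \<mu> ^ (n + 1)"
proof -
  have "(\<Sum>w\<in>rooted_polygons k n. (1 :: real)) \<le> (\<Sum>w\<in>rooted_polygons k n. (1 + 1 / \<mu>\<^sup>2) ^ card (links k w))"
    using mu by (intro sum_mono one_le_power) simp
  thus ?thesis using sum_links_le[OF mu bridges, of n] by simp
qed

text \<open>Joining wants the second polygon to reach at least as high as the first. As
  \<open>R\<close> is symmetric, at least half of the pairs are ordered this way, whence the factor
  2. In \<open>N + 6\<close>, the two spikes account for 4 and the joining edge for 2.\<close>

lemma sum_pairs_le_links: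
  fixes k j :: "'d::finite" and G :: "nat \<Rightarrow> (int ^ 'd) list set" and K :: real
  assumes jk: "j \<noteq> k" and finR: "finite R"
    and R: "\<And>m n. (m, n) \<in> R \<Longrightarrow> m + n = N" and sym: "\<And>m n. (m, n) \<in> R \<Longrightarrow> (n, m) \<in> R"
    and G: "\<And>m n w. (m, n) \<in> R \<Longrightarrow> w \<in> G m \<Longrightarrow> w \<in> rooted_polygons k (m + 2) \<and> K \<le> card (flatten j ` set (tl w))"
  shows "K * (\<Sum>(m, n)\<in>R. real (card (G m) * card (G n)))
    \<le> 2 * (\<Sum>w\<in>rooted_polygons k (N + 6). real (card (links k w)))"
proof (cases "K \<ge> 0")
  case K: True
  define All where "All = (\<Union>(m, n)\<in>R. G m \<times> G n)"
  define Ps where "Ps = {(A, B) \<in> All. top_level k A \<le> top_level k B}"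
  have finG: "finite (G m)" if "(m, n) \<in> R" for m n
    using G[OF that] by (intro finite_subset[OF _ finite_rooted_polygons[of k "m + 2"]]) auto
  have finAll: "finite All"
    unfolding All_def
  proof (rule finite_UN_I[OF finR])
    fix p assume p: "p \<in> R"
    obtain m n where [simp]: "p = (m, n)" by (metis prod.exhaust)
    show "finite (case p of (m, n) \<Rightarrow> G m \<times> G n)"
      using p finG[of m n] finG[OF sym[of m n]] by simp
  qed
  hence finPs: "finite Ps" by (rule finite_subset[rotated]) (auto simp: Ps_def)
  have len: "length w = m + 2" if "(m, n) \<in> R" "w \<in> G m" for m n w
    using G[OF that] by (simp add: rooted_polygons_def polygons_def)
  have "card All = (\<Sum>(m, n)\<in>R. card (G m) * card (G n))"
  proof -
    have "card (\<Union>p\<in>R. G (fst p) \<times> G (snd p)) = (\<Sum>p\<in>R. card (G (fst p) \<times> G (snd p)))"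
    proof (rule card_UN_disjoint[OF finR])
      show "\<forall>p\<in>R. finite (G (fst p) \<times> G (snd p))" using finG sym
        by (metis finite_cartesian_product prod.collapse)
      show "\<forall>p\<in>R. \<forall>q\<in>R. p \<noteq> q \<longrightarrow> (G (fst p) \<times> G (snd p)) \<inter> (G (fst q) \<times> G (snd q)) = {}"
      proof (intro ballI impI, rule ccontr)
        fix p q assume pq: "p \<in> R" "q \<in> R" "p \<noteq> q"
          "(G (fst p) \<times> G (snd p)) \<inter> (G (fst q) \<times> G (snd q)) \<noteq> {}"
        then obtain A B where AB: "A \<in> G (fst p)" "B \<in> G (snd p)" "A \<in> G (fst q)" "B \<in> G (snd q)"
          by auto
        have "fst p = fst q" using len[of "fst p" "snd p" A] len[of "fst q" "snd q" A] AB pq by simp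
        moreover have "snd p = snd q"
          using len[of "snd p" "fst p" B] len[of "snd q" "fst q" B] AB pq sym by simp
        ultimately show False using pq(3) by (simp add: prod_eq_iff)
      qed
    qed
    thus ?thesis by (simp add: All_def split_def card_cartesian_product)
  qed
  moreover have "card All \<le> card Ps + card Ps"
  proof -
    have "All \<subseteq> Ps \<union> prod.swap ` Ps"
    proof
      fix p assume p: "p \<in> All"
      obtain A B where [simp]: "p = (A, B)" by (metis prod.exhaust)
      have "(B, A) \<in> All" using p sym by (fastforce simp: All_def)
      thus "p \<in> Ps \<union> prod.swap ` Ps" using p
        by (cases "top_level k A \<le> top_level k B") (force simp: Ps_def)+
    qed
    hence "card All \<le> card (Ps \<union> prod.swap ` Ps)" using finPs by (intro card_mono) auto
    also have "\<dots> \<le> card Ps + card (prod.swap ` Ps)" by (rule card_Un_le)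
    also have "\<dots> \<le> card Ps + card Ps" using finPs by (simp add: card_image_le)
    finally show ?thesis .
  qed
  ultimately have cPs: "(\<Sum>(m, n)\<in>R. card (G m) * card (G n)) \<le> 2 * card Ps" by simp
  have PsG: "\<exists>m n. (m, n) \<in> R \<and> A \<in> G m \<and> B \<in> G n \<and> top_level k A \<le> top_level k B"
    if "(A, B) \<in> Ps" for A B
    using that by (auto simp: Ps_def All_def)
  have "(\<Sum>(A, B)\<in>Ps. card (flatten j ` set (tl A))) \<le> (\<Sum>w\<in>rooted_polygons k ((N + 4) + 2). card (links k w))"
  proof (rule join_count[OF jk finPs])
    fix A B assume "(A, B) \<in> Ps"
    then obtain m n where mn: "(m, n) \<in> R" "A \<in> G m" "B \<in> G n" "top_level k A \<le> top_level k B"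
      using PsG by blast
    thus "\<exists>m n. A \<in> rooted_polygons k m \<and> B \<in> rooted_polygons k n \<and> m + n = N + 4 \<and> top_level k A \<le> top_level k B"
      using G[OF mn(1,2)] G[OF sym[OF mn(1)] mn(3)] R[OF mn(1)]
      by (intro exI[of _ "m + 2"] exI[of _ "n + 2"]) auto
  qed
  hence J: "real (\<Sum>(A, B)\<in>Ps. card (flatten j ` set (tl A))) \<le> (\<Sum>w\<in>rooted_polygons k (N + 6). real (card (links k w)))"
    by (simp add: add.commute flip: of_nat_sum)
  have "K * real (card Ps) = (\<Sum>(A, B)\<in>Ps. K)" by (simp add: split_def)
  also have "\<dots> \<le> (\<Sum>(A, B)\<in>Ps. real (card (flatten j ` set (tl A))))"
  proof (rule sum_mono, clarify)
    fix A B assume "(A, B) \<in> Ps"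
    thus "K \<le> real (card (flatten j ` set (tl A)))" using PsG G by blast
  qed
  also have "\<dots> = real (\<Sum>(A, B)\<in>Ps. card (flatten j ` set (tl A)))" by (simp add: split_def)
  finally have KP: "K * real (card Ps) \<le> (\<Sum>w\<in>rooted_polygons k (N + 6). real (card (links k w)))" using J by linarith
  have "(\<Sum>(m, n)\<in>R. real (card (G m) * card (G n))) = real (\<Sum>(m, n)\<in>R. card (G m) * card (G n))"
    by (simp add: split_def)
  also have "\<dots> \<le> real (2 * card Ps)" using cPs by (rule of_nat_mono)
  finally have "K * (\<Sum>(m, n)\<in>R. real (card (G m) * card (G n))) \<le> K * real (2 * card Ps)"
    using K by (intro mult_left_mono) auto
  thus ?thesis using KP by simp
next
  case False
  have "K * (\<Sum>(m, n)\<in>R. real (card (G m) * card (G n))) \<le> 0"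
    using False by (intro mult_nonpos_nonneg sum_nonneg) (auto simp: split_def)
  also have "0 \<le> 2 * (\<Sum>w\<in>rooted_polygons k (N + 6). real (card (links k w)))" by (simp add: sum_nonneg)
  finally show ?thesis .
qed

text \<open>The last clause is the engine of the bootstrap: many pairs of plentiful lengths with sum
  \<open>N\<close> force many polygons of length \<open>N + 6\<close>. The cut-off \<open>L\<close>
  stays free so that it can be chosen logarithmic, which makes \<open>\<rho> powr (- L)\<close> beat
  any given power.\<close>

lemma polygon_recurrence:
  assumes d2: "CARD('d::finite) \<ge> 2"
  obtains \<mu> c \<rho> D :: real where "\<mu> \<ge> 1" "c > 0" "\<rho> > 1" "D > 0"
    "\<And>n. n \<ge> 1 \<Longrightarrow> \<mu> ^ n \<le> card (walks n :: (int ^ 'd) list set)"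
    "\<And>n. n \<ge> 1 \<Longrightarrow> card (polygons n :: (int ^ 'd) list set) \<le> D * real n ^ 3 * \<mu> ^ n"
    "\<And>H (X :: real) N (a :: real) (L :: real). finite H \<Longrightarrow> X \<ge> 1 \<Longrightarrow> a \<ge> 0 \<Longrightarrow> L \<ge> 0 \<Longrightarrow>
      (\<And>n. n \<in> H \<Longrightarrow> X \<le> real n \<and> a * real n * \<mu> ^ n \<le> card (polygons n :: (int ^ 'd) list set)) \<Longrightarrow>
      c * X powr (1 - 1 / real CARD('d)) * a\<^sup>2 * card {(m, n) \<in> H \<times> H. m + n = N} * \<mu> ^ N
        \<le> L * card (polygons (N + 6) :: (int ^ 'd) list set) / real (N + 6)
          + D * \<rho> powr (- L) * (real (N + 6))\<^sup>2 * \<mu> ^ N"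
proof -
  obtain k j :: 'd where jk: "j \<noteq> k"
  proof -
    have "\<exists>k j :: 'd. j \<noteq> k"
    proof (rule ccontr)
      assume "\<not> (\<exists>k j :: 'd. j \<noteq> k)"
      hence "(UNIV :: 'd set) \<subseteq> {undefined}" by auto
      hence "CARD('d) \<le> card {undefined :: 'd}" by (intro card_mono) auto
      thus False using d2 by simp
    qed
    thus thesis using that by blast
  qed
  obtain \<mu> :: real where mu: "\<mu> \<ge> 1"
    "\<And>n. n \<ge> 1 \<Longrightarrow> \<mu> ^ n \<le> card (walks n :: (int ^ 'd) list set)"
    "\<And>(k :: 'd) n. n \<ge> 1 \<Longrightarrow> card (bridges k n) \<le> \<mu> ^ n"
    using connective_constant[where 'd = 'd] by blast
  define d where "d = CARD('d)"
  have d: "d > 0" using d2 by (simp add: d_def)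
  define q where "q = 1 - 1 / real d"
  have q: "q \<ge> 0" using d by (simp add: q_def)
  obtain \<kappa> :: real where \<kappa>: "\<kappa> > 0" and wide:
    "\<And>n. n \<ge> 1 \<Longrightarrow> card (polygons n :: (int ^ 'd) list set) \<le> d * n *
       card {w \<in> rooted_polygons k (n + 2). \<kappa> * real n powr q \<le> card (flatten j ` set (tl w))}"
    using card_polygons_le_wide_rooted_polygons[of k j] unfolding q_def d_def by blast
  define G where "G = (\<lambda>n. {w \<in> rooted_polygons k (n + 2). \<kappa> * real n powr q \<le> card (flatten j ` set (tl w))})"
  define \<rho> where "\<rho> = 1 + 1 / \<mu>\<^sup>2"
  have l: "\<rho> > 1" using mu by (simp add: \<rho>_def)
  \<comment> \<open>The 2 is due to ordering pairs by height, \<open>d ^ 2\<close> to fixing the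
    wide direction of both polygons.\<close>
  define c where "c = \<kappa> / (2 * real d ^ 2)"
  \<comment> \<open>Here 121 = 11^2, from \<open>3 * (n + 2) + 2 \<le> 11 * n\<close> for
    \<open>n \<ge> 1\<close>. The first summand serves the upper bound on polygons, the second the
    error term of the recurrence.\<close>
  define D where "D = 121 * (real d * \<mu> ^ 3 + \<mu> ^ 7 / ln \<rho>)"
  have c: "c > 0" using \<kappa> d by (simp add: c_def)
  have D: "D > 0" using mu d l by (simp add: D_def add_pos_pos)
  have upper: "card (polygons n :: (int ^ 'd) list set) \<le> D * real n ^ 3 * \<mu> ^ n" if n: "n \<ge> 1" for n
  proof -
    have "real (card (polygons n :: (int ^ 'd) list set)) \<le> real (d * n * card (G n))"
      using wide[OF n] unfolding G_def by (rule of_nat_mono)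
    also have "\<dots> \<le> real d * real n * real (card (rooted_polygons k (n + 2)))"
      unfolding of_nat_mult by (intro mult_left_mono of_nat_mono card_mono finite_rooted_polygons) (auto simp: G_def)
    also have "\<dots> \<le> real d * real n * ((3 * real (n + 2) + 2)\<^sup>2 * \<mu> ^ (n + 2 + 1))"
      using card_rooted_polygons_upper[OF mu(1), of k "n + 2"] mu(3) by (intro mult_left_mono) auto
    also have "\<dots> \<le> real d * real n * ((11 * real n)\<^sup>2 * \<mu> ^ (n + 2 + 1))"
      using n mu by (intro mult_left_mono mult_right_mono power_mono) auto
    also have "\<dots> = 121 * (real d * \<mu> ^ 3) * real n ^ 3 * \<mu> ^ n"
      by (simp add: power_mult_distrib power_add eval_nat_numeral)
    also have "\<dots> \<le> D * real n ^ 3 * \<mu> ^ n"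
      using mu l by (intro mult_right_mono) (auto simp: D_def)
    finally show ?thesis .
  qed
  have main: "c * X powr q * a\<^sup>2 * card {(m, n) \<in> H \<times> H. m + n = N} * \<mu> ^ N
        \<le> L * card (polygons (N + 6) :: (int ^ 'd) list set) / real (N + 6)
          + D * \<rho> powr (- L) * (real (N + 6))\<^sup>2 * \<mu> ^ N"
    if H: "finite H" and X: "X \<ge> 1" and a: "a \<ge> 0" and L: "L \<ge> 0"
      and big: "\<And>n. n \<in> H \<Longrightarrow> X \<le> real n \<and> a * real n * \<mu> ^ n \<le> card (polygons n :: (int ^ 'd) list set)"
    for H N and X a L :: real
  proof -
    define R where "R = {(m, n) \<in> H \<times> H. m + n = N}"
    have finR: "finite R" using H by (intro finite_subset[of R "H \<times> H"]) (auto simp: R_def)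
    \<comment> \<open>The factor n in the hypothesis on \<open>H\<close> pays for passing to rooted
      polygons.\<close>
    have Gbig: "a * \<mu> ^ n / d \<le> card (G n)" if "n \<in> H" for n
    proof -
      have n: "real n \<ge> 1" using big[OF that] X by linarith
      hence "n \<ge> 1" by simp
      hence "real (card (polygons n :: (int ^ 'd) list set)) \<le> real (d * n * card (G n))"
        using wide unfolding G_def by (intro of_nat_mono) blast
      hence "real n * (a * \<mu> ^ n) \<le> real n * (d * card (G n))"
        using big[OF that] by (simp add: algebra_simps)
      hence "a * \<mu> ^ n \<le> d * card (G n)" using n by (subst (asm) mult_le_cancel_left_pos) auto
      thus ?thesis using d by (simp add: field_simps)
    qed
    have "(a * \<mu> ^ m / d) * (a * \<mu> ^ n / d) \<le> real (card (G m) * card (G n))" if "(m, n) \<in> R" for m n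
      unfolding of_nat_mult using Gbig[of m] Gbig[of n] that a mu
      by (intro mult_mono) (auto simp: R_def)
    moreover have "(a * \<mu> ^ m / d) * (a * \<mu> ^ n / d) = a\<^sup>2 * \<mu> ^ N / real d ^ 2" if "(m, n) \<in> R" for m n
      using that by (auto simp: R_def power_add power2_eq_square)
    ultimately have "(\<Sum>(m, n)\<in>R. a\<^sup>2 * \<mu> ^ N / real d ^ 2) \<le> (\<Sum>(m, n)\<in>R. real (card (G m) * card (G n)))"
      by (intro sum_mono) (metis (no_types, lifting) case_prod_beta prod.collapse)
    hence 1: "real (card R) * (a\<^sup>2 * \<mu> ^ N / real d ^ 2) \<le> (\<Sum>(m, n)\<in>R. real (card (G m) * card (G n)))"
      by (simp add: split_def)
    let ?S = "\<Sum>w\<in>rooted_polygons k (N + 6). real (card (links k w))"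
    have 2: "(\<kappa> * X powr q) * (\<Sum>(m, n)\<in>R. real (card (G m) * card (G n))) \<le> 2 * ?S"
    proof (rule sum_pairs_le_links[OF jk finR])
      fix m n w assume mn: "(m, n) \<in> R" and w: "w \<in> G m"
      have "X powr q \<le> real m powr q" using big[of m] mn X q by (intro powr_mono2) (auto simp: R_def)
      hence "\<kappa> * X powr q \<le> \<kappa> * real m powr q" using \<kappa> by simp
      thus "w \<in> rooted_polygons k (m + 2) \<and> \<kappa> * X powr q \<le> card (flatten j ` set (tl w))"
        using w unfolding G_def by auto
    qed (auto simp: R_def)
    have "c * X powr q * a\<^sup>2 * card R * \<mu> ^ N
        = (\<kappa> * X powr q) * (real (card R) * (a\<^sup>2 * \<mu> ^ N / real d ^ 2)) / 2"
      by (simp add: c_def mult_ac)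
    also have "\<dots> \<le> (\<kappa> * X powr q) * (\<Sum>(m, n)\<in>R. real (card (G m) * card (G n))) / 2"
      using 1 \<kappa> by (intro divide_right_mono mult_left_mono) auto
    also have "\<dots> \<le> ?S" using 2 by simp
    also have "\<dots> \<le> L * card (rooted_polygons k (N + 6))
        + \<rho> powr (- L) / ln \<rho> * ((3 * real (N + 6) + 2)\<^sup>2 * \<mu> ^ (N + 6 + 1))"
      unfolding \<rho>_def by (rule sum_card_links_le[OF mu(1) mu(3)])
    also have "L * card (rooted_polygons k (N + 6)) \<le> L * card (polygons (N + 6) :: (int ^ 'd) list set) / real (N + 6)"
    proof -
      have "real (N + 6) * card (rooted_polygons k (N + 6)) \<le> card (polygons (N + 6) :: (int ^ 'd) list set)"
        using card_rooted_polygons_le[of "N + 6" k] by (metis of_nat_le_iff of_nat_mult)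
      hence "card (rooted_polygons k (N + 6)) \<le> card (polygons (N + 6) :: (int ^ 'd) list set) / real (N + 6)"
        by (simp add: field_simps)
      hence "L * card (rooted_polygons k (N + 6)) \<le> L * (card (polygons (N + 6) :: (int ^ 'd) list set) / real (N + 6))"
        using L by (rule mult_left_mono)
      thus ?thesis by simp
    qed
    also have "\<rho> powr (- L) / ln \<rho> * ((3 * real (N + 6) + 2)\<^sup>2 * \<mu> ^ (N + 6 + 1))
        \<le> \<rho> powr (- L) / ln \<rho> * ((11 * real (N + 6))\<^sup>2 * \<mu> ^ (N + 6 + 1))"
      using mu l by (intro mult_left_mono mult_right_mono power_mono) auto
    also have "\<dots> = (121 * (\<mu> ^ 7 / ln \<rho>)) * (\<rho> powr (- L) * (real (N + 6))\<^sup>2 * \<mu> ^ N)"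
    proof -
      have "\<mu> ^ (N + 6 + 1) = \<mu> ^ 7 * \<mu> ^ N" using power_add[of \<mu> 7 N] by (simp add: add.commute)
      thus ?thesis unfolding power_mult_distrib by simp
    qed
    also have "\<dots> \<le> D * (\<rho> powr (- L) * (real (N + 6))\<^sup>2 * \<mu> ^ N)"
      using mu l d by (intro mult_right_mono) (auto simp: D_def)
    finally show ?thesis unfolding R_def by (simp add: mult.assoc)
  qed
  show thesis using that[OF mu(1) c l D] mu(2) upper main unfolding q_def d_def by blast
qed


section \<open>Bootstrapping along scales\<close>

text \<open>The threshold is taken at the scale \<open>X\<close>, so that all lengths in a window
  share one bound, as the recurrence demands. Rich windows are only required at arbitrarily large
  scales, not at all of them.\<close>

definition abundant :: "(nat \<Rightarrow> real) \<Rightarrow> real \<Rightarrow> bool" where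
  "abundant a \<theta> \<longleftrightarrow> (\<exists>\<eta>>0. \<exists>\<kappa>. \<forall>X0. \<exists>X\<ge>X0.
     \<eta> * real X \<le> card {n \<in> {X..\<kappa> * X}. real X powr (- \<theta>) \<le> a n})"

text \<open>Double counting: the representation numbers add up to the square of
  \<open>card H\<close>, none exceeds \<open>card H\<close>, and the rarely represented sums
  contribute at most half of the lower bound for the total.\<close>

lemma many_sums:
  fixes \<eta> :: real
  assumes X: "X \<ge> 1" and \<eta>: "\<eta> > 0" and H: "H \<subseteq> {X..\<kappa> * X}" "\<eta> * real X \<le> card H"
  defines "r \<equiv> \<lambda>N. card {(m, n) \<in> H \<times> H. m + n = N}"
  shows "\<eta>\<^sup>2 / (2 * (real \<kappa> + 1)) * real X
    \<le> card {N \<in> {..2 * \<kappa> * X}. \<eta>\<^sup>2 / (6 * (real \<kappa> + 1)) * real X \<le> r N}"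
proof -
  define K where "K = real \<kappa> + 1"
  have K: "K \<ge> 1" by (simp add: K_def)
  \<comment> \<open>At most \<open>3 * K * X\<close> sums are possible, so those below
    \<open>t\<close> contribute at most half of \<open>(\<eta> * X)\<^sup>2\<close>.\<close>
  define t where "t = \<eta>\<^sup>2 / (6 * K) * real X"
  define Good where "Good = {N \<in> {..2 * \<kappa> * X}. t \<le> r N}"
  have finH: "finite H" using H finite_subset by blast
  have "card H \<le> card {X..\<kappa> * X}" using H by (intro card_mono) auto
  also have "\<dots> \<le> \<kappa> * X" using X by simp
  finally have "real (card H) \<le> real (\<kappa> * X)" by (rule of_nat_mono)
  hence cardH: "real (card H) \<le> K * real X" by (simp add: K_def algebra_simps)
  have rH: "real (r N) \<le> K * real X" for N
  proof -
    have "r N \<le> card H" unfolding r_def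
      by (rule card_inj_on_le[of fst]) (auto simp: inj_on_def finH)
    thus ?thesis using cardH by linarith
  qed
  have r_sum: "(card H)\<^sup>2 = (\<Sum>N\<le>2 * \<kappa> * X. r N)"
  proof -
    have "(\<Sum>N\<le>2 * \<kappa> * X. r N)
        = (\<Sum>N\<le>2 * \<kappa> * X. \<Sum>p\<in>{p \<in> H \<times> H. (\<lambda>(m, n). m + n) p = N}. 1)"
      unfolding r_def by (intro sum.cong) (auto intro!: arg_cong[where f = card])
    also have "\<dots> = (\<Sum>p\<in>H \<times> H. 1)"
    proof (rule sum.group)
      show "(\<lambda>(m, n). m + n) ` (H \<times> H) \<subseteq> {..2 * \<kappa> * X}"
      proof (rule image_subsetI)
        fix p assume "p \<in> H \<times> H"
        hence "fst p \<le> \<kappa> * X" "snd p \<le> \<kappa> * X" using H(1) by auto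
        thus "(\<lambda>(m, n). m + n) p \<in> {..2 * \<kappa> * X}" by (simp add: split_def)
      qed
    qed (use finH in auto)
    finally show ?thesis by (simp add: card_cartesian_product power2_eq_square)
  qed
  have "(\<eta> * real X)\<^sup>2 \<le> real ((card H)\<^sup>2)"
    unfolding of_nat_power using H(2) \<eta> by (intro power_mono) auto
  also have "\<dots> = (\<Sum>N\<le>2 * \<kappa> * X. real (r N))" unfolding r_sum by simp
  also have "\<dots> \<le> (\<Sum>N\<le>2 * \<kappa> * X. (if N \<in> Good then K * real X else 0) + t)"
  proof (rule sum_mono)
    fix N assume "N \<in> {..2 * \<kappa> * X}"
    moreover have "t \<ge> 0" using K by (simp add: t_def)
    ultimately show "real (r N) \<le> (if N \<in> Good then K * real X else 0) + t"
      using rH[of N] by (auto simp: Good_def)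
  qed
  also have "\<dots> = real (card Good) * (K * real X) + (2 * real \<kappa> * real X + 1) * t"
  proof -
    have "{..2 * \<kappa> * X} \<inter> {N. N \<in> Good} = Good" by (auto simp: Good_def)
    thus ?thesis by (simp add: sum.distrib sum.If_cases algebra_simps)
  qed
  also have "\<dots> \<le> real (card Good) * (K * real X) + (3 * K * real X) * t"
  proof -
    have "0 \<le> real \<kappa> * real X" "1 \<le> real X" using X by simp_all
    moreover have "3 * K * real X = 3 * (real \<kappa> * real X) + 3 * real X"
      by (simp add: K_def algebra_simps)
    ultimately have "2 * real \<kappa> * real X + 1 \<le> 3 * K * real X" by linarith
    thus ?thesis using K by (intro add_left_mono mult_right_mono) (auto simp: t_def)
  qed
  also have "(3 * K * real X) * t = (\<eta> * real X)\<^sup>2 / 2"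
    using K by (simp add: t_def power2_eq_square)
  finally have "(\<eta> * real X)\<^sup>2 / 2 \<le> real (card Good) * (K * real X)" by simp
  moreover have "(\<eta> * real X)\<^sup>2 / 2 = \<eta>\<^sup>2 / (2 * K) * real X * (K * real X)"
    using K by (simp add: power2_eq_square)
  ultimately have "\<eta>\<^sup>2 / (2 * K) * real X * (K * real X) \<le> real (card Good) * (K * real X)" by simp
  moreover have "K * real X > 0" using K X by simp
  ultimately have "\<eta>\<^sup>2 / (2 * K) * real X \<le> card Good" by (rule mult_right_le_imp_le)
  thus ?thesis by (simp add: Good_def t_def K_def)
qed

text \<open>With \<open>\<theta> = 1 + q - x\<close>, the new exponent is \<open>1 + q - 2 * x + \<epsilon>\<close>.\<close>

lemma abundant_double:
  fixes a :: "nat \<Rightarrow> real" and c \<rho> D q :: real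
  assumes pos: "c > 0" "\<rho> > 1" "D > 0"
    and rec: "\<And>H (X :: real) N (b :: real) (L :: real). finite H \<Longrightarrow> X \<ge> 1 \<Longrightarrow> b \<ge> 0 \<Longrightarrow> L \<ge> 0 \<Longrightarrow>
      (\<And>n. n \<in> H \<Longrightarrow> X \<le> real n \<and> b \<le> a n) \<Longrightarrow>
      c * X powr q * b\<^sup>2 * card {(m, n) \<in> H \<times> H. m + n = N}
        \<le> L * a (N + 6) + D * \<rho> powr (- L) * (real (N + 6))\<^sup>2"
    and ab: "abundant a \<theta>" and \<epsilon>: "\<epsilon> > 0"
  shows "abundant a (2 * \<theta> - (1 + q) + \<epsilon>)"
proof -
  obtain \<eta> \<kappa> where \<eta>: "\<eta> > 0" and many: "\<And>X0. \<exists>X\<ge>X0.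
     \<eta> * real X \<le> card {n \<in> {X..\<kappa> * X}. real X powr (- \<theta>) \<le> a n}"
    using ab unfolding abundant_def by blast
  define K where "K = real \<kappa> + 1"
  have K: "K \<ge> 1" by (simp add: K_def)
  define t where "t = \<eta>\<^sup>2 / (6 * K)"
  have t: "t > 0" using \<eta> K by (simp add: t_def)
  define s where "s = 2 * \<theta> - (1 + q)"
  \<comment> \<open>Makes the error term, of order \<open>X powr (2 - p)\<close>, smaller than
    \<open>X powr (- s)\<close> by at least a factor X.\<close>
  define p where "p = \<bar>s\<bar> + 3"
  have p: "p > 0" by (simp add: p_def)
  \<comment> \<open>The cut-off \<open>L = C1 * ln X\<close> then gives
    \<open>\<rho> powr (- L) = X powr (- p)\<close>.\<close>
  define C1 where "C1 = p / ln \<rho>"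
  \<comment> \<open>The 64 comes from squaring \<open>N + 6 \<le> 8 * K * X\<close>.\<close>
  define C2 where "C2 = 64 * D * K\<^sup>2"
  have C: "C1 > 0" "C2 > 0" using pos p K by (simp_all add: C1_def C2_def)
  have "((\<lambda>X :: nat. C1 * ln (real X) * real X powr (- \<epsilon>) + C2 * real X powr (-1)) \<longlongrightarrow> 0) sequentially"
  proof -
    have "((\<lambda>X :: nat. ln (real X) * real X powr (- \<epsilon>)) \<longlongrightarrow> 0) sequentially"
      using \<epsilon> by real_asymp
    moreover have "((\<lambda>X :: nat. real X powr (-1)) \<longlongrightarrow> 0) sequentially" by real_asymp
    ultimately have "((\<lambda>X :: nat. C1 * (ln (real X) * real X powr (- \<epsilon>)) + C2 * real X powr (-1))
        \<longlongrightarrow> C1 * 0 + C2 * 0) sequentially" by (intro tendsto_intros)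
    thus ?thesis by (simp add: mult.assoc)
  qed
  hence "\<forall>\<^sub>F X in sequentially. C1 * ln (real X) * real X powr (- \<epsilon>) + C2 * real X powr (-1) < c * t"
    using pos t by (intro order_tendstoD(2)) auto
  then obtain X1 where X1: "\<And>X. X \<ge> X1 \<Longrightarrow>
      C1 * ln (real X) * real X powr (- \<epsilon>) + C2 * real X powr (-1) < c * t"
    unfolding eventually_sequentially by blast
  have "\<exists>X\<ge>X0. \<eta>\<^sup>2 / (2 * K) * real X
      \<le> card {n \<in> {X..(2 * \<kappa> + 6) * X}. real X powr (- (s + \<epsilon>)) \<le> a n}" for X0
  proof -
    obtain X where X: "X \<ge> max X0 (max X1 1)"
      "\<eta> * real X \<le> card {n \<in> {X..\<kappa> * X}. real X powr (- \<theta>) \<le> a n}" using many by blast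
    define H where "H = {n \<in> {X..\<kappa> * X}. real X powr (- \<theta>) \<le> a n}"
    define r where "r = (\<lambda>N. card {(m, n) \<in> H \<times> H. m + n = N})"
    define Good where "Good = {N \<in> {..2 * \<kappa> * X}. t * real X \<le> r N}"
    have X1': "X \<ge> 1" "real X \<ge> 1" using X by auto
    have H: "H \<subseteq> {X..\<kappa> * X}" "finite H" "\<eta> * real X \<le> card H"
      using X(2) by (auto simp: H_def)
    have Good: "\<eta>\<^sup>2 / (2 * K) * real X \<le> card Good"
      using many_sums[OF X1'(1) \<eta> H(1) H(3)] unfolding Good_def t_def K_def r_def .
    have large: "real X powr (- (s + \<epsilon>)) \<le> a (N + 6)" if N: "N \<in> Good" for N
    proof (rule ccontr)
      assume "\<not> real X powr (- (s + \<epsilon>)) \<le> a (N + 6)"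
      hence small: "a (N + 6) \<le> real X powr (- (s + \<epsilon>))" by simp
      define L where "L = C1 * ln (real X)"
      have L: "L \<ge> 0" using C X1' by (simp add: L_def)
      have rhoL: "\<rho> powr (- L) = real X powr (- p)"
        using pos X1' by (simp add: powr_def L_def C1_def)
      \<comment> \<open>The exponent \<open>- s\<close> collects q from the positions, 1 from the
        number of pairs and \<open>- \<theta>\<close> from each polygon.\<close>
      have "(c * t) * real X powr (- s) = c * real X powr q * (real X powr (- \<theta>))\<^sup>2 * (t * real X)"
      proof -
        have "real X powr (- s) = real X powr q * (real X powr (- \<theta>) * real X powr (- \<theta>)) * real X powr 1"
          unfolding s_def powr_add[symmetric] by (simp add: algebra_simps)
        thus ?thesis using X1' by (simp add: power2_eq_square)
      qed
      also have "\<dots> \<le> c * real X powr q * (real X powr (- \<theta>))\<^sup>2 * r N"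
        using N pos by (intro mult_left_mono) (auto simp: Good_def)
      also have "\<dots> \<le> L * a (N + 6) + D * \<rho> powr (- L) * (real (N + 6))\<^sup>2"
        unfolding r_def using X1' L H(2) by (intro rec) (auto simp: H_def)
      also have "\<dots> \<le> L * real X powr (- (s + \<epsilon>)) + D * real X powr (- p) * (8 * K * real X)\<^sup>2"
      proof (intro add_mono mult_left_mono small L power_mono)
        show "D * \<rho> powr (- L) * (real (N + 6))\<^sup>2 \<le> D * real X powr (- p) * (8 * K * real X)\<^sup>2"
        proof -
          have "N + 6 \<le> 2 * \<kappa> * X + 6" using N by (simp add: Good_def)
          hence "real (N + 6) \<le> real (2 * \<kappa> * X + 6)" by (rule of_nat_mono)
          also have "\<dots> \<le> 8 * K * real X"
          proof -
            have "8 * K * real X = 8 * (real \<kappa> * real X) + 8 * real X" by (simp add: K_def algebra_simps)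
            moreover have "0 \<le> real \<kappa> * real X" by simp
            moreover have "real (2 * \<kappa> * X + 6) = 2 * (real \<kappa> * real X) + 6" by simp
            ultimately show ?thesis using X1'(2) by linarith
          qed
          finally have "(real (N + 6))\<^sup>2 \<le> (8 * K * real X)\<^sup>2" by (intro power_mono) auto
          thus ?thesis unfolding rhoL using pos by (intro mult_left_mono) auto
        qed
      qed
      also have "D * real X powr (- p) * (8 * K * real X)\<^sup>2 = C2 * real X powr (2 - p)"
      proof -
        have "real X powr (2 - p) = real X powr (- p) * (real X)\<^sup>2"
          using X1' powr_add[of "real X" "- p" 2] by simp
        thus ?thesis by (simp add: C2_def power_mult_distrib)
      qed
      also have "L * real X powr (- (s + \<epsilon>)) + C2 * real X powr (2 - p)
          \<le> L * real X powr (- (s + \<epsilon>)) + C2 * real X powr (- s + - 1)"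
        using C X1' by (intro add_left_mono mult_left_mono powr_mono) (auto simp: p_def)
      also have "\<dots> = (C1 * ln (real X) * real X powr (- \<epsilon>) + C2 * real X powr (- 1)) * real X powr (- s)"
      proof -
        have "real X powr (- (s + \<epsilon>)) = real X powr (- \<epsilon>) * real X powr (- s)"
          unfolding powr_add[symmetric] by (simp add: algebra_simps)
        moreover have "real X powr (- s + - 1) = real X powr (- 1) * real X powr (- s)"
          unfolding powr_add[symmetric] by (simp add: algebra_simps)
        ultimately show ?thesis unfolding L_def by (simp only: distrib_right mult.assoc)
      qed
      finally have "c * t \<le> C1 * ln (real X) * real X powr (- \<epsilon>) + C2 * real X powr (- 1)"
        using X1' by (simp add: mult_le_cancel_right_pos)
      thus False using X1[of X] X(1) by simp
    qed
    have "(\<lambda>N. N + 6) ` Good \<subseteq> {n \<in> {X..(2 * \<kappa> + 6) * X}. real X powr (- (s + \<epsilon>)) \<le> a n}"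
    proof (rule image_subsetI)
      fix N assume N: "N \<in> Good"
      have "t * real X > 0" using t X1' by simp
      hence "real (r N) > 0" using N unfolding Good_def by (auto intro: less_le_trans)
      hence "{(m, n) \<in> H \<times> H. m + n = N} \<noteq> {}" unfolding r_def by (metis card.empty less_irrefl of_nat_0)
      hence "X \<le> N" using H(1) by fastforce
      moreover have "N \<le> 2 * \<kappa> * X" using N by (simp add: Good_def)
      hence "N + 6 \<le> (2 * \<kappa> + 6) * X" using X1'(1) by (simp add: algebra_simps)
      ultimately show "N + 6 \<in> {n \<in> {X..(2 * \<kappa> + 6) * X}. real X powr (- (s + \<epsilon>)) \<le> a n}"
        using large[OF N] by simp
    qed
    hence "card ((\<lambda>N. N + 6) ` Good) \<le> card {n \<in> {X..(2 * \<kappa> + 6) * X}. real X powr (- (s + \<epsilon>)) \<le> a n}"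
      by (intro card_mono) auto
    hence "card Good \<le> card {n \<in> {X..(2 * \<kappa> + 6) * X}. real X powr (- (s + \<epsilon>)) \<le> a n}"
      by (simp add: card_image)
    thus ?thesis using Good X(1) by (intro exI[of _ X]) auto
  qed
  moreover have "\<eta>\<^sup>2 / (2 * K) > 0" using \<eta> K by simp
  ultimately show ?thesis unfolding abundant_def s_def by blast
qed

text \<open>An entry of size at least \<open>X ^ 3\<close> in the window would exceed the quadratic
  bound \<open>D * (\<kappa> * X)\<^sup>2\<close> once X is large.\<close>

lemma not_abundant_polynomial:
  assumes upper: "\<And>n. n \<ge> 1 \<Longrightarrow> a n \<le> D * (real n)\<^sup>2" and D: "D > 0" and \<theta>: "\<theta> \<le> -3"
  shows "\<not> abundant a \<theta>"
proof
  assume "abundant a \<theta>"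
  then obtain \<eta> \<kappa> where \<eta>: "\<eta> > 0" and many: "\<And>X0. \<exists>X\<ge>X0.
     \<eta> * real X \<le> card {n \<in> {X..\<kappa> * X}. real X powr (- \<theta>) \<le> a n}"
    unfolding abundant_def by blast
  obtain X where X: "X \<ge> nat \<lceil>D * (real \<kappa>)\<^sup>2\<rceil> + 1"
    "\<eta> * real X \<le> card {n \<in> {X..\<kappa> * X}. real X powr (- \<theta>) \<le> a n}" using many by blast
  have X1: "real X \<ge> 1" and XD: "real X > D * (real \<kappa>)\<^sup>2" using X(1) by linarith+
  have "{n \<in> {X..\<kappa> * X}. real X powr (- \<theta>) \<le> a n} \<noteq> {}"
  proof
    assume "{n \<in> {X..\<kappa> * X}. real X powr (- \<theta>) \<le> a n} = {}"
    hence "\<eta> * real X \<le> 0" using X(2) by (metis card.empty of_nat_0)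
    thus False using \<eta> X1 by (simp add: mult_le_0_iff)
  qed
  then obtain n where n: "X \<le> n" "n \<le> \<kappa> * X" "real X powr (- \<theta>) \<le> a n" by auto
  have "real X ^ 3 = real X powr 3" using X1 by simp
  also have "\<dots> \<le> real X powr (- \<theta>)" using X1 \<theta> by (intro powr_mono) auto
  also have "\<dots> \<le> D * (real n)\<^sup>2" using n X1 upper[of n] by simp
  also have "\<dots> \<le> D * (real \<kappa> * real X)\<^sup>2"
    using n(2) D by (intro mult_left_mono power_mono) (simp_all flip: of_nat_mult)
  also have "\<dots> = D * (real \<kappa>)\<^sup>2 * real X ^ 2" by (simp add: power_mult_distrib)
  also have "\<dots> < real X * real X ^ 2" using XD X1 by (intro mult_strict_right_mono) auto
  finally show False by (simp add: eval_nat_numeral)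
qed

text \<open>Each round doubles the excess and spends a quarter of the result on \<epsilon>, leaving
  growth by 3/2. The window constants deteriorate from round to round, but finitely many rounds
  bring the exponent down to -3.\<close>

lemma not_abundant_above:
  fixes a :: "nat \<Rightarrow> real" and c \<rho> D q x :: real
  assumes pos: "c > 0" "\<rho> > 1" "D > 0"
    and upper: "\<And>n. n \<ge> 1 \<Longrightarrow> a n \<le> D * (real n)\<^sup>2"
    and rec: "\<And>H (X :: real) N (b :: real) (L :: real). finite H \<Longrightarrow> X \<ge> 1 \<Longrightarrow> b \<ge> 0 \<Longrightarrow> L \<ge> 0 \<Longrightarrow>
      (\<And>n. n \<in> H \<Longrightarrow> X \<le> real n \<and> b \<le> a n) \<Longrightarrow>
      c * X powr q * b\<^sup>2 * card {(m, n) \<in> H \<times> H. m + n = N}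
        \<le> L * a (N + 6) + D * \<rho> powr (- L) * (real (N + 6))\<^sup>2"
    and x: "x > 0"
  shows "\<not> abundant a (1 + q - x)"
proof
  assume ab: "abundant a (1 + q - x)"
  have abi: "abundant a (1 + q - (3 / 2) ^ i * x)" for i
  proof (induction i)
    case 0
    show ?case using ab by simp
  next
    case (Suc i)
    define y where "y = (3 / 2) ^ i * x"
    have "y > 0" using x by (simp add: y_def)
    hence "y / 2 > 0" by simp
    have "abundant a (2 * (1 + q - y) - (1 + q) + y / 2)"
      by (rule abundant_double[OF pos _ Suc[folded y_def] \<open>y / 2 > 0\<close>]) (fact rec)
    moreover have "2 * (1 + q - y) - (1 + q) + y / 2 = 1 + q - (3 / 2) ^ Suc i * x"
      by (simp add: y_def)
    ultimately show ?case by metis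
  qed
  obtain i where "(4 + q) / x < (3 / 2) ^ i" using real_arch_pow[of "3 / 2"] by auto
  hence le: "1 + q - (3 / 2) ^ i * x \<le> -3" using x by (simp add: field_simps)
  have "\<not> abundant a (1 + q - (3 / 2) ^ i * x)"
    by (rule not_abundant_polynomial[OF _ pos(3) le]) (rule upper)
  thus False using abi by blast
qed

section \<open>From windows to densities\<close>

lemma positive_density_windows:
  assumes "\<not> (\<lambda>n. real (card (B \<inter> {0..2 * n})) / real n) \<longlonglongrightarrow> 0"
  shows "\<exists>\<kappa>\<ge>1. \<forall>X0. \<exists>X\<ge>X0. X \<le> card (B \<inter> {X..\<kappa> * X})"
proof -
  let ?f = "\<lambda>n. real (card (B \<inter> {0..2 * n})) / real n"
  obtain e where e: "e > 0" "\<And>n0. \<exists>n\<ge>n0. ?f n \<ge> e"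
    using assms unfolding lim_sequentially dist_real_def by (auto simp: not_less)
  \<comment> \<open>With X about \<open>e * n / 4\<close>, discarding the numbers below X leaves at
    least X elements of \<open>B\<close>. As X is at least \<open>e * n / 8\<close>, the multiple
    \<open>16 / e * X\<close> reaches \<open>2 * n\<close>.\<close>
  define \<kappa> where "\<kappa> = nat \<lceil>16 / e\<rceil>"
  have \<kappa>: "real \<kappa> \<ge> 16 / e" "\<kappa> \<ge> 1" using e(1) by (simp_all add: \<kappa>_def Suc_le_eq)
  have "\<exists>X\<ge>X0. X \<le> card (B \<inter> {X..\<kappa> * X})" for X0
  proof -
    obtain n where n: "n \<ge> nat \<lceil>8 * (real X0 + 1) / e\<rceil>" "?f n \<ge> e" using e(2) by blast
    have "real n \<ge> 8 * (real X0 + 1) / e" using n(1) by linarith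
    hence n8: "e * real n \<ge> 8 * (real X0 + 1)" using e(1) by (simp add: field_simps)
    have "0 < 8 * (real X0 + 1)" by simp
    hence "e * real n > 0" using n8 by (rule less_le_trans)
    hence n0: "real n > 0" using e(1) by (simp add: zero_less_mult_iff)
    define X where "X = nat \<lfloor>e * real n / 4\<rfloor>"
    have Xle: "real X \<le> e * real n / 4" and Xge: "real X \<ge> e * real n / 8"
    proof -
      have "0 \<le> \<lfloor>e * real n / 4\<rfloor>" using \<open>e * real n > 0\<close> by simp
      hence "real X = real_of_int \<lfloor>e * real n / 4\<rfloor>" unfolding X_def by simp
      moreover have "e * real n \<ge> 8" using n8 by simp
      ultimately show "real X \<le> e * real n / 4" "real X \<ge> e * real n / 8"
        using of_int_floor_le[of "e * real n / 4"] real_of_int_floor_gt_diff_one[of "e * real n / 4"]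
        by linarith+
    qed
    have "real X0 \<le> real X" using Xge n8 by argo
    hence XX0: "X \<ge> X0" by simp
    have "2 * n \<le> \<kappa> * X"
    proof -
      have "2 * real n = 16 / e * (e * real n / 8)" using e(1) by simp
      also have "\<dots> \<le> real \<kappa> * real X" using \<kappa> Xge e(1) n0 by (intro mult_mono) auto
      finally have "real (2 * n) \<le> real (\<kappa> * X)" by simp
      thus ?thesis by (simp only: of_nat_le_iff)
    qed
    hence "B \<inter> {0..2 * n} \<subseteq> {..<X} \<union> (B \<inter> {X..\<kappa> * X})" by auto
    hence "card (B \<inter> {0..2 * n}) \<le> card ({..<X} \<union> (B \<inter> {X..\<kappa> * X}))" by (intro card_mono) auto
    also have "\<dots> \<le> X + card (B \<inter> {X..\<kappa> * X})" using card_Un_le[of "{..<X}"] by simp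
    finally have "real (card (B \<inter> {0..2 * n})) \<le> real X + card (B \<inter> {X..\<kappa> * X})" by simp
    moreover have "e * real n \<le> card (B \<inter> {0..2 * n})" using n(2) n0 by (simp add: field_simps)
    ultimately have "real X \<le> card (B \<inter> {X..\<kappa> * X})" using Xle Xge by linarith
    thus ?thesis using XX0 by auto
  qed
  thus ?thesis using \<kappa>(2) by blast
qed

text \<open>Within a window of ratio \<open>\<kappa>\<close>, \<open>n powr (- \<theta>)\<close> and
  \<open>X powr (- \<theta>)\<close> differ at most by the factor
  \<open>\<kappa> powr \<bar>\<theta>\<bar>\<close>, which the extra
  \<open>X powr (- \<delta>)\<close> absorbs for large X.\<close>

lemma sparse_exceedances:
  assumes na: "\<not> abundant a (\<theta> + \<delta>)" and \<delta>: "\<delta> > 0"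
  shows "(\<lambda>n. real (card ({n. real n powr (- \<theta>) < a n} \<inter> {0..2 * n})) / real n) \<longlonglongrightarrow> 0"
proof (rule ccontr)
  let ?B = "{n. real n powr (- \<theta>) < a n}"
  assume "\<not> (\<lambda>n. real (card (?B \<inter> {0..2 * n})) / real n) \<longlonglongrightarrow> 0"
  then obtain \<kappa> where \<kappa>: "\<kappa> \<ge> 1" "\<And>X0. \<exists>X\<ge>X0. X \<le> card (?B \<inter> {X..\<kappa> * X})"
    using positive_density_windows by blast
  have "\<forall>\<^sub>F X :: nat in sequentially. real X powr (- \<delta>) < real \<kappa> powr (- \<bar>\<theta>\<bar>)"
    using \<delta> \<kappa>(1) by (intro order_tendstoD(2)) (real_asymp, simp)
  then obtain X1 where X1: "\<And>X. X \<ge> X1 \<Longrightarrow> real X powr (- \<delta>) < real \<kappa> powr (- \<bar>\<theta>\<bar>)"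
    unfolding eventually_sequentially by blast
  have "\<exists>X\<ge>X0. 1 * real X \<le> card {n \<in> {X..\<kappa> * X}. real X powr (- (\<theta> + \<delta>)) \<le> a n}" for X0
  proof -
    obtain X where X: "X \<ge> max X0 (max X1 1)" "X \<le> card (?B \<inter> {X..\<kappa> * X})" using \<kappa>(2) by blast
    have XX: "real X \<ge> 1" using X(1) by simp
    have "real X powr (- (\<theta> + \<delta>)) \<le> a n" if n: "n \<in> ?B" "X \<le> n" "n \<le> \<kappa> * X" for n
    proof -
      have nX: "real n / real X \<ge> 1" "real n / real X \<le> real \<kappa>"
        using n XX by (simp_all add: field_simps flip: of_nat_mult)
      have "real \<kappa> powr (- \<bar>\<theta>\<bar>) \<le> (real n / real X) powr (- \<bar>\<theta>\<bar>)"
        using nX by (intro powr_mono2') auto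
      also have "\<dots> \<le> (real n / real X) powr (- \<theta>)" using nX by (intro powr_mono) auto
      finally have "real X powr (- \<delta>) \<le> (real n / real X) powr (- \<theta>)" using X1[of X] X(1) by simp
      hence "real X powr (- \<delta>) * real X powr (- \<theta>) \<le> (real n / real X) powr (- \<theta>) * real X powr (- \<theta>)"
        by (intro mult_right_mono) auto
      also have "\<dots> = real n powr (- \<theta>)" using XX by (simp add: powr_mult[symmetric])
      also have "\<dots> \<le> a n" using n(1) by simp
      finally show ?thesis by (simp add: powr_add[symmetric] add.commute)
    qed
    hence "?B \<inter> {X..\<kappa> * X} \<subseteq> {n \<in> {X..\<kappa> * X}. real X powr (- (\<theta> + \<delta>)) \<le> a n}" by auto
    hence "card (?B \<inter> {X..\<kappa> * X}) \<le> card {n \<in> {X..\<kappa> * X}. real X powr (- (\<theta> + \<delta>)) \<le> a n}"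
      by (intro card_mono) auto
    thus ?thesis using X by (intro exI[of _ X]) auto
  qed
  hence "abundant a (\<theta> + \<delta>)" unfolding abundant_def by (intro exI[of _ "1 :: real"]) auto
  thus False using na by blast
qed

lemma limiting_density_one:
  assumes "(\<lambda>n. real (card (B \<inter> {0..2 * n})) / real n) \<longlonglongrightarrow> 0"
    and A: "A \<subseteq> {n. even n}" "{n. even n} - A - {0} \<subseteq> B"
  shows "has_limiting_density A 1"
proof -
  let ?f = "\<lambda>n. real (card (A \<inter> {0..2 * n})) / real n"
  have evens: "card ({n. even n} \<inter> {0..2 * n}) = n + 1" for n :: nat
  proof -
    have "{n. even n} \<inter> {0..2 * n} = (\<lambda>i. 2 * i) ` {..n}" by (auto elim!: evenE)
    thus ?thesis by (simp add: card_image inj_on_def)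
  qed
  have lower: "1 - real (card (B \<inter> {0..2 * n})) / real n \<le> ?f n" if "n \<ge> 1" for n
  proof -
    \<comment> \<open>There are \<open>n + 1\<close> even numbers up to \<open>2 * n\<close>;
      setting 0 aside leaves exactly \<open>n\<close> to account for.\<close>
    have "{n. even n} \<inter> {0..2 * n} \<subseteq> (A \<inter> {0..2 * n}) \<union> ((B \<inter> {0..2 * n}) \<union> {0})" using A(2) by auto
    hence "n + 1 \<le> card ((A \<inter> {0..2 * n}) \<union> ((B \<inter> {0..2 * n}) \<union> {0}))"
      unfolding evens[symmetric] by (intro card_mono) auto
    also have "\<dots> \<le> card (A \<inter> {0..2 * n}) + (card (B \<inter> {0..2 * n}) + 1)"
      using card_Un_le[of "A \<inter> {0..2 * n}" "(B \<inter> {0..2 * n}) \<union> {0}"]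
        card_Un_le[of "B \<inter> {0..2 * n}" "{0}"] by simp
    finally have "real n \<le> card (A \<inter> {0..2 * n}) + card (B \<inter> {0..2 * n})" by simp
    hence "1 \<le> (real (card (A \<inter> {0..2 * n})) + card (B \<inter> {0..2 * n})) / real n" using that by simp
    thus ?thesis unfolding add_divide_distrib by linarith
  qed
  have upper: "?f n \<le> (real n + 1) / real n" if "n \<ge> 1" for n
  proof -
    have "card (A \<inter> {0..2 * n}) \<le> n + 1"
      unfolding evens[symmetric] using A(1) by (intro card_mono) auto
    thus ?thesis by (intro divide_right_mono) auto
  qed
  have "?f \<longlonglongrightarrow> 1"
  proof (rule tendsto_sandwich)
    show "(\<lambda>n. 1 - real (card (B \<inter> {0..2 * n})) / real n) \<longlonglongrightarrow> 1"
      using tendsto_diff[OF tendsto_const assms(1), of 1] by simp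
    show "(\<lambda>n. (real n + 1) / real n) \<longlonglongrightarrow> 1" by real_asymp
    show "\<forall>\<^sub>F n in sequentially. 1 - real (card (B \<inter> {0..2 * n})) / real n \<le> ?f n"
      using lower eventually_sequentially by auto
    show "\<forall>\<^sub>F n in sequentially. ?f n \<le> (real n + 1) / real n"
      using upper eventually_sequentially by auto
  qed
  hence "(\<lambda>n. ereal (?f n)) \<longlonglongrightarrow> ereal 1" by simp
  thus ?thesis unfolding has_limiting_density_def limsup_density_def liminf_density_def
    using lim_imp_Limsup lim_imp_Liminf trivial_limit_sequentially by blast
qed

theorem corollary1p7:
  fixes \<delta> :: real
  assumes "CARD('d::finite) \<ge> 2"
    and "\<delta> > 0"
  shows "has_limiting_density
    {n. even n \<and>
        measure_pmf.prob (W3E n) {\<Gamma> :: nat \<Rightarrow> int ^ 'd. closes n \<Gamma>}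
          \<le> real n powr (- (1 - 1 / real CARD('d)) + \<delta>)} 1"
proof -
  define q where "q = 1 - 1 / real CARD('d)"
  define cw where "cw = (\<lambda>n. real (card (polygons n :: (int ^ 'd) list set)))"
  obtain \<mu> c \<rho> D :: real where mu: "\<mu> \<ge> 1" and pos: "c > 0" "\<rho> > 1" "D > 0"
    and walks: "\<And>n. n \<ge> 1 \<Longrightarrow> \<mu> ^ n \<le> card (walks n :: (int ^ 'd) list set)"
    and polygons: "\<And>n. n \<ge> 1 \<Longrightarrow> cw n \<le> D * real n ^ 3 * \<mu> ^ n"
    and rec: "\<And>H (X :: real) N (a :: real) (L :: real). finite H \<Longrightarrow> X \<ge> 1 \<Longrightarrow> a \<ge> 0 \<Longrightarrow> L \<ge> 0 \<Longrightarrow>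
      (\<And>n. n \<in> H \<Longrightarrow> X \<le> real n \<and> a * real n * \<mu> ^ n \<le> cw n) \<Longrightarrow>
      c * X powr q * a\<^sup>2 * card {(m, n) \<in> H \<times> H. m + n = N} * \<mu> ^ N
        \<le> L * cw (N + 6) / real (N + 6) + D * \<rho> powr (- L) * (real (N + 6))\<^sup>2 * \<mu> ^ N"
  proof (rule polygon_recurrence[OF assms(1)], goal_cases)
    case (1 \<mu> c \<rho> D)
    show thesis by (rule that[of \<mu> c \<rho> D], unfold q_def cw_def) (fact 1)+
  qed
  define a where "a = (\<lambda>n. cw n / (real n * \<mu> ^ n))"
  have cw_a: "cw n = a n * real n * \<mu> ^ n" if "n \<ge> 1" for n
    using that mu by (simp add: a_def)
  have upper: "a n \<le> D * (real n)\<^sup>2" if n: "n \<ge> 1" for n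
  proof -
    have "a n * (real n * \<mu> ^ n) \<le> D * (real n)\<^sup>2 * (real n * \<mu> ^ n)"
      using polygons[OF n] cw_a[OF n] by (simp add: eval_nat_numeral mult_ac)
    thus ?thesis using n mu by (simp add: mult_le_cancel_right_pos)
  qed
  \<comment> \<open>Dividing by \<open>\<mu> ^ N\<close> normalises both sides; the length shift
    leaves \<open>\<mu> ^ 6\<close>, which goes into the constant.\<close>
  have rec': "c / \<mu> ^ 6 * X powr q * b\<^sup>2 * card {(m, n) \<in> H \<times> H. m + n = N}
        \<le> L * a (N + 6) + D * \<rho> powr (- L) * (real (N + 6))\<^sup>2"
    if "finite H" "X \<ge> 1" "b \<ge> 0" "L \<ge> 0" and big: "\<And>n. n \<in> H \<Longrightarrow> X \<le> real n \<and> b \<le> a n"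
    for H N and X b L :: real
  proof -
    have "X \<le> real n \<and> b * real n * \<mu> ^ n \<le> cw n" if "n \<in> H" for n
    proof -
      have "real n \<ge> 1" using big[OF that] \<open>X \<ge> 1\<close> by linarith
      hence "cw n = a n * real n * \<mu> ^ n" by (intro cw_a) simp
      thus ?thesis using big[OF that] mu by (auto intro!: mult_right_mono)
    qed
    from rec[OF that(1-4) this, of N]
    have "c * X powr q * b\<^sup>2 * card {(m, n) \<in> H \<times> H. m + n = N} * \<mu> ^ N
        \<le> L * cw (N + 6) / real (N + 6) + D * \<rho> powr (- L) * (real (N + 6))\<^sup>2 * \<mu> ^ N" by blast
    also have "L * cw (N + 6) / real (N + 6) = L * a (N + 6) * \<mu> ^ 6 * \<mu> ^ N"
      using cw_a[of "N + 6"] by (simp add: power_add mult_ac)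
    also have "D * \<rho> powr (- L) * (real (N + 6))\<^sup>2 * \<mu> ^ N
        \<le> D * \<rho> powr (- L) * (real (N + 6))\<^sup>2 * \<mu> ^ 6 * \<mu> ^ N"
    proof (rule mult_right_mono)
      have "D * \<rho> powr (- L) * (real (N + 6))\<^sup>2 * 1 \<le> D * \<rho> powr (- L) * (real (N + 6))\<^sup>2 * \<mu> ^ 6"
        using mu pos by (intro mult_left_mono one_le_power) auto
      thus "D * \<rho> powr (- L) * (real (N + 6))\<^sup>2 \<le> D * \<rho> powr (- L) * (real (N + 6))\<^sup>2 * \<mu> ^ 6" by simp
    qed (use mu in simp)
    finally have "c * X powr q * b\<^sup>2 * card {(m, n) \<in> H \<times> H. m + n = N} * \<mu> ^ N
        \<le> (L * a (N + 6) + D * \<rho> powr (- L) * (real (N + 6))\<^sup>2) * \<mu> ^ 6 * \<mu> ^ N"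
      by (simp only: distrib_right)
    hence "c * X powr q * b\<^sup>2 * card {(m, n) \<in> H \<times> H. m + n = N}
        \<le> (L * a (N + 6) + D * \<rho> powr (- L) * (real (N + 6))\<^sup>2) * \<mu> ^ 6"
      using mu by (simp add: mult_le_cancel_right_pos)
    hence "c * X powr q * b\<^sup>2 * card {(m, n) \<in> H \<times> H. m + n = N} / \<mu> ^ 6
        \<le> L * a (N + 6) + D * \<rho> powr (- L) * (real (N + 6))\<^sup>2"
      using mu by (subst pos_divide_le_eq) auto
    thus ?thesis by simp
  qed
  have c6: "c / \<mu> ^ 6 > 0" using pos(1) mu by simp
  \<comment> \<open>One half of \<open>\<delta>\<close> is the excess refuted by the bootstrap, the
    other pays for replacing the scale \<open>X\<close> by the length \<open>n\<close>.\<close>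
  have half: "\<delta> / 2 > 0" using assms(2) by simp
  have "\<not> abundant a (1 + q - \<delta> / 2)"
    by (rule not_abundant_above[OF c6 pos(2,3) _ _ half]) (fact upper, fact rec')
  moreover have "1 + q - \<delta> / 2 = (1 + q - \<delta>) + \<delta> / 2" by (simp add: field_simps)
  ultimately have na: "\<not> abundant a ((1 + q - \<delta>) + \<delta> / 2)" by metis
  have sparse: "(\<lambda>n. real (card ({n. real n powr (- (1 + q - \<delta>)) < a n} \<inter> {0..2 * n})) / real n) \<longlonglongrightarrow> 0"
    by (rule sparse_exceedances[OF na half])
  let ?A = "{n. even n \<and> measure_pmf.prob (W3E n) {\<Gamma> :: nat \<Rightarrow> int ^ 'd. closes n \<Gamma>}
      \<le> real n powr (- q + \<delta>)}"
  \<comment> \<open>Bounding the number of walks below by \<open>\<mu> ^ n\<close> bounds the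
    closing probability by \<open>n * a n\<close>; this factor n is the 1 in the exponent
    \<open>1 + q - \<delta>\<close>.\<close>
  have "{n. even n} - ?A - {0} \<subseteq> {n. real n powr (- (1 + q - \<delta>)) < a n}"
  proof (rule subsetI)
    fix n assume "n \<in> {n. even n} - ?A - {0}"
    hence n: "n \<noteq> 0" "\<not> measure_pmf.prob (W3E n) {\<Gamma> :: nat \<Rightarrow> int ^ 'd. closes n \<Gamma>}
      \<le> real n powr (- q + \<delta>)" by auto
    have n1: "n \<ge> 1" using n(1) by simp
    have "real n powr (- q + \<delta>) < cw n / card (walks n :: (int ^ 'd) list set)"
      using n(2) prob_closes[OF n1, where 'd = 'd] by (simp add: cw_def)
    also have "\<dots> \<le> cw n / \<mu> ^ n"
    proof (rule divide_left_mono[OF walks[OF n1]])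
      have "0 < \<mu> ^ n" using mu by simp
      moreover from this have "0 < real (card (walks n :: (int ^ 'd) list set))"
        using walks[OF n1] by (rule less_le_trans)
      ultimately show "0 < real (card (walks n :: (int ^ 'd) list set)) * \<mu> ^ n" by simp
    qed (simp add: cw_def)
    also have "\<dots> = a n * real n" using n1 by (simp add: a_def)
    finally have "real n powr (- q + \<delta>) / real n < a n" using n1 by (simp add: pos_divide_less_eq)
    moreover have "real n powr (- (1 + q - \<delta>)) = real n powr (- q + \<delta>) / real n"
    proof -
      have "- (1 + q - \<delta>) = (- q + \<delta>) - 1" by simp
      thus ?thesis using n1 by (simp only: powr_diff) simp
    qed
    ultimately show "n \<in> {n. real n powr (- (1 + q - \<delta>)) < a n}" by simp
  qed
  hence "has_limiting_density ?A 1" by (intro limiting_density_one[OF sparse]) auto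
  thus ?thesis unfolding q_def .
qed

end
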